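(* Let $V$ be a Stein variety, $x\in V$ a point, and $\gamma: V\to V$ an invertible holomorphic contraction centered in $x$. Assume that the cyclic group $\langle\gamma\rangle$ generated by $\gamma$ acts on $V\setminus\{x\}$ properly discontinuously, and that $V\setminus\{x\}$ is smooth. Then the quotient manifold $\frac{V\setminus\{x\}}{\langle\gamma\rangle}$ admits an LCK metric with potential.
   Context: A holomorphic contraction of a complex variety $V$ centered in $x\in V$ is a holomorphic map $\gamma: V\to V$ with $\gamma(x)=x$ such that for each compact subset $K\subset V$ and each open neighbourhood $U\ni x$ there exists $N>0$ such that $\gamma^n(K)\subset U$ for every integer $n>N$. It is invertible if it is a biholomorphic automorphism of $V$. A complex manifold $M$ is locally conformally Kähler (LCK) if it admits a covering $\tilde M$ (with the pulled-back complex structure) equipped with a Kähler metric $\tilde\omega$ such that the deck group of the covering acts on $(\tilde M,\tilde\omega)$ by holomorphic homotheties (each deck transformation multiplies $\tilde\omega$ by a positive constant). An LCK metric on $M$ is a Hermitian metric on $M$ whose pullback to $\tilde M$ is conformal to $\tilde\omega$. The LCK manifold has LCK potential (one says it is an LCK manifold with potential, or admits an LCK metric with potential) if it admits such a Kähler covering $(\tilde M,\tilde\omega)$ on which the Kähler metric has a global positive Kähler potential $\psi:\tilde M\to\mathbb{R}_{>0}$ (i.e. $\tilde\omega=dd^c\psi$, a positive constant multiple of $\sqrt{-1}\,\partial\bar\partial\psi$) such that each element of the deck group multiplies $\psi$ by a constant. *)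

theory Defs
  imports "HOL-Analysis.Analysis" "HOL-Algebra.Bij" "HOL-Algebra.Generated_Groups"
begin

section \<open>Holomorphic functions and analytic sets in complex n-space\<close>

text \<open>
  The dimension of a local model is existentially quantified and may vary from point to point, so
  complex n-space cannot be a type. As in \<open>Euclidean_space\<close>, it is the set of sequences vanishing
  from index \<open>n\<close> on. The topology is the one induced by the product topology on
  \<open>nat \<Rightarrow> complex\<close>, i.e. the usual one.
\<close>

type_synonym cvec = "nat \<Rightarrow> complex"

definition Cn :: "nat \<Rightarrow> cvec set" where
  "Cn n = {v. \<forall>i\<ge>n. v i = 0}"

abbreviation open_Cn :: "nat \<Rightarrow> cvec set \<Rightarrow> bool" where
  "open_Cn n D \<equiv> openin (top_of_set (Cn n)) D"

definition holomorphic_Cn :: "nat \<Rightarrow> cvec set \<Rightarrow> (cvec \<Rightarrow> complex) \<Rightarrow> bool" where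
  "holomorphic_Cn n D f \<longleftrightarrow> open_Cn n D \<and> continuous_on D f \<and>
     (\<forall>z\<in>D. \<forall>i<n. (\<lambda>w. f (z(i := w))) field_differentiable at (z i))"

definition analytic_subset :: "nat \<Rightarrow> cvec set \<Rightarrow> cvec set \<Rightarrow> bool" where
  "analytic_subset n D A \<longleftrightarrow> open_Cn n D \<and> A \<subseteq> D \<and>
     (\<forall>z\<in>D. \<exists>W F. open_Cn n W \<and> z \<in> W \<and> W \<subseteq> D \<and> finite F \<and>
        (\<forall>f\<in>F. holomorphic_Cn n W f) \<and> A \<inter> W = {w\<in>W. \<forall>f\<in>F. f w = 0})"

text \<open>
  Holomorphic functions on a relatively open piece \<open>B\<close> of an analytic set (with its reduced
  structure): those which locally extend to holomorphic functions of the ambient space.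
\<close>

definition holomorphic_on_set :: "nat \<Rightarrow> cvec set \<Rightarrow> (cvec \<Rightarrow> complex) \<Rightarrow> bool" where
  "holomorphic_on_set n B f \<longleftrightarrow>
     (\<forall>z\<in>B. \<exists>W F. z \<in> W \<and> holomorphic_Cn n W F \<and> (\<forall>w\<in>W \<inter> B. F w = f w))"


section \<open>Complex varieties and complex manifolds\<close>

text \<open>
  A topological space with, for every open set \<open>U\<close>, the set \<open>hol_fns X U\<close> of functions which are
  holomorphic on \<open>U\<close>. Functions are total; only their values on \<open>U\<close> matter, and
  \<open>hol_fns X U\<close> is irrelevant unless \<open>U\<close> is open.
\<close>

record 'a complex_space =
  Top :: "'a topology"
  hol_fns :: "'a set \<Rightarrow> ('a \<Rightarrow> complex) set"

abbreviation points :: "'a complex_space \<Rightarrow> 'a set" where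
  "points X \<equiv> topspace (Top X)"

definition is_function_sheaf :: "'a complex_space \<Rightarrow> bool" where
  "is_function_sheaf X \<longleftrightarrow>
     (\<forall>U W f. openin (Top X) U \<and> openin (Top X) W \<and> W \<subseteq> U \<and> f \<in> hol_fns X U \<longrightarrow> f \<in> hol_fns X W) \<and>
     (\<forall>\<U> f. (\<forall>U\<in>\<U>. openin (Top X) U \<and> f \<in> hol_fns X U) \<longrightarrow> f \<in> hol_fns X (\<Union>\<U>)) \<and>
     (\<forall>U f g. openin (Top X) U \<and> f \<in> hol_fns X U \<and> (\<forall>y\<in>U. g y = f y) \<longrightarrow> g \<in> hol_fns X U)"

text \<open>A chart consists of the dimension of its target, its domain and the coordinate map.\<close>

type_synonym 'a chart = "nat \<times> 'a set \<times> ('a \<Rightarrow> cvec)"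

definition cdim :: "'a chart \<Rightarrow> nat" where "cdim c = fst c"
definition cdom :: "'a chart \<Rightarrow> 'a set" where "cdom c = fst (snd c)"
definition coord :: "'a chart \<Rightarrow> 'a \<Rightarrow> cvec" where "coord c = snd (snd c)"
definition cimage :: "'a chart \<Rightarrow> cvec set" where "cimage c = coord c ` cdom c"
definition cinv :: "'a chart \<Rightarrow> cvec \<Rightarrow> 'a" where "cinv c = inv_into (cdom c) (coord c)"

definition local_model :: "'a complex_space \<Rightarrow> 'a chart \<Rightarrow> bool" where
  "local_model X c \<longleftrightarrow> openin (Top X) (cdom c) \<and>
     (\<exists>D. analytic_subset (cdim c) D (cimage c)) \<and>
     homeomorphic_map (subtopology (Top X) (cdom c)) (top_of_set (cimage c)) (coord c) \<and>
     (\<forall>W f. openin (Top X) W \<and> W \<subseteq> cdom c \<longrightarrow>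
        (f \<in> hol_fns X W \<longleftrightarrow> holomorphic_on_set (cdim c) (coord c ` W) (f \<circ> cinv c)))"

text \<open>
  Complex varieties are reduced complex spaces with countable topology. Neither irreducibility nor
  pure dimensionality is required.
\<close>

definition complex_variety :: "'a complex_space \<Rightarrow> bool" where
  "complex_variety X \<longleftrightarrow> Hausdorff_space (Top X) \<and> second_countable (Top X) \<and> is_function_sheaf X \<and>
     (\<forall>y\<in>points X. \<exists>c. local_model X c \<and> y \<in> cdom c)"

definition charts :: "'a complex_space \<Rightarrow> 'a chart set" where
  "charts X = {c. local_model X c \<and> open_Cn (cdim c) (cimage c)}"

definition complex_manifold :: "'a complex_space \<Rightarrow> bool" where
  "complex_manifold X \<longleftrightarrow> complex_variety X \<and> (\<forall>y\<in>points X. \<exists>c\<in>charts X. y \<in> cdom c)"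

definition open_subspace :: "'a complex_space \<Rightarrow> 'a set \<Rightarrow> 'a complex_space" where
  "open_subspace X S = \<lparr>Top = subtopology (Top X) S, hol_fns = hol_fns X\<rparr>"

definition holomorphic_map :: "'a complex_space \<Rightarrow> 'b complex_space \<Rightarrow> ('a \<Rightarrow> 'b) \<Rightarrow> bool" where
  "holomorphic_map X Y F \<longleftrightarrow> continuous_map (Top X) (Top Y) F \<and>
     (\<forall>W f. openin (Top Y) W \<and> f \<in> hol_fns Y W \<longrightarrow>
        f \<circ> F \<in> hol_fns X {y\<in>points X. F y \<in> W})"

definition biholomorphic_map :: "'a complex_space \<Rightarrow> 'b complex_space \<Rightarrow> ('a \<Rightarrow> 'b) \<Rightarrow> bool" where
  "biholomorphic_map X Y F \<longleftrightarrow> holomorphic_map X Y F \<and>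
     (\<exists>G. holomorphic_map Y X G \<and> (\<forall>y\<in>points X. G (F y) = y) \<and> (\<forall>y\<in>points Y. F (G y) = y))"


section \<open>Stein varieties and holomorphic contractions\<close>

definition holomorphic_hull :: "'a complex_space \<Rightarrow> 'a set \<Rightarrow> 'a set" where
  "holomorphic_hull X K = {y\<in>points X. \<forall>f\<in>hol_fns X (points X).
     \<forall>b. (\<forall>z\<in>K. cmod (f z) \<le> b) \<longrightarrow> cmod (f y) \<le> b}"

definition stein_variety :: "'a complex_space \<Rightarrow> bool" where
  "stein_variety X \<longleftrightarrow> complex_variety X \<and>
     (\<forall>K. compactin (Top X) K \<longrightarrow> compactin (Top X) (holomorphic_hull X K)) \<and>
     (\<forall>y\<in>points X. \<forall>z\<in>points X. y \<noteq> z \<longrightarrow> (\<exists>f\<in>hol_fns X (points X). f y \<noteq> f z))"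

definition holomorphic_contraction :: "'a complex_space \<Rightarrow> 'a \<Rightarrow> ('a \<Rightarrow> 'a) \<Rightarrow> bool" where
  "holomorphic_contraction X x \<gamma> \<longleftrightarrow> holomorphic_map X X \<gamma> \<and> \<gamma> x = x \<and>
     (\<forall>K U. compactin (Top X) K \<and> openin (Top X) U \<and> x \<in> U \<longrightarrow>
        (\<exists>N>0. \<forall>n>N. (\<gamma> ^^ n) ` K \<subseteq> U))"


section \<open>Cyclic groups of transformations and quotients\<close>

definition cyclic_group :: "'a set \<Rightarrow> ('a \<Rightarrow> 'a) \<Rightarrow> ('a \<Rightarrow> 'a) set" where
  "cyclic_group S \<gamma> = generate (BijGroup S) {restrict \<gamma> S}"

definition properly_discontinuous :: "'a topology \<Rightarrow> ('a \<Rightarrow> 'a) set \<Rightarrow> bool" where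
  "properly_discontinuous X G \<longleftrightarrow> (\<forall>K. compactin X K \<longrightarrow> finite {g\<in>G. g ` K \<inter> K \<noteq> {}})"

definition group_orbit :: "('a \<Rightarrow> 'a) set \<Rightarrow> 'a \<Rightarrow> 'a set" where
  "group_orbit G y = (\<lambda>g. g y) ` G"

definition quotient_topology :: "'a topology \<Rightarrow> ('a \<Rightarrow> 'b) \<Rightarrow> 'b topology" where
  "quotient_topology X q = topology (\<lambda>W. W \<subseteq> q ` topspace X \<and> openin X {y\<in>topspace X. q y \<in> W})"

lemma openin_quotient_topology:
  "openin (quotient_topology X q) W \<longleftrightarrow>
     W \<subseteq> q ` topspace X \<and> openin X {y\<in>topspace X. q y \<in> W}"
proof -
  have "istopology (\<lambda>W. W \<subseteq> q ` topspace X \<and> openin X {y\<in>topspace X. q y \<in> W})"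
    unfolding istopology_def
  proof (intro conjI allI impI)
    fix S T
    assume "S \<subseteq> q ` topspace X \<and> openin X {y\<in>topspace X. q y \<in> S}"
      and "T \<subseteq> q ` topspace X \<and> openin X {y\<in>topspace X. q y \<in> T}"
    moreover have "{y\<in>topspace X. q y \<in> S \<inter> T} =
        {y\<in>topspace X. q y \<in> S} \<inter> {y\<in>topspace X. q y \<in> T}"
      by blast
    ultimately show "S \<inter> T \<subseteq> q ` topspace X" "openin X {y\<in>topspace X. q y \<in> S \<inter> T}"
      by auto
  next
    fix \<K>
    assume *: "\<forall>K\<in>\<K>. K \<subseteq> q ` topspace X \<and> openin X {y\<in>topspace X. q y \<in> K}"
    have "{y\<in>topspace X. q y \<in> \<Union>\<K>} = (\<Union>K\<in>\<K>. {y\<in>topspace X. q y \<in> K})"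
      by blast
    with * show "\<Union>\<K> \<subseteq> q ` topspace X" "openin X {y\<in>topspace X. q y \<in> \<Union>\<K>}"
      by auto
  qed
  then show ?thesis
    by (simp add: quotient_topology_def topology_inverse')
qed

lemma quotient_map_quotient_topology: "quotient_map X (quotient_topology X q) q"
proof -
  have "{y\<in>topspace X. q y \<in> q ` topspace X} = topspace X"
    by blast
  then have "openin (quotient_topology X q) (q ` topspace X)"
    by (simp add: openin_quotient_topology)
  then have "topspace (quotient_topology X q) = q ` topspace X"
    by (meson openin_quotient_topology openin_subset openin_topspace subset_antisym)
  then show ?thesis
    by (simp add: quotient_map_def openin_quotient_topology)
qed

definition quotient_space :: "'a complex_space \<Rightarrow> ('a \<Rightarrow> 'a) set \<Rightarrow> 'a set complex_space" where
  "quotient_space X G =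
     \<lparr>Top = quotient_topology (Top X) (group_orbit G),
      hol_fns = (\<lambda>W. {f. f \<circ> group_orbit G \<in> hol_fns X {y\<in>points X. group_orbit G y \<in> W}})\<rparr>"


section \<open>Coverings\<close>

definition covering_map :: "'c topology \<Rightarrow> 'b topology \<Rightarrow> ('c \<Rightarrow> 'b) \<Rightarrow> bool" where
  "covering_map T X p \<longleftrightarrow> continuous_map T X p \<and> p ` topspace T = topspace X \<and>
     (\<forall>y\<in>topspace X. \<exists>W. y \<in> W \<and> openin X W \<and>
        (\<exists>\<V>. \<Union>\<V> = {z\<in>topspace T. p z \<in> W} \<and> (\<forall>U\<in>\<V>. openin T U) \<and> pairwise disjnt \<V> \<and>
           (\<forall>U\<in>\<V>. homeomorphic_map (subtopology T U) (subtopology X W) p)))"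

definition deck_transformation :: "'c topology \<Rightarrow> ('c \<Rightarrow> 'b) \<Rightarrow> ('c \<Rightarrow> 'c) \<Rightarrow> bool" where
  "deck_transformation T p g \<longleftrightarrow> homeomorphic_map T T g \<and> (\<forall>z\<in>topspace T. p (g z) = p z)"

text \<open>
  The pulled-back complex structure: locally, the holomorphic functions on the covering are the
  compositions of \<open>p\<close> with holomorphic functions on the base.
\<close>

definition pullback_structure :: "'c topology \<Rightarrow> ('c \<Rightarrow> 'b) \<Rightarrow> 'b complex_space \<Rightarrow> 'c complex_space" where
  "pullback_structure T p X =
     \<lparr>Top = T,
      hol_fns = (\<lambda>U. {h. \<forall>z\<in>U. \<exists>U' W f. openin T U' \<and> z \<in> U' \<and> U' \<subseteq> U \<and> openin (Top X) W \<and>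
                    p ` U' \<subseteq> W \<and> f \<in> hol_fns X W \<and> (\<forall>w\<in>U'. h w = f (p w))})\<rparr>"


section \<open>Differential forms in coordinates\<close>

definition scale_cvec :: "complex \<Rightarrow> cvec \<Rightarrow> cvec" where
  "scale_cvec a u = (\<lambda>k. a * u k)"

definition add_cvec :: "cvec \<Rightarrow> cvec \<Rightarrow> cvec" where
  "add_cvec u v = (\<lambda>k. u k + v k)"

definition shift :: "cvec \<Rightarrow> cvec \<Rightarrow> real \<Rightarrow> cvec" where
  "shift z u t = add_cvec z (scale_cvec (of_real t) u)"

text \<open>The derivative of \<open>f\<close> along the constant real vector field \<open>u\<close>.\<close>

definition dir_deriv :: "cvec \<Rightarrow> (cvec \<Rightarrow> 'v::real_normed_vector) \<Rightarrow> cvec \<Rightarrow> 'v" where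
  "dir_deriv u f z = vector_derivative (\<lambda>t. f (shift z u t)) (at 0)"

definition smooth_Cn :: "nat \<Rightarrow> cvec set \<Rightarrow> (cvec \<Rightarrow> real) \<Rightarrow> bool" where
  "smooth_Cn n D f \<longleftrightarrow>
     (\<forall>us. set us \<subseteq> Cn n \<longrightarrow>
        continuous_on D (foldr dir_deriv us f) \<and>
        (\<forall>z\<in>D. \<forall>u\<in>Cn n. (\<lambda>t. foldr dir_deriv us f (shift z u t)) differentiable at 0))"

definition smooth_function :: "'a complex_space \<Rightarrow> ('a \<Rightarrow> real) \<Rightarrow> bool" where
  "smooth_function M f \<longleftrightarrow> (\<forall>c\<in>charts M. smooth_Cn (cdim c) (cimage c) (f \<circ> cinv c))"

text \<open>
  A real 2-form is given by its coordinate expressions: \<open>\<omega> c z u v\<close> is the value, in the chart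
  \<open>c\<close> and at the point with coordinates \<open>z\<close>, on the tangent vectors with coordinates \<open>u\<close> and
  \<open>v\<close>. The complex structure of the tangent spaces is multiplication of \<open>u\<close> by \<open>\<i>\<close>.
\<close>

type_synonym 'a form2 = "'a chart \<Rightarrow> cvec \<Rightarrow> cvec \<Rightarrow> cvec \<Rightarrow> real"

definition push :: "('a \<Rightarrow> 'b) \<Rightarrow> 'a chart \<Rightarrow> 'b chart \<Rightarrow> cvec \<Rightarrow> cvec \<Rightarrow> cvec" where
  "push F c d z u = (\<lambda>k. dir_deriv u (\<lambda>w. coord d (F (cinv c w)) k) z)"

text \<open>\<open>is_pullback_on S M N F \<eta> \<omega>\<close>: at the points of \<open>S\<close>, the form \<open>\<eta>\<close> on \<open>M\<close> is the pullback of
  the form \<open>\<omega>\<close> on \<open>N\<close> under \<open>F\<close>.\<close>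

definition is_pullback_on ::
  "'a set \<Rightarrow> 'a complex_space \<Rightarrow> 'b complex_space \<Rightarrow> ('a \<Rightarrow> 'b) \<Rightarrow> 'a form2 \<Rightarrow> 'b form2 \<Rightarrow> bool" where
  "is_pullback_on S M N F \<eta> \<omega> \<longleftrightarrow>
     (\<forall>c\<in>charts M. \<forall>d\<in>charts N. \<forall>y\<in>S \<inter> cdom c. F y \<in> cdom d \<longrightarrow>
        (\<forall>u\<in>Cn (cdim c). \<forall>v\<in>Cn (cdim c).
           \<eta> c (coord c y) u v =
             \<omega> d (coord d (F y)) (push F c d (coord c y) u) (push F c d (coord c y) v)))"

definition mult_form :: "('a \<Rightarrow> real) \<Rightarrow> 'a form2 \<Rightarrow> 'a form2" where
  "mult_form f \<omega> = (\<lambda>c z u v. f (cinv c z) * \<omega> c z u v)"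

text \<open>The last condition is the compatibility of the coordinate expressions in different charts.\<close>

definition smooth_form2 :: "'a complex_space \<Rightarrow> 'a form2 \<Rightarrow> bool" where
  "smooth_form2 M \<omega> \<longleftrightarrow>
     (\<forall>c\<in>charts M.
        (\<forall>u\<in>Cn (cdim c). \<forall>v\<in>Cn (cdim c). smooth_Cn (cdim c) (cimage c) (\<lambda>z. \<omega> c z u v)) \<and>
        (\<forall>z\<in>cimage c. \<forall>u\<in>Cn (cdim c). \<forall>v\<in>Cn (cdim c).
           \<omega> c z v u = - \<omega> c z u v \<and>
           (\<forall>w\<in>Cn (cdim c). \<omega> c z (add_cvec u w) v = \<omega> c z u v + \<omega> c z w v) \<and>
           (\<forall>a::real. \<omega> c z (scale_cvec (of_real a) u) v = a * \<omega> c z u v))) \<and>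
     is_pullback_on (points M) M M id \<omega> \<omega>"

text \<open>The coordinate formulas for the exterior derivative on constant vector fields.\<close>

definition ext_deriv1 :: "(cvec \<Rightarrow> cvec \<Rightarrow> real) \<Rightarrow> cvec \<Rightarrow> cvec \<Rightarrow> cvec \<Rightarrow> real" where
  "ext_deriv1 \<alpha> z u v = dir_deriv u (\<lambda>w. \<alpha> w v) z - dir_deriv v (\<lambda>w. \<alpha> w u) z"

definition ext_deriv2 :: "(cvec \<Rightarrow> cvec \<Rightarrow> cvec \<Rightarrow> real) \<Rightarrow> cvec \<Rightarrow> cvec \<Rightarrow> cvec \<Rightarrow> cvec \<Rightarrow> real" where
  "ext_deriv2 \<beta> z u v w =
     dir_deriv u (\<lambda>x. \<beta> x v w) z - dir_deriv v (\<lambda>x. \<beta> x u w) z + dir_deriv w (\<lambda>x. \<beta> x u v) z"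

text \<open>
  With \<open>d\<^sup>c f = - df \<circ> I\<close>, so that \<open>d d\<^sup>c f\<close> is \<open>2 \<i> \<partial> \<partial>bar f\<close>, which is positive on
  \<open>(u, I u)\<close> for strictly plurisubharmonic \<open>f\<close>.
\<close>

definition dc :: "(cvec \<Rightarrow> real) \<Rightarrow> cvec \<Rightarrow> cvec \<Rightarrow> real" where
  "dc f z v = - dir_deriv (scale_cvec \<i> v) f z"

definition ddc :: "(cvec \<Rightarrow> real) \<Rightarrow> cvec \<Rightarrow> cvec \<Rightarrow> cvec \<Rightarrow> real" where
  "ddc f = ext_deriv1 (dc f)"


section \<open>LCK metrics with potential\<close>

text \<open>
  A Hermitian metric \<open>g\<close> is identified with its fundamental form \<open>\<omega>(u,v) = g(Iu,v)\<close>, a real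
  (1,1)-form with \<open>\<omega>(u,Iu) = g(u,u) > 0\<close> for \<open>u \<noteq> 0\<close>.
\<close>

definition hermitian_metric :: "'a complex_space \<Rightarrow> 'a form2 \<Rightarrow> bool" where
  "hermitian_metric M \<omega> \<longleftrightarrow> smooth_form2 M \<omega> \<and>
     (\<forall>c\<in>charts M. \<forall>z\<in>cimage c. \<forall>u\<in>Cn (cdim c).
        (\<forall>v\<in>Cn (cdim c). \<omega> c z (scale_cvec \<i> u) (scale_cvec \<i> v) = \<omega> c z u v) \<and>
        (u \<noteq> (\<lambda>_. 0) \<longrightarrow> \<omega> c z u (scale_cvec \<i> u) > 0))"

definition kaehler_metric :: "'a complex_space \<Rightarrow> 'a form2 \<Rightarrow> bool" where
  "kaehler_metric M \<omega> \<longleftrightarrow> hermitian_metric M \<omega> \<and>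
     (\<forall>c\<in>charts M. \<forall>z\<in>cimage c.
        \<forall>u\<in>Cn (cdim c). \<forall>v\<in>Cn (cdim c). \<forall>w\<in>Cn (cdim c). ext_deriv2 (\<omega> c) z u v w = 0)"

definition kaehler_potential :: "'a complex_space \<Rightarrow> 'a form2 \<Rightarrow> ('a \<Rightarrow> real) \<Rightarrow> bool" where
  "kaehler_potential M \<omega> \<psi> \<longleftrightarrow> smooth_function M \<psi> \<and>
     (\<forall>c\<in>charts M. \<forall>z\<in>cimage c. \<forall>u\<in>Cn (cdim c). \<forall>v\<in>Cn (cdim c).
        \<omega> c z u v = ddc (\<psi> \<circ> cinv c) z u v)"

text \<open>
  Manifolds and coverings are not assumed to be connected. On a disconnected covering a deck
  transformation may act independently on the components (already when the base is a disjoint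
  union of two manifolds), so its scaling factor is a constant on every connected component; on a
  connected covering this is just a constant.
\<close>

definition kaehler_covering ::
  "'b complex_space \<Rightarrow> 'c topology \<Rightarrow> ('c \<Rightarrow> 'b) \<Rightarrow> 'c form2 \<Rightarrow> bool" where
  "kaehler_covering M T p \<omega> \<longleftrightarrow>
     covering_map T (Top M) p \<and> complex_manifold (pullback_structure T p M) \<and>
     kaehler_metric (pullback_structure T p M) \<omega> \<and>
     (\<forall>g. deck_transformation T p g \<longrightarrow>
        (\<forall>K\<in>connected_components_of T. \<exists>a>0.
           is_pullback_on K (pullback_structure T p M) (pullback_structure T p M) g
             (mult_form (\<lambda>_. a) \<omega>) \<omega>))"

definition automorphic_potential ::
  "'b complex_space \<Rightarrow> 'c topology \<Rightarrow> ('c \<Rightarrow> 'b) \<Rightarrow> 'c form2 \<Rightarrow> ('c \<Rightarrow> real) \<Rightarrow> bool" where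
  "automorphic_potential M T p \<omega> \<psi> \<longleftrightarrow>
     kaehler_potential (pullback_structure T p M) \<omega> \<psi> \<and> (\<forall>z\<in>topspace T. \<psi> z > 0) \<and>
     (\<forall>g. deck_transformation T p g \<longrightarrow>
        (\<forall>K\<in>connected_components_of T. \<exists>a. \<forall>z\<in>K. \<psi> (g z) = a * \<psi> z))"

text \<open>
  The covering lives on the type \<open>'b \<times> nat\<close>: a covering with countable fibres, in particular every
  connected covering of a connected manifold, has an isomorphic copy there.
\<close>

definition lck_metric_with_potential :: "'b complex_space \<Rightarrow> 'b form2 \<Rightarrow> bool" where
  "lck_metric_with_potential M \<eta> \<longleftrightarrow> hermitian_metric M \<eta> \<and>
     (\<exists>(T :: ('b \<times> nat) topology) p \<omega> \<psi> f.
        kaehler_covering M T p \<omega> \<and> automorphic_potential M T p \<omega> \<psi> \<and>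
        smooth_function (pullback_structure T p M) f \<and> (\<forall>z\<in>topspace T. f z > 0) \<and>
        is_pullback_on (topspace T) (pullback_structure T p M) M p (mult_form f \<omega>) \<eta>)"

definition admits_lck_metric_with_potential :: "'b complex_space \<Rightarrow> bool" where
  "admits_lck_metric_with_potential M \<longleftrightarrow>
     complex_manifold M \<and> (\<exists>\<eta>. lck_metric_with_potential M \<eta>)"

end

theory Submission
  imports Defs "HOL-Complex_Analysis.Cauchy_Integral_Formula"
begin

text \<open>
  Suppose that \<open>V - {x}\<close> carries a positive, smooth, strictly plurisubharmonic function
  \<open>\<psi>\<close> that \<open>\<gamma>\<close> multiplies by a constant. The action of \<open>\<gamma>\<close> on \<open>V - {x}\<close> is free and wandering,
  because a contraction pushes every compact set into any neighbourhood of \<open>x\<close>; so \<open>V - {x}\<close>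
  covers the quotient, and a deck transformation agrees with a power of \<open>\<gamma>\<close> on each component
  (lemma \<open>deck_shift\<close>). Hence \<open>dd\<^sup>c \<psi>\<close> is a Kaehler metric on the covering on which deck
  transformations act by homotheties, with automorphic potential \<open>\<psi>\<close>, and \<open>\<psi>\<^sup>-\<^sup>1 dd\<^sup>c \<psi>\<close> is
  invariant and descends to a Hermitian metric on the quotient (lemma \<open>eta_pullback\<close>).

  The function \<open>\<psi>\<close> is a sum over the group. Let \<open>\<kappa>\<close> be the coordinate map of a local model around
  \<open>x\<close>, let \<open>\<phi> = |\<kappa> - \<kappa>(x)|\<^sup>2\<close>, and choose \<open>r\<close> such that \<open>{\<phi> \<le> r}\<close> is compact. Take
  \<open>g = \<chi>(\<phi>)\<close>, where \<open>\<chi>\<close> is a smooth bump supported in \<open>[\<epsilon>, r]\<close> which is increasing and convex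
  on \<open>[\<epsilon>, r/2]\<close>, and put
  \<open>\<psi>(y) = \<Sum>k. \<Lambda>\<^sup>k g(\<gamma>\<^sup>k y)\<close>. The sum over all integers is locally finite, and
  \<open>\<psi>(\<gamma> y) = \<Lambda>\<^sup>-\<^sup>1 \<psi>(y)\<close> holds by reindexing. It remains to see that \<open>\<psi>\<close> is strictly
  plurisubharmonic for large \<open>\<Lambda>\<close> (lemma \<open>exists_automorphic_potential\<close>).

  A term with \<open>\<phi>(\<gamma>\<^sup>k y) \<le> r/2\<close> has nonnegative Levi form. A term whose argument \<open>\<gamma>\<^sup>k y\<close> lies in the
  outer shell \<open>r/2 \<le> \<phi> \<le> r\<close> may be negative, but its Levi form is at least
  \<open>- D |d(\<kappa> \<gamma>\<^sup>k)|\<^sup>2\<close>. Fix \<open>N\<close> such that \<open>\<gamma>\<^sup>N\<close> maps the outer shell into \<open>{\<epsilon> < \<phi> < r/2}\<close>.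
  Then the term of index \<open>k + N\<close> has Levi form at least \<open>4 c |d(\<kappa> \<gamma>\<^sup>k\<^sup>+\<^sup>N)|\<^sup>2\<close> for some \<open>c > 0\<close>, and it
  carries the additional weight \<open>\<Lambda>\<^sup>N\<close>. Since \<open>\<kappa>\<close> is locally a holomorphic function of
  \<open>\<kappa> \<gamma>\<^sup>N\<close>, compactness of the shell gives \<open>|d(\<kappa> \<gamma>\<^sup>k)|\<^sup>2 \<le> C |d(\<kappa> \<gamma>\<^sup>k\<^sup>+\<^sup>N)|\<^sup>2\<close> (lemma
  \<open>speed_comparison\<close>), so the pair is positive once \<open>\<Lambda>\<^sup>N > D C / (4 c)\<close>. Different outer terms use
  different compensating terms, so nothing is spent twice. The same description of functions as
  holomorphic functions of \<open>\<kappa>\<close> shows that \<open>\<kappa>\<close> is an immersion away from \<open>x\<close> (lemma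
  \<open>speed_positive\<close>), which makes the positive terms strictly positive.

  The calculus behind this takes place on open subsets of \<open>C\<^sup>n\<close>, where \<open>n\<close> depends on the chart.
  Holomorphic functions are continuous and separately differentiable, so joint differentiability and
  the symmetry of second derivatives have to be derived from Cauchy's estimates. Smooth functions
  are handled through a class of functions generated by real parts of holomorphic functions, in which
  linearity, symmetry of second derivatives and the chain rule are proved by induction.
\<close>

section \<open>Holomorphic functions of several variables\<close>

definition polydisc :: "nat \<Rightarrow> cvec \<Rightarrow> real \<Rightarrow> cvec set" where
  "polydisc n z e = {w\<in>Cn n. \<forall>i<n. cmod (w i - z i) < e}"

lemma Cn_upd [simp]: "z \<in> Cn n \<Longrightarrow> i < n \<Longrightarrow> z(i := w) \<in> Cn n"
  by (auto simp: Cn_def)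

text \<open>
  A basic open set of the product topology constrains only finitely many coordinates, and the
  coordinates of index at least \<open>n\<close> vanish on all of \<open>Cn n\<close>.
\<close>

lemma open_contains_polydisc:
  assumes "open_Cn n D" "z \<in> D"
  obtains e where "e > 0" "polydisc n z e \<subseteq> D"
proof -
  obtain T where T: "open T" "D = Cn n \<inter> T"
    using assms(1) by (auto simp: openin_open)
  have zT: "z \<in> T" "z \<in> Cn n"
    using assms T by auto
  have "openin (product_topology (\<lambda>i. euclidean) UNIV) T"
    using T by (simp add: open_fun_def)
  from product_topology_open_contains_basis[OF this zT(1)]
  obtain X where X: "z \<in> Pi\<^sub>E UNIV X" "\<And>i. open (X i)" "Pi\<^sub>E UNIV X \<subseteq> T"
    by auto
  have "\<exists>e>0. \<forall>i<m. ball (z i) e \<subseteq> X i" for m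
  proof (induction m)
    case (Suc m)
    then obtain e where e: "e > 0" "\<forall>i<m. ball (z i) e \<subseteq> X i" by blast
    obtain d where d: "d > 0" "ball (z m) d \<subseteq> X m"
      using X by (meson PiE_mem UNIV_I openE)
    have "\<forall>i<Suc m. ball (z i) (min d e) \<subseteq> X i"
      using d e by (auto simp: less_Suc_eq subset_iff)
    then show ?case using d e by (intro exI[of _ "min d e"]) auto
  qed (auto intro: exI[of _ 1])
  then obtain e where e: "e > 0" "\<forall>i<n. ball (z i) e \<subseteq> X i" by blast
  have "polydisc n z e \<subseteq> D"
  proof
    fix w assume w: "w \<in> polydisc n z e"
    have "w i \<in> X i" for i
    proof (cases "i < n")
      case True
      then show ?thesis using e w by (auto simp: polydisc_def subset_iff dist_norm norm_minus_commute)
    next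
      case False
      then have "w i = z i" using w zT by (auto simp: polydisc_def Cn_def)
      then show ?thesis using X by auto
    qed
    then show "w \<in> D" using X T w by (auto simp: polydisc_def)
  qed
  with e that show ?thesis by blast
qed

lemma polydisc_eq: "polydisc n z e = Cn n \<inter> {w. \<forall>i\<in>{..<n}. w (id i) \<in> ball (z i) e}"
  by (auto simp: polydisc_def dist_norm norm_minus_commute)

lemma open_polydisc_ambient: "open {w::cvec. \<forall>i\<in>{..<n}. w (id i) \<in> ball (z i) e}"
  by (rule product_topology_basis') auto

lemma open_Cn_polydisc: "open_Cn n (polydisc n z e)"
  unfolding polydisc_eq using open_polydisc_ambient by (auto simp: openin_open)

lemma open_Cn_subset: "open_Cn n D \<Longrightarrow> D \<subseteq> Cn n"
  using openin_imp_subset by blast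

lemma open_Cn_preimage:
  assumes "open_Cn n D" "continuous_on S c" "open S" "\<And>s. s \<in> S \<Longrightarrow> c s \<in> Cn n"
  shows "open {s\<in>S. c s \<in> D}"
proof -
  obtain T where T: "open T" "D = Cn n \<inter> T"
    using assms(1) by (auto simp: openin_open)
  have "{s\<in>S. c s \<in> D} = c -` T \<inter> S"
    using T assms by auto
  with continuous_on_open_vimage[OF assms(3)] assms(2) T show ?thesis by auto
qed

lemma continuous_on_fun_upd: "continuous_on S (\<lambda>s. (z::cvec)(i := s))"
proof (rule continuous_on_coordinatewise_then_product)
  fix k show "continuous_on S (\<lambda>s. (z(i := s)) k)"
    by (cases "k = i") auto
qed

lemma continuous_on_fun_upd2:
  assumes "continuous_on S z" "continuous_on S w"
  shows "continuous_on S (\<lambda>s. ((z s)::cvec)(i := w s))"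
proof (rule continuous_on_coordinatewise_then_product)
  fix k show "continuous_on S (\<lambda>s. ((z s)(i := w s)) k)"
    using assms continuous_on_product_then_coordinatewise[OF assms(1)]
    by (cases "k = i") auto
qed

lemma open_slice:
  assumes "open_Cn n D" "z \<in> Cn n" "i < n"
  shows "open {s. z(i := s) \<in> D}"
  using open_Cn_preimage[OF assms(1), of UNIV "\<lambda>s. z(i := s)"] assms continuous_on_fun_upd by auto

lemma holomorphic_Cn_open: "holomorphic_Cn n D f \<Longrightarrow> open_Cn n D"
  and holomorphic_Cn_continuous: "holomorphic_Cn n D f \<Longrightarrow> continuous_on D f"
  by (auto simp: holomorphic_Cn_def)

text \<open>
  The complex partial derivative in the coordinate \<open>i\<close>.
\<close>

definition pd :: "nat \<Rightarrow> (cvec \<Rightarrow> complex) \<Rightarrow> cvec \<Rightarrow> complex" where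
  "pd i f z = deriv (\<lambda>w. f (z(i := w))) (z i)"

lemma pd_has_derivative:
  assumes "holomorphic_Cn n D f" "z(i := s) \<in> D" "i < n"
  shows "((\<lambda>w. f (z(i := w))) has_field_derivative pd i f (z(i := s))) (at s)"
proof -
  have "(\<lambda>w. f ((z(i := s))(i := w))) field_differentiable at ((z(i := s)) i)"
    using assms unfolding holomorphic_Cn_def by blast
  then show ?thesis by (simp add: pd_def DERIV_deriv_iff_field_differentiable)
qed

lemma holomorphic_slice:
  assumes "holomorphic_Cn n D f" "i < n" "\<And>s. s \<in> S \<Longrightarrow> z(i := s) \<in> D"
  shows "(\<lambda>w. f (z(i := w))) holomorphic_on S"
proof (rule holomorphic_onI)
  fix s assume "s \<in> S"
  then show "(\<lambda>w. f (z(i := w))) field_differentiable at s within S"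
    using pd_has_derivative[OF assms(1) assms(3) assms(2)]
    by (meson field_differentiable_at_within field_differentiable_def)
qed

lemma polydisc_upd:
  assumes "z \<in> polydisc n z0 r" "cmod (s - z i) \<le> r" "i < n"
  shows "z(i := s) \<in> polydisc n z0 (2 * r)"
proof -
  have "cmod (s - z0 i) < 2 * r"
    using assms norm_triangle_ineq[of "s - z i" "z i - z0 i"] by (auto simp: polydisc_def)
  moreover have "r \<ge> 0" using assms(2) norm_ge_zero order_trans by blast
  moreover have "cmod (z j - z0 j) < 2 * r" if "j < n" for j
    using assms that \<open>r \<ge> 0\<close> by (force simp: polydisc_def)
  ultimately show ?thesis
    using assms by (auto simp: polydisc_def)
qed

lemma centre_in_polydisc: "z \<in> Cn n \<Longrightarrow> e > 0 \<Longrightarrow> z \<in> polydisc n z e"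
  by (auto simp: polydisc_def)

text \<open>
  Separate differentiability alone says nothing about the dependence of the derivative on the other
  variables. Slices through neighbouring points are uniformly close on a circle, and Cauchy's
  inequality transfers this to their derivatives at the centre.
\<close>

lemma continuous_pd:
  assumes f: "holomorphic_Cn n D f" and i: "i < n"
  shows "continuous_on D (pd i f)"
  unfolding continuous_on_def
proof (intro ballI tendstoI)
  fix z0 and \<epsilon> :: real
  assume z0: "z0 \<in> D" and "\<epsilon> > 0"
  obtain e where e: "e > 0" "polydisc n z0 e \<subseteq> D"
    using open_contains_polydisc f z0 holomorphic_Cn_open by metis
  define r where "r = e / 2"
  have r: "r > 0" "polydisc n z0 (2 * r) \<subseteq> D" using e by (auto simp: r_def)
  define G where "G = (\<lambda>(z::cvec, s). f (z(i := z i + s)))"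
  have upd: "z(i := z i + s) \<in> D" if "z \<in> polydisc n z0 r" "cmod s \<le> r" for z s
    using polydisc_upd[of z n z0 r "z i + s" i] that i r by auto
  have z0': "z0 \<in> polydisc n z0 r"
    using r z0 open_Cn_subset[OF holomorphic_Cn_open[OF f]] by (auto intro: centre_in_polydisc)
  have "continuous_on (polydisc n z0 r \<times> cball 0 r) G"
  proof -
    have 1: "continuous_on (polydisc n z0 r \<times> cball 0 r) (\<lambda>p. (fst p)(i := fst p i + snd p))"
      by (intro continuous_on_fun_upd2 continuous_intros
          continuous_on_product_then_coordinatewise[where i = i])
    have 2: "continuous_on ((\<lambda>p. (fst p)(i := fst p i + snd p)) ` (polydisc n z0 r \<times> cball 0 r)) f"
      by (rule continuous_on_subset[OF holomorphic_Cn_continuous[OF f]]) (auto intro!: upd)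
    show ?thesis
      using continuous_on_compose[OF 1 2] by (simp add: G_def o_def case_prod_unfold)
  qed
  from continuous_on_prod_compactE[OF this compact_cball, of z0 "\<epsilon> * r / 2"]
  obtain X0 where X0: "z0 \<in> X0" "open X0"
      "\<forall>z\<in>X0 \<inter> polydisc n z0 r. \<forall>s\<in>cball 0 r. dist (G (z, s)) (G (z0, s)) \<le> \<epsilon> * r / 2"
    using \<open>\<epsilon> > 0\<close> r z0' by auto
  have der: "((\<lambda>s. G (z, s)) has_field_derivative pd i f (z(i := z i + s))) (at s)"
    if "z \<in> polydisc n z0 r" "cmod s \<le> r" for z s
  proof -
    have "((\<lambda>s. z i + s) has_field_derivative 1) (at s)" by (auto intro!: derivative_eq_intros)
    from DERIV_chain2[OF pd_has_derivative[OF f upd[OF that] i] this] show ?thesis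
      by (simp add: G_def)
  qed
  have close: "dist (pd i f z) (pd i f z0) < \<epsilon>" if z: "z \<in> X0 \<inter> polydisc n z0 r" for z
  proof -
    let ?g = "\<lambda>s. G (z, s) - G (z0, s)"
    have d: "(?g has_field_derivative pd i f (z(i := z i + s)) - pd i f (z0(i := z0 i + s))) (at s)"
      if "cmod s \<le> r" for s
      using der[of z s] der[OF z0', of s] that z by (auto intro!: derivative_intros)
    have "cmod ((deriv ^^ 1) ?g 0) \<le> fact 1 * (\<epsilon> * r / 2) / r ^ 1"
    proof (rule Cauchy_inequality)
      show "?g holomorphic_on ball 0 r"
      proof (rule holomorphic_onI)
        fix s assume "s \<in> ball (0::complex) r"
        then show "?g field_differentiable at s within ball 0 r"
          using d[of s] by (auto simp: field_differentiable_def intro: has_field_derivative_at_within)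
      qed
      show "continuous_on (cball 0 r) ?g"
        by (rule DERIV_continuous_on[where D = "\<lambda>s. pd i f (z(i := z i + s)) - pd i f (z0(i := z0 i + s))"])
           (auto intro!: has_field_derivative_at_within d)
      show "cmod (?g s) \<le> \<epsilon> * r / 2" if "cmod (0 - s) = r" for s
        using X0 z that by (auto simp: dist_norm)
    qed (use r in auto)
    moreover have "deriv ?g 0 = pd i f z - pd i f z0"
      using DERIV_imp_deriv[OF d[of 0]] r by simp
    ultimately show ?thesis using r \<open>\<epsilon> > 0\<close> by (simp add: dist_norm)
  qed
  have "X0 \<inter> {w. \<forall>j\<in>{..<n}. w (id j) \<in> ball (z0 j) r} \<inter> D \<subseteq> X0 \<inter> polydisc n z0 r"
    using holomorphic_Cn_open[OF f] open_Cn_subset by (fastforce simp: polydisc_eq)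
  then show "\<forall>\<^sub>F z in at z0 within D. dist (pd i f z) (pd i f z0) < \<epsilon>"
    unfolding eventually_at_topological
    using close X0 open_polydisc_ambient z0' r
    by (intro exI[of _ "X0 \<inter> {w. \<forall>j\<in>{..<n}. w (id j) \<in> ball (z0 j) r}"])
       (auto intro!: open_Int simp: polydisc_eq)
qed

text \<open>
  The chain rule along a curve expresses joint differentiability. The increment of \<open>f\<close> telescopes
  into changes of one coordinate at a time, and the continuity of the partial derivatives makes every
  quotient converge although the other coordinates move as well.
\<close>

lemma holomorphic_curve:
  assumes f: "holomorphic_Cn n D f" and S: "open S" "s0 \<in> S" "\<And>s. s \<in> S \<Longrightarrow> c s \<in> D"
    and c: "\<And>i. i < n \<Longrightarrow> ((\<lambda>s. c s i) has_field_derivative c' i) (at s0)"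
  shows "((\<lambda>s. f (c s)) has_field_derivative (\<Sum>i<n. c' i * pd i f (c s0))) (at s0)"
proof -
  define z0 where "z0 = c s0"
  \<comment> \<open>The curve in which only the first k coordinates move.\<close>
  define p where "p k s i = (if i < k then c s i else z0 i)" for k s i
  have z0: "z0 \<in> D" "z0 \<in> Cn n" using S open_Cn_subset[OF holomorphic_Cn_open[OF f]] by (auto simp: z0_def)
  obtain e where e: "e > 0" "polydisc n z0 e \<subseteq> D"
    using open_contains_polydisc[OF holomorphic_Cn_open[OF f] z0(1)] by metis
  have near: "\<forall>\<^sub>F s in nhds s0. \<forall>i<n. cmod (c s i - z0 i) < d" if "d > 0" for d
  proof -
    have "\<forall>\<^sub>F s in nhds s0. cmod (c s i - z0 i) < d" if "i < n" for i
    proof -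
      have "isCont (\<lambda>s. c s i) s0" using c[OF that] DERIV_isCont by blast
      then have "((\<lambda>s. c s i) \<longlongrightarrow> z0 i) (nhds s0)"
        by (simp add: continuous_at tendsto_nhds_iff z0_def)
      then have "\<forall>\<^sub>F s in nhds s0. dist (c s i) (z0 i) < d"
        using \<open>d > 0\<close> tendstoD by blast
      then show ?thesis by (simp add: dist_norm)
    qed
    then have "\<forall>\<^sub>F s in nhds s0. \<forall>i\<in>{..<n}. cmod (c s i - z0 i) < d"
      by (intro eventually_ball_finite) auto
    then show ?thesis by (rule eventually_mono) auto
  qed
  have pin: "p k s \<in> polydisc n z0 d" if "\<forall>i<n. cmod (c s i - z0 i) < d" "d > 0" "s \<in> S" for k s d
  proof -
    have "c s \<in> Cn n" using S open_Cn_subset[OF holomorphic_Cn_open[OF f]] that by blast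
    then show ?thesis using that z0 by (auto simp: p_def polydisc_def Cn_def)
  qed
  have "((\<lambda>s. f (p k s)) has_field_derivative (\<Sum>i<k. c' i * pd i f z0)) (at s0)" if "k \<le> n" for k
    using that
  proof (induction k)
    case 0
    then show ?case by (simp add: p_def)
  next
    case (Suc k)
    then have k: "k < n" by simp
    define R where "R s = f (p (Suc k) s) - f (p k s)" for s
    define P where "P = pd k f z0"
    \<comment> \<open>The difference quotient in the k-th coordinate; Caratheodory's criterion needs its continuity
       at s0, which is where continuity of the partial derivative enters.\<close>
    define Q where "Q s = (if c s k = z0 k then P else R s / (c s k - z0 k))" for s
    have p0: "p j s0 = z0" for j by (auto simp: p_def z0_def)
    have pS: "p (Suc k) s = (p k s)(k := c s k)" "p k s = (p k s)(k := z0 k)" for s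
      by (auto simp: p_def less_Suc_eq)
    have R: "R s = Q s * (c s k - z0 k)" for s
      using pS by (auto simp: R_def Q_def)
    have "isCont Q s0"
      unfolding continuous_at
    proof (rule tendstoI)
      fix \<epsilon> :: real assume "\<epsilon> > 0"
      have "continuous_on (polydisc n z0 e) (pd k f)"
        using continuous_on_subset[OF continuous_pd[OF f k] e(2)] .
      then have "openin (top_of_set (polydisc n z0 e)) (polydisc n z0 e \<inter> pd k f -` ball P (\<epsilon> / 2))"
        using continuous_openin_preimage_gen by blast
      then have "open_Cn n (polydisc n z0 e \<inter> pd k f -` ball P (\<epsilon> / 2))"
        using openin_trans open_Cn_polydisc by blast
      moreover have "z0 \<in> polydisc n z0 e \<inter> pd k f -` ball P (\<epsilon> / 2)"
        using z0 e \<open>\<epsilon> > 0\<close> by (auto simp: P_def centre_in_polydisc)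
      ultimately obtain d where d: "d > 0" "polydisc n z0 d \<subseteq> polydisc n z0 e \<inter> pd k f -` ball P (\<epsilon> / 2)"
        using open_contains_polydisc by metis
      have "dist (Q s) P \<le> \<epsilon> / 2" if s: "\<forall>i<n. cmod (c s i - z0 i) < d" "s \<in> S" for s
      proof (cases "c s k = z0 k")
        case False
        have pt: "(p k s)(k := t) \<in> polydisc n z0 d" if "t \<in> ball (z0 k) d" for t
          using pin[OF s(1) d(1) s(2), of k] that k
          by (auto simp: polydisc_def dist_norm norm_minus_commute)
        have "cmod ((f ((p k s)(k := c s k)) - P * c s k) - (f ((p k s)(k := z0 k)) - P * z0 k))
            \<le> \<epsilon> / 2 * cmod (c s k - z0 k)"
        proof (rule field_differentiable_bound[where S = "ball (z0 k) d"])
          fix t assume t: "t \<in> ball (z0 k) d"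
          have "((p k s)(k := t)) \<in> D" using pt[OF t] d e by auto
          then have "((\<lambda>t. f ((p k s)(k := t)) - P * t) has_field_derivative pd k f ((p k s)(k := t)) - P) (at t)"
            using pd_has_derivative[OF f _ k] by (auto intro!: derivative_eq_intros)
          then show "((\<lambda>t. f ((p k s)(k := t)) - P * t) has_field_derivative pd k f ((p k s)(k := t)) - P) (at t within ball (z0 k) d)"
            by (rule has_field_derivative_at_within)
          show "cmod (pd k f ((p k s)(k := t)) - P) \<le> \<epsilon> / 2"
            using pt[OF t] d by (force simp: dist_norm norm_minus_commute)
        qed (use s k d in \<open>auto simp: dist_norm norm_minus_commute\<close>)
        moreover have "(f ((p k s)(k := c s k)) - P * c s k) - (f ((p k s)(k := z0 k)) - P * z0 k)
           = (Q s - P) * (c s k - z0 k)"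
          using R[of s] pS[of s] by (simp add: R_def algebra_simps)
        ultimately have "cmod (Q s - P) * cmod (c s k - z0 k) \<le> \<epsilon> / 2 * cmod (c s k - z0 k)"
          by (simp add: norm_mult)
        then show ?thesis using False by (simp add: dist_norm)
      qed (use \<open>\<epsilon> > 0\<close> in \<open>simp add: Q_def\<close>)
      moreover have "\<forall>\<^sub>F s in nhds s0. s \<in> S" using S by (simp add: eventually_nhds_in_open)
      ultimately have "\<forall>\<^sub>F s in nhds s0. dist (Q s) P \<le> \<epsilon> / 2"
        using near[OF d(1)] by (auto elim: eventually_elim2)
      moreover have "Q s0 = P" by (simp add: Q_def z0_def)
      ultimately have "\<forall>\<^sub>F s in nhds s0. dist (Q s) (Q s0) < \<epsilon>"
        using \<open>\<epsilon> > 0\<close> by (auto elim!: eventually_mono)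
      then show "\<forall>\<^sub>F s in at s0. dist (Q s) (Q s0) < \<epsilon>"
        by (simp add: eventually_at_filter eventually_mono)
    qed
    moreover obtain g where g: "\<And>s. c s k - z0 k = g s * (s - s0)" "isCont g s0" "g s0 = c' k"
      using c[OF k] unfolding CARAT_DERIV z0_def by blast
    ultimately have "isCont (\<lambda>s. Q s * g s) s0"
      by (intro continuous_intros)
    moreover have "Q s0 = P" by (simp add: Q_def z0_def)
    ultimately have "(R has_field_derivative c' k * P) (at s0)"
      unfolding CARAT_DERIV using g R p0
      by (intro exI[of _ "\<lambda>s. Q s * g s"]) (auto simp: z0_def)
    then have "((\<lambda>s. R s + f (p k s)) has_field_derivative c' k * P + (\<Sum>i<k. c' i * pd i f z0)) (at s0)"
      using Suc by (intro derivative_intros) auto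
    then show ?case by (simp add: R_def P_def algebra_simps)
  qed
  from this[of n] have "((\<lambda>s. f (p n s)) has_field_derivative (\<Sum>i<n. c' i * pd i f z0)) (at s0)" by simp
  moreover have "p n s = c s" if "s \<in> S" for s
  proof -
    have "c s \<in> Cn n" using S open_Cn_subset[OF holomorphic_Cn_open[OF f]] that by blast
    then show ?thesis using z0 by (auto simp: p_def Cn_def fun_eq_iff)
  qed
  ultimately show ?thesis
    unfolding z0_def
    using has_field_derivative_transform_within_open[of "\<lambda>s. f (p n s)" _ s0 S "\<lambda>s. f (c s)"] S by simp
qed

lemma at_within_openin:
  assumes "openin (top_of_set D) W" "z \<in> W"
  shows "at z within D = at z within W"
proof -
  obtain T where "open T" "W = D \<inter> T"
    using assms(1) by (auto simp: openin_open)
  then show ?thesis using assms by (intro at_within_nhd[of z T]) auto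
qed

lemma holomorphic_Cn_local:
  assumes D: "open_Cn n D"
    and loc: "\<And>z. z \<in> D \<Longrightarrow> \<exists>W F. z \<in> W \<and> holomorphic_Cn n W F \<and> (\<forall>w\<in>W \<inter> D. F w = f w)"
  shows "holomorphic_Cn n D f"
proof -
  have "continuous (at z within D) f \<and> (\<forall>i<n. (\<lambda>w. f (z(i := w))) field_differentiable at (z i))"
    if z: "z \<in> D" for z
  proof -
    obtain W F where W: "z \<in> W" "holomorphic_Cn n W F" "\<forall>w\<in>W \<inter> D. F w = f w"
      using loc[OF z] by blast
    have o: "open_Cn n (W \<inter> D)"
      using D W holomorphic_Cn_open by blast
    have "continuous_on (W \<inter> D) F"
      using holomorphic_Cn_continuous[OF W(2)] continuous_on_subset by blast
    then have "continuous_on (W \<inter> D) f" using W(3) continuous_on_cong[of "W \<inter> D" "W \<inter> D" F f] by blast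
    then have "continuous (at z within (W \<inter> D)) f"
      using W z by (auto simp: continuous_on_eq_continuous_within)
    moreover have "openin (top_of_set D) (W \<inter> D)"
      using o D openin_subset_trans[OF o, of D] open_Cn_subset by auto
    then have "at z within D = at z within (W \<inter> D)"
      using W z by (intro at_within_openin) auto
    ultimately have 1: "continuous (at z within D) f" by simp
    have "(\<lambda>w. f (z(i := w))) field_differentiable at (z i)" if i: "i < n" for i
    proof -
      have "open {s. z(i := s) \<in> W \<inter> D}"
        using open_slice[OF o _ i] z D open_Cn_subset by blast
      moreover have "(\<lambda>w. F (z(i := w))) field_differentiable at (z i)"
        using W i by (auto simp: holomorphic_Cn_def)
      ultimately show ?thesis
        unfolding field_differentiable_def
        using has_field_derivative_transform_within_open[of "\<lambda>w. F (z(i := w))" _ "z i" "{s. z(i := s) \<in> W \<inter> D}" "\<lambda>w. f (z(i := w))"]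
          W z by auto
    qed
    with 1 show ?thesis by blast
  qed
  then show ?thesis
    unfolding holomorphic_Cn_def continuous_on_eq_continuous_within using D by blast
qed

lemma holomorphic_Cn_subset:
  "holomorphic_Cn n D f \<Longrightarrow> open_Cn n W \<Longrightarrow> W \<subseteq> D \<Longrightarrow> holomorphic_Cn n W f"
  by (auto simp: holomorphic_Cn_def intro: continuous_on_subset)

lemma holomorphic_Cn_cong:
  assumes "holomorphic_Cn n D f" "\<And>z. z \<in> D \<Longrightarrow> f z = g z"
  shows "holomorphic_Cn n D g"
proof (rule holomorphic_Cn_local)
  show "open_Cn n D" using assms(1) by (rule holomorphic_Cn_open)
qed (use assms in \<open>auto intro!: exI[of _ D] exI[of _ f]\<close>)

lemma pd_cong:
  assumes "open_Cn n D" "z \<in> D" "\<And>w. w \<in> D \<Longrightarrow> f w = g w" "i < n"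
  shows "pd i f z = pd i g z"
  unfolding pd_def
proof (rule deriv_cong_ev)
  have "open {s. z(i := s) \<in> D}"
    using open_slice[OF assms(1) _ assms(4)] assms open_Cn_subset by blast
  then have "\<forall>\<^sub>F s in nhds (z i). s \<in> {s. z(i := s) \<in> D}"
    using assms by (intro eventually_nhds_in_open) auto
  then show "\<forall>\<^sub>F s in nhds (z i). f (z(i := s)) = g (z(i := s))"
    using assms by (auto elim: eventually_mono)
qed simp

lemma holomorphic_Cn_const: "open_Cn n D \<Longrightarrow> holomorphic_Cn n D (\<lambda>z. a)"
  by (auto simp: holomorphic_Cn_def)

lemma holomorphic_Cn_coord: "open_Cn n D \<Longrightarrow> holomorphic_Cn n D (\<lambda>z. z k)"
  unfolding holomorphic_Cn_def
proof (intro conjI ballI allI impI)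
  show "continuous_on D (\<lambda>z. z k)"
    by (rule continuous_on_subset[OF continuous_on_product_coordinates]) auto
  show "(\<lambda>w. (z(i := w)) k) field_differentiable at (z i)" for z :: cvec and i
    by (cases "i = k") auto
qed

lemma holomorphic_Cn_add:
  "holomorphic_Cn n D f \<Longrightarrow> holomorphic_Cn n D g \<Longrightarrow> holomorphic_Cn n D (\<lambda>z. f z + g z)"
  by (auto simp: holomorphic_Cn_def intro!: continuous_intros derivative_intros)

lemma holomorphic_Cn_mult:
  "holomorphic_Cn n D f \<Longrightarrow> holomorphic_Cn n D g \<Longrightarrow> holomorphic_Cn n D (\<lambda>z. f z * g z)"
  by (auto simp: holomorphic_Cn_def intro!: continuous_intros derivative_intros)

lemma holomorphic_Cn_sum:
  assumes "open_Cn n D" "\<And>j. j \<in> J \<Longrightarrow> holomorphic_Cn n D (f j)"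
  shows "holomorphic_Cn n D (\<lambda>z. \<Sum>j\<in>J. f j z)"
  using assms(2) by (induction J rule: infinite_finite_induct)
    (auto intro: holomorphic_Cn_const holomorphic_Cn_add assms(1))

text \<open>
  The difference quotients of \<open>f\<close> in the variable \<open>i\<close> converge to \<open>pd i f\<close> uniformly in the variable
  \<open>j\<close>. By Weierstrass' theorem the limit is holomorphic in the variable \<open>j\<close>, and its derivative is the
  limit of the derivatives. The first conclusion gives holomorphy of partial derivatives, the second
  one their commutation.
\<close>

lemma partial_difference_quotient:
  assumes f: "holomorphic_Cn n D f" and ij: "i < n" "j < n" "i \<noteq> j" and z0: "z0 \<in> D"
  shows "(\<lambda>w. pd i f (z0(j := w))) field_differentiable at (z0 j)"
    and "((\<lambda>h. (pd j f (z0(i := z0 i + h)) - pd j f z0) / h) \<longlongrightarrow> pd j (pd i f) z0) (at 0)"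
proof -
  have z0C: "z0 \<in> Cn n" using z0 open_Cn_subset[OF holomorphic_Cn_open[OF f]] by auto
  obtain e where e: "e > 0" "polydisc n z0 e \<subseteq> D"
    using open_contains_polydisc[OF holomorphic_Cn_open[OF f] z0] by metis
  define r where "r = e / 2"
  have r: "r > 0" "r < e" using e by (auto simp: r_def)
  define q where "q w t = z0(j := w, i := z0 i + t)" for w t
  have qD: "q w t \<in> D" if "w \<in> cball (z0 j) r" "cmod t \<le> r" for w t
  proof -
    have "q w t \<in> polydisc n z0 e"
      using that r z0C ij by (auto simp: q_def polydisc_def dist_norm norm_minus_commute)
    then show ?thesis using e by auto
  qed
  have q0: "q w 0 = z0(j := w)" for w using ij by (auto simp: q_def)
  have qj: "q (z0 j) t = z0(i := z0 i + t)" for t by (auto simp: q_def)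
  have qi: "q w t = (z0(j := w))(i := z0 i + t)" for w t by (auto simp: q_def)
  have qj': "q w t = (z0(i := z0 i + t))(j := w)" for w t using ij by (auto simp: q_def)
  define F where "F h w = (f (q w h) - f (q w 0)) / h" for h w
  define F' where "F' h w = (pd j f (q w h) - pd j f (q w 0)) / h" for h w
  define g where "g w = pd i f (q w 0)" for w
  have dj: "((\<lambda>w. f (q w h)) has_field_derivative pd j f (q w h)) (at w)"
    if "w \<in> cball (z0 j) r" "cmod h \<le> r" for w h
    using pd_has_derivative[OF f _ ij(2), of "z0(i := z0 i + h)" w] qD[OF that] unfolding qj' by simp
  have dF: "(F h has_field_derivative F' h w) (at w)"
    if "w \<in> cball (z0 j) r" "cmod h \<le> r" for w h
    unfolding F_def F'_def using dj[OF that] dj[of w 0] that r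
    by (auto intro!: DERIV_cdivide derivative_intros)
  have ev: "\<forall>\<^sub>F h in at (0::complex). cmod h \<le> d" if "d > 0" for d
    unfolding eventually_at using that by (auto intro!: exI[of _ d])
  have P: "continuous_on (cball 0 r \<times> cball (z0 j) r) (\<lambda>(t, w). pd i f (q w t))"
  proof -
    have 1: "continuous_on (cball 0 r \<times> cball (z0 j) r) (\<lambda>p. q (snd p) (fst p))"
      unfolding q_def by (intro continuous_on_fun_upd2 continuous_intros)
    have 2: "continuous_on ((\<lambda>p. q (snd p) (fst p)) ` (cball 0 r \<times> cball (z0 j) r)) (pd i f)"
      by (rule continuous_on_subset[OF continuous_pd[OF f ij(1)]]) (auto intro!: qD)
    show ?thesis using continuous_on_compose[OF 1 2] by (simp add: o_def case_prod_unfold)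
  qed
  \<comment> \<open>The mean value inequality in the increment, with continuity of pd i f on a compact set.\<close>
  have ul: "uniform_limit (cball (z0 j) r) F g (at 0)"
  proof (rule uniform_limitI)
    fix \<epsilon> :: real assume "\<epsilon> > 0"
    from continuous_on_prod_compactE[OF P compact_cball, of 0 "\<epsilon> / 2"]
    obtain X0 where X0: "0 \<in> X0" "open X0"
      "\<forall>t\<in>X0 \<inter> cball 0 r. \<forall>w\<in>cball (z0 j) r. dist (pd i f (q w t)) (pd i f (q w 0)) \<le> \<epsilon> / 2"
      using r \<open>\<epsilon> > 0\<close> by auto
    then obtain d where d: "d > 0" "ball 0 d \<subseteq> X0" by (meson openE)
    have "dist (F h w) (g w) < \<epsilon>" if h: "cmod h \<le> min (d / 2) r" "h \<noteq> 0" and w: "w \<in> cball (z0 j) r" for h w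
    proof -
      have seg: "cmod t \<le> min (d / 2) r" if "t \<in> cball 0 (cmod h)" for t :: complex
        using that h by auto
      have "cmod ((f (q w h) - g w * h) - (f (q w 0) - g w * 0)) \<le> \<epsilon> / 2 * cmod (h - 0)"
      proof (rule field_differentiable_bound[where S = "cball 0 (cmod h)"])
        fix t :: complex assume t: "t \<in> cball 0 (cmod h)"
        have "((\<lambda>s. f ((z0(j := w))(i := s))) has_field_derivative pd i f ((z0(j := w))(i := z0 i + t))) (at (z0 i + t))"
          using pd_has_derivative[OF f _ ij(1)] qD[OF w, of t] seg[OF t] unfolding qi by simp
        moreover have "((+) (z0 i) has_field_derivative 1) (at t)" by (auto intro!: derivative_eq_intros)
        ultimately have "((\<lambda>t. f (q w t)) has_field_derivative pd i f (q w t)) (at t)"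
          using DERIV_chain2[of "\<lambda>s. f ((z0(j := w))(i := s))" _ "\<lambda>t. z0 i + t" t 1 UNIV] unfolding qi by simp
        then have "((\<lambda>t. f (q w t) - g w * t) has_field_derivative pd i f (q w t) - g w) (at t)"
          by (auto intro!: derivative_eq_intros)
        then show "((\<lambda>t. f (q w t) - g w * t) has_field_derivative pd i f (q w t) - g w) (at t within cball 0 (cmod h))"
          by (rule has_field_derivative_at_within)
        show "cmod (pd i f (q w t) - g w) \<le> \<epsilon> / 2"
          using X0 d seg[OF t] w by (auto simp: g_def dist_norm subset_iff)
      qed auto
      moreover have "(f (q w h) - g w * h) - (f (q w 0) - g w * 0) = (F h w - g w) * h"
        using h by (simp add: F_def field_simps)
      ultimately have "cmod (F h w - g w) * cmod h \<le> \<epsilon> / 2 * cmod h"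
        by (simp add: norm_mult)
      then show ?thesis using h \<open>\<epsilon> > 0\<close> by (simp add: dist_norm)
    qed
    moreover have "\<forall>\<^sub>F h in at (0::complex). cmod h \<le> min (d / 2) r \<and> h \<noteq> 0"
      using ev[of "min (d / 2) r"] d r eventually_neq_at_within[of 0 0 UNIV]
      by (auto elim: eventually_elim2)
    ultimately show "\<forall>\<^sub>F h in at 0. \<forall>w\<in>cball (z0 j) r. dist (F h w) (g w) < \<epsilon>"
      by (auto elim: eventually_mono)
  qed
  have "\<forall>\<^sub>F h in at 0. continuous_on (cball (z0 j) r) (F h) \<and>
      (\<forall>w\<in>ball (z0 j) r. (F h has_field_derivative F' h w) (at w))"
    using ev[OF r(1)]
  proof (rule eventually_mono)
    fix h :: complex assume h: "cmod h \<le> r"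
    have "continuous_on (cball (z0 j) r) (F h)"
      by (rule DERIV_continuous_on[where D = "F' h"]) (use dF h in \<open>auto intro: has_field_derivative_at_within\<close>)
    then show "continuous_on (cball (z0 j) r) (F h) \<and>
      (\<forall>w\<in>ball (z0 j) r. (F h has_field_derivative F' h w) (at w))"
      using dF h by auto
  qed
  from has_complex_derivative_uniform_limit[OF this ul _ r(1)] obtain g' where
    g': "\<And>w. w \<in> ball (z0 j) r \<Longrightarrow> (g has_field_derivative g' w) (at w) \<and> ((\<lambda>h. F' h w) \<longlongrightarrow> g' w) (at 0)"
    using trivial_limit_at by blast
  have g1: "(g has_field_derivative g' (z0 j)) (at (z0 j))" and g2: "((\<lambda>h. F' h (z0 j)) \<longlongrightarrow> g' (z0 j)) (at 0)"
    using g'[of "z0 j"] r by auto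
  show "(\<lambda>w. pd i f (z0(j := w))) field_differentiable at (z0 j)"
    using g1 unfolding g_def q0 field_differentiable_def by blast
  have "pd j (pd i f) z0 = g' (z0 j)"
    using DERIV_imp_deriv[OF g1] unfolding g_def q0 pd_def[of j] .
  then show "((\<lambda>h. (pd j f (z0(i := z0 i + h)) - pd j f z0) / h) \<longlongrightarrow> pd j (pd i f) z0) (at 0)"
    using g2 unfolding F'_def qj by simp
qed

lemma holomorphic_pd:
  assumes f: "holomorphic_Cn n D f" and i: "i < n"
  shows "holomorphic_Cn n D (pd i f)"
  unfolding holomorphic_Cn_def
proof (intro conjI ballI allI impI)
  fix z j assume z: "z \<in> D" and j: "j < n"
  show "(\<lambda>w. pd i f (z(j := w))) field_differentiable at (z j)"
  proof (cases "i = j")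
    case True
    define S where "S = {s. z(i := s) \<in> D}"
    have S: "open S" "z i \<in> S"
      using open_slice[OF holomorphic_Cn_open[OF f] _ i] z open_Cn_subset[OF holomorphic_Cn_open[OF f]]
      by (auto simp: S_def)
    have "(\<lambda>w. f (z(i := w))) holomorphic_on S"
      by (rule holomorphic_slice[OF f i]) (auto simp: S_def)
    then have "deriv (\<lambda>w. f (z(i := w))) field_differentiable at (z i)"
      using S holomorphic_deriv holomorphic_on_imp_differentiable_at by blast
    moreover have "pd i f (z(i := w)) = deriv (\<lambda>w. f (z(i := w))) w" for w
      by (simp add: pd_def)
    ultimately show ?thesis using True by simp
  next
    case False
    then show ?thesis using partial_difference_quotient(1)[OF f i j False z] by simp
  qed
qed (use holomorphic_Cn_open[OF f] continuous_pd[OF assms] in auto)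

lemma pd_commute:
  assumes f: "holomorphic_Cn n D f" and ij: "i < n" "j < n" and z: "z \<in> D"
  shows "pd i (pd j f) z = pd j (pd i f) z"
proof (cases "i = j")
  case False
  have "((\<lambda>w. pd j f (z(i := w))) has_field_derivative pd i (pd j f) z) (at (z i))"
    using pd_has_derivative[OF holomorphic_pd[OF f ij(2)], of z i "z i"] z ij by simp
  then have "((\<lambda>h. (pd j f (z(i := z i + h)) - pd j f z) / h) \<longlongrightarrow> pd i (pd j f) z) (at 0)"
    by (simp add: DERIV_def)
  then show ?thesis
    using partial_difference_quotient(2)[OF f ij False z] LIM_unique by blast
qed simp

definition holomorphic_to :: "nat \<Rightarrow> cvec set \<Rightarrow> nat \<Rightarrow> cvec set \<Rightarrow> (cvec \<Rightarrow> cvec) \<Rightarrow> bool" where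
  "holomorphic_to m D n D' \<Phi> \<longleftrightarrow> \<Phi> ` D \<subseteq> D' \<and> open_Cn n D' \<and> (\<forall>k<n. holomorphic_Cn m D (\<lambda>w. \<Phi> w k)) \<and> open_Cn m D"

lemma holomorphic_to_continuous:
  assumes "holomorphic_to m D n D' \<Phi>"
  shows "continuous_on D \<Phi>"
proof (rule continuous_on_coordinatewise_then_product)
  fix k
  have "\<Phi> w k = 0" if "w \<in> D" "k \<ge> n" for w
    using assms that open_Cn_subset unfolding holomorphic_to_def Cn_def by blast
  then show "continuous_on D (\<lambda>w. \<Phi> w k)"
    using assms by (cases "k < n") (auto simp: holomorphic_to_def holomorphic_Cn_def)
qed

lemma holomorphic_Cn_compose:
  assumes \<Phi>: "holomorphic_to m D n D' \<Phi>" and h: "holomorphic_Cn n D' h"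
  shows "holomorphic_Cn m D (\<lambda>w. h (\<Phi> w))"
    and "w \<in> D \<Longrightarrow> i < m \<Longrightarrow> pd i (\<lambda>w. h (\<Phi> w)) w = (\<Sum>k<n. pd i (\<lambda>w. \<Phi> w k) w * pd k h (\<Phi> w))"
proof -
  have o: "open_Cn m D" using \<Phi> by (auto simp: holomorphic_to_def)
  have der: "((\<lambda>s. h (\<Phi> (z(i := s)))) has_field_derivative (\<Sum>k<n. pd i (\<lambda>w. \<Phi> w k) z * pd k h (\<Phi> z))) (at (z i))"
    if z: "z \<in> D" and i: "i < m" for z i
  proof -
    have "((\<lambda>s. h (\<Phi> (z(i := s)))) has_field_derivative (\<Sum>k<n. pd i (\<lambda>w. \<Phi> w k) z * pd k h (\<Phi> (z(i := z i))))) (at (z i))"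
    proof (rule holomorphic_curve[OF h, of "{s. z(i := s) \<in> D}"])
      show "open {s. z(i := s) \<in> D}" using open_slice[OF o _ i] z open_Cn_subset[OF o] by auto
      show "((\<lambda>s. \<Phi> (z(i := s)) k) has_field_derivative pd i (\<lambda>w. \<Phi> w k) z) (at (z i))" if "k < n" for k
        using pd_has_derivative[of m D "\<lambda>w. \<Phi> w k" z i "z i"] \<Phi> that z i by (auto simp: holomorphic_to_def)
    qed (use z \<Phi> in \<open>auto simp: holomorphic_to_def\<close>)
    then show ?thesis by simp
  qed
  show "holomorphic_Cn m D (\<lambda>w. h (\<Phi> w))"
    unfolding holomorphic_Cn_def
  proof (intro conjI ballI allI impI)
    have "continuous_on (\<Phi> ` D) h"
      using \<Phi> holomorphic_Cn_continuous[OF h] continuous_on_subset by (auto simp: holomorphic_to_def)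
    then show "continuous_on D (\<lambda>w. h (\<Phi> w))"
      using continuous_on_compose[OF holomorphic_to_continuous[OF \<Phi>]] by (simp add: o_def)
  qed (use o der in \<open>auto simp: field_differentiable_def\<close>)
  show "w \<in> D \<Longrightarrow> i < m \<Longrightarrow> pd i (\<lambda>w. h (\<Phi> w)) w = (\<Sum>k<n. pd i (\<lambda>w. \<Phi> w k) w * pd k h (\<Phi> w))"
    using DERIV_imp_deriv[OF der] by (simp add: pd_def[of i "\<lambda>w. h (\<Phi> w)"])
qed

section \<open>Smooth functions built from holomorphic ones\<close>

lemma scale_cvec_Cn [simp, intro]: "u \<in> Cn n \<Longrightarrow> scale_cvec a u \<in> Cn n"
  and add_cvec_Cn [simp, intro]: "u \<in> Cn n \<Longrightarrow> v \<in> Cn n \<Longrightarrow> add_cvec u v \<in> Cn n"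
  by (auto simp: Cn_def scale_cvec_def add_cvec_def)

lemma shift_eventually:
  assumes "open_Cn n W" "z \<in> W" "u \<in> Cn n"
  shows "\<forall>\<^sub>F t in nhds 0. shift z u t \<in> W"
proof -
  have "continuous_on UNIV (shift z u)"
    unfolding shift_def add_cvec_def scale_cvec_def
    by (intro continuous_on_coordinatewise_then_product continuous_intros)
  moreover have "shift z u t \<in> Cn n" for t
    using assms open_Cn_subset unfolding shift_def by blast
  ultimately have "open {t\<in>UNIV. shift z u t \<in> W}"
    by (intro open_Cn_preimage[OF assms(1)]) auto
  then have "\<forall>\<^sub>F t in nhds 0. t \<in> {t\<in>UNIV. shift z u t \<in> W}"
    using assms by (intro eventually_nhds_in_open) (auto simp: shift_def add_cvec_def scale_cvec_def)
  then show ?thesis by simp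
qed

lemma shift_0 [simp]: "shift z u 0 = z"
  by (auto simp: shift_def add_cvec_def scale_cvec_def)

lemma dir_deriv_cong:
  assumes "open_Cn n W" "z \<in> W" "u \<in> Cn n" "\<And>w. w \<in> W \<Longrightarrow> f w = g w"
  shows "dir_deriv u f z = dir_deriv u g z"
  unfolding dir_deriv_def
  by (rule vector_derivative_cong_eq)
     (use shift_eventually[OF assms(1-3)] assms(4) in \<open>auto elim: eventually_mono\<close>)

lemma has_real_derivative_shift_cong:
  assumes "open_Cn n W" "z \<in> W" "u \<in> Cn n" "\<And>w. w \<in> W \<Longrightarrow> f w = g w"
    and "((\<lambda>t. f (shift z u t)) has_real_derivative d) (at 0)"
  shows "((\<lambda>t. g (shift z u t)) has_real_derivative d) (at 0)"
proof -
  have "\<forall>\<^sub>F t in nhds 0. f (shift z u t) = g (shift z u t)"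
    using shift_eventually[OF assms(1-3)] by (rule eventually_mono) (simp add: assms(4))
  from DERIV_cong_ev[OF refl this refl] assms(5) show ?thesis by simp
qed

lemma dir_deriv_eqI:
  "((\<lambda>t. f (shift z u t)) has_real_derivative d) (at 0) \<Longrightarrow> dir_deriv u f z = d"
  unfolding dir_deriv_def
  by (rule vector_derivative_at) (simp add: has_real_derivative_iff_has_vector_derivative)

text \<open>
  The derivative of a holomorphic function along \<open>u\<close>. It is complex linear in \<open>u\<close>, which \<open>dir_deriv\<close>
  is not for general functions.
\<close>

definition cdir :: "nat \<Rightarrow> cvec \<Rightarrow> (cvec \<Rightarrow> complex) \<Rightarrow> cvec \<Rightarrow> complex" where
  "cdir n u h z = (\<Sum>i<n. u i * pd i h z)"

lemma holomorphic_cdir: "holomorphic_Cn n D h \<Longrightarrow> holomorphic_Cn n D (cdir n u h)"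
  unfolding cdir_def[abs_def]
  by (intro holomorphic_Cn_sum holomorphic_Cn_mult holomorphic_Cn_const holomorphic_pd)
     (auto dest: holomorphic_Cn_open)

lemma cdir_has_derivative:
  assumes h: "holomorphic_Cn n D h" and z: "z \<in> D" and u: "u \<in> Cn n"
  shows "((\<lambda>t. h (shift z u t)) has_vector_derivative cdir n u h z) (at 0)"
proof -
  let ?c = "\<lambda>s::complex. (\<lambda>i. z i + s * u i)"
  have o: "open_Cn n D" using h by (rule holomorphic_Cn_open)
  have zC: "z \<in> Cn n" using z open_Cn_subset[OF o] by auto
  have "open {s\<in>UNIV. ?c s \<in> D}"
    by (rule open_Cn_preimage[OF o])
       (use zC u in \<open>auto simp: Cn_def intro!: continuous_on_coordinatewise_then_product continuous_intros\<close>)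
  then have "((\<lambda>s. h (?c s)) has_field_derivative (\<Sum>i<n. u i * pd i h (?c 0))) (at 0)"
    using z by (intro holomorphic_curve[OF h, of "{s\<in>UNIV. ?c s \<in> D}"]) (auto intro!: derivative_eq_intros)
  then have "((\<lambda>s. h (?c s)) has_field_derivative cdir n u h z) (at (of_real 0))"
    by (simp add: cdir_def)
  from has_vector_derivative_real_field[OF this]
  show ?thesis by (simp add: shift_def add_cvec_def scale_cvec_def)
qed

lemma dir_deriv_holomorphic:
  "holomorphic_Cn n D h \<Longrightarrow> z \<in> D \<Longrightarrow> u \<in> Cn n \<Longrightarrow> dir_deriv u h z = cdir n u h z"
  unfolding dir_deriv_def by (rule vector_derivative_at[OF cdir_has_derivative])

lemma cdir_add: "cdir n (add_cvec u v) h z = cdir n u h z + cdir n v h z"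
  and cdir_scale: "cdir n (scale_cvec a u) h z = a * cdir n u h z"
  by (auto simp: cdir_def add_cvec_def scale_cvec_def sum.distrib algebra_simps sum_distrib_left)

lemma pd_linear_combination:
  assumes "\<And>j. j \<in> J \<Longrightarrow> holomorphic_Cn n D (f j)" "z \<in> D" "i < n"
  shows "pd i (\<lambda>z. \<Sum>j\<in>J. a j * f j z) z = (\<Sum>j\<in>J. a j * pd i (f j) z)"
  unfolding pd_def[of i "\<lambda>z. \<Sum>j\<in>J. a j * f j z"]
proof (rule DERIV_imp_deriv, rule DERIV_sum)
  fix j assume "j \<in> J"
  then show "((\<lambda>w. a j * f j (z(i := w))) has_field_derivative a j * pd i (f j) z) (at (z i))"
    using pd_has_derivative[of n D "f j" z i "z i"] assms by (intro DERIV_cmult) auto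
qed

lemma cdir_commute:
  assumes h: "holomorphic_Cn n D h" and z: "z \<in> D"
  shows "cdir n u (cdir n v h) z = cdir n v (cdir n u h) z"
proof -
  have 1: "cdir n u (cdir n v h) z = (\<Sum>i<n. \<Sum>j<n. u i * v j * pd i (pd j h) z)" for u v
    unfolding cdir_def[of n u] cdir_def[of n v, abs_def]
    using pd_linear_combination[of "{..<n}" n D "\<lambda>j. pd j h" z _ v] holomorphic_pd[OF h] z
    by (simp add: sum_distrib_left mult.assoc)
  show ?thesis
    unfolding 1 by (subst sum.swap) (simp add: pd_commute[OF h _ _ z] mult.commute mult.left_commute)
qed

lemma cdir_scale_right:
  assumes "holomorphic_Cn n D h" "z \<in> D"
  shows "cdir n u (\<lambda>z. a * h z) z = a * cdir n u h z"
  using pd_linear_combination[of "{0::nat}" n D "\<lambda>_. h" z _ "\<lambda>_. a"] assms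
  by (simp add: cdir_def sum_distrib_left mult.left_commute)

lemma cdir_cong:
  assumes "open_Cn n D" "z \<in> D" "\<And>w. w \<in> D \<Longrightarrow> f w = g w"
  shows "cdir n u f z = cdir n u g z"
  unfolding cdir_def using pd_cong[OF assms] by simp

text \<open>
  The witness is the sequence of all derivatives, so that the derivative of a smooth function is
  smooth by shifting the sequence.
\<close>

definition smooth_real :: "real set \<Rightarrow> (real \<Rightarrow> real) \<Rightarrow> bool" where
  "smooth_real A F \<longleftrightarrow> (\<exists>Fs. Fs 0 = F \<and> (\<forall>k. \<forall>t\<in>A. (Fs k has_real_derivative Fs (Suc k) t) (at t)))"

lemma smooth_real_deriv:
  assumes "smooth_real A F"
  obtains F' where "smooth_real A F'" "\<And>t. t \<in> A \<Longrightarrow> (F has_real_derivative F' t) (at t)"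
proof -
  obtain Fs where Fs: "Fs 0 = F" "\<forall>k. \<forall>t\<in>A. (Fs k has_real_derivative Fs (Suc k) t) (at t)"
    using assms by (auto simp: smooth_real_def)
  then have "smooth_real A (Fs 1)"
    unfolding smooth_real_def by (intro exI[of _ "\<lambda>k. Fs (Suc k)"]) auto
  with Fs that show ?thesis by (metis One_nat_def)
qed

text \<open>
  Every function below arises from real parts of holomorphic functions by sums, products, composition
  with smooth functions of one variable, and gluing. For this class, every statement on derivatives
  is an induction whose only analytic content is the holomorphic case. The class is closed under
  \<open>dir_deriv\<close>, so its members are infinitely differentiable.
\<close>

inductive gen_smooth :: "nat \<Rightarrow> cvec set \<Rightarrow> (cvec \<Rightarrow> real) \<Rightarrow> bool" for n where
  Re: "holomorphic_Cn n D h \<Longrightarrow> gen_smooth n D (\<lambda>z. Re (h z))"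
| add: "gen_smooth n D f \<Longrightarrow> gen_smooth n D g \<Longrightarrow> gen_smooth n D (\<lambda>z. f z + g z)"
| mult: "gen_smooth n D f \<Longrightarrow> gen_smooth n D g \<Longrightarrow> gen_smooth n D (\<lambda>z. f z * g z)"
| comp: "gen_smooth n D f \<Longrightarrow> smooth_real A F \<Longrightarrow> f ` D \<subseteq> A \<Longrightarrow> gen_smooth n D (\<lambda>z. F (f z))"
| local: "open_Cn n D \<Longrightarrow> (\<And>z. z \<in> D \<Longrightarrow> \<exists>W g. z \<in> W \<and> W \<subseteq> D \<and> gen_smooth n W g \<and> (\<forall>w\<in>W. g w = f w)) \<Longrightarrow>
    gen_smooth n D f"

lemma gen_smooth_open: "gen_smooth n D f \<Longrightarrow> open_Cn n D"
  by (induction rule: gen_smooth.induct) (auto dest: holomorphic_Cn_open)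

lemma gen_smooth_subset: "gen_smooth n D f \<Longrightarrow> open_Cn n W \<Longrightarrow> W \<subseteq> D \<Longrightarrow> gen_smooth n W f"
proof (induction arbitrary: W rule: gen_smooth.induct)
  case (Re D h)
  then show ?case by (auto intro: gen_smooth.Re holomorphic_Cn_subset)
next
  case (comp D f A F)
  then show ?case by (intro gen_smooth.comp[of n W f A F]) auto
next
  case (local D f)
  show ?case
  proof (rule gen_smooth.local[OF \<open>open_Cn n W\<close>])
    fix z assume "z \<in> W"
    then have "z \<in> D" using local.prems by auto
    from local(2)[OF this] obtain W' g where W': "z \<in> W'" "W' \<subseteq> D" "gen_smooth n W' g" "\<forall>w\<in>W'. g w = f w"
      "\<And>W. open_Cn n W \<Longrightarrow> W \<subseteq> W' \<Longrightarrow> gen_smooth n W g" by auto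
    have "gen_smooth n (W' \<inter> W) g"
      by (rule W'(5)) (use local.prems gen_smooth_open[OF W'(3)] in auto)
    then show "\<exists>W' g. z \<in> W' \<and> W' \<subseteq> W \<and> gen_smooth n W' g \<and> (\<forall>w\<in>W'. g w = f w)"
      using W' \<open>z \<in> W\<close> by (intro exI[of _ "W' \<inter> W"] exI[of _ g]) auto
  qed
qed (auto intro: gen_smooth.intros)

lemma gen_smooth_cong:
  assumes "gen_smooth n D f" "\<And>z. z \<in> D \<Longrightarrow> f z = g z"
  shows "gen_smooth n D g"
  using assms by (intro gen_smooth.local[OF gen_smooth_open[OF assms(1)]]) blast

lemma gen_smooth_const: "open_Cn n D \<Longrightarrow> gen_smooth n D (\<lambda>z. a)"
  using gen_smooth.Re[OF holomorphic_Cn_const[of n D "complex_of_real a"]] by simp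

lemma gen_smooth_Im: "holomorphic_Cn n D h \<Longrightarrow> gen_smooth n D (\<lambda>z. Im (h z))"
  using gen_smooth.Re[OF holomorphic_Cn_mult[OF holomorphic_Cn_const[of n D "- \<i>"]], of h]
  by (auto dest: holomorphic_Cn_open)

lemma gen_smooth_cmult: "gen_smooth n D f \<Longrightarrow> gen_smooth n D (\<lambda>z. a * f z)"
  by (rule gen_smooth.mult[OF gen_smooth_const[OF gen_smooth_open]])

lemma gen_smooth_minus: "gen_smooth n D f \<Longrightarrow> gen_smooth n D (\<lambda>z. - f z)"
  using gen_smooth_cmult[of n D f "-1"] by simp

lemma gen_smooth_diff: "gen_smooth n D f \<Longrightarrow> gen_smooth n D g \<Longrightarrow> gen_smooth n D (\<lambda>z. f z - g z)"
  using gen_smooth.add[OF _ gen_smooth_minus] by fastforce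

lemma gen_smooth_sum:
  assumes "open_Cn n D" "\<And>j. j \<in> J \<Longrightarrow> gen_smooth n D (f j)"
  shows "gen_smooth n D (\<lambda>z. \<Sum>j\<in>J. f j z)"
  using assms(2) by (induction J rule: infinite_finite_induct)
    (auto intro: gen_smooth_const gen_smooth.add assms(1))

text \<open>
  Existence of the derivatives and closure of the class are proved together: for a glued function the
  derivative is known only locally, and it has to be a member of the class there.
\<close>

lemma gen_smooth_dir_derivs:
  "gen_smooth n D f \<Longrightarrow> \<exists>df. (\<forall>u\<in>Cn n. gen_smooth n D (df u)) \<and>
     (\<forall>u\<in>Cn n. \<forall>z\<in>D. ((\<lambda>t. f (shift z u t)) has_real_derivative df u z) (at 0))"
proof (induction rule: gen_smooth.induct)
  case (Re D h)
  show ?case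
  proof (intro exI[of _ "\<lambda>u z. Re (cdir n u h z)"] conjI ballI)
    fix u z assume "u \<in> Cn n" "z \<in> D"
    from bounded_linear.has_vector_derivative[OF bounded_linear_Re cdir_has_derivative[OF Re this(2,1)]]
    show "((\<lambda>t. Re (h (shift z u t))) has_real_derivative Re (cdir n u h z)) (at 0)"
      by (simp add: has_real_derivative_iff_has_vector_derivative)
  qed (auto intro: gen_smooth.Re holomorphic_cdir Re)
next
  case (add D f g)
  then obtain df dg where *: "\<forall>u\<in>Cn n. gen_smooth n D (df u)" "\<forall>u\<in>Cn n. gen_smooth n D (dg u)"
    "\<forall>u\<in>Cn n. \<forall>z\<in>D. ((\<lambda>t. f (shift z u t)) has_real_derivative df u z) (at 0)"
    "\<forall>u\<in>Cn n. \<forall>z\<in>D. ((\<lambda>t. g (shift z u t)) has_real_derivative dg u z) (at 0)" by blast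
  then show ?case
    by (intro exI[of _ "\<lambda>u z. df u z + dg u z"]) (auto intro: gen_smooth.add DERIV_add)
next
  case (mult D f g)
  then obtain df dg where *: "\<forall>u\<in>Cn n. gen_smooth n D (df u)" "\<forall>u\<in>Cn n. gen_smooth n D (dg u)"
    "\<forall>u\<in>Cn n. \<forall>z\<in>D. ((\<lambda>t. f (shift z u t)) has_real_derivative df u z) (at 0)"
    "\<forall>u\<in>Cn n. \<forall>z\<in>D. ((\<lambda>t. g (shift z u t)) has_real_derivative dg u z) (at 0)" by blast
  have "((\<lambda>t. f (shift z u t) * g (shift z u t)) has_real_derivative df u z * g z + dg u z * f z) (at 0)"
    if "u \<in> Cn n" "z \<in> D" for u z
    using * that DERIV_mult[of "\<lambda>t. f (shift z u t)" "df u z" 0 UNIV "\<lambda>t. g (shift z u t)" "dg u z"] by simp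
  with * mult show ?case
    by (intro exI[of _ "\<lambda>u z. df u z * g z + dg u z * f z"]) (auto intro!: gen_smooth.add gen_smooth.mult)
next
  case (comp D f A F)
  obtain F' where F': "smooth_real A F'" "\<And>t. t \<in> A \<Longrightarrow> (F has_real_derivative F' t) (at t)"
    using smooth_real_deriv[OF comp(2)] by blast
  obtain df where df: "\<forall>u\<in>Cn n. gen_smooth n D (df u)"
    "\<forall>u\<in>Cn n. \<forall>z\<in>D. ((\<lambda>t. f (shift z u t)) has_real_derivative df u z) (at 0)"
    using comp by blast
  have "((\<lambda>t. F (f (shift z u t))) has_real_derivative F' (f z) * df u z) (at 0)"
    if "u \<in> Cn n" "z \<in> D" for u z
    using df that DERIV_chain2[of F "F' (f z)" "\<lambda>t. f (shift z u t)" 0 "df u z" UNIV] F' comp(3) by auto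
  then show ?case
    using df gen_smooth.comp[OF comp(1) F'(1) comp(3)]
    by (intro exI[of _ "\<lambda>u z. F' (f z) * df u z"]) (auto intro!: gen_smooth.mult)
next
  case (local D f)
  have loc: "\<exists>W g dg. z \<in> W \<and> W \<subseteq> D \<and> open_Cn n W \<and> (\<forall>w\<in>W. g w = f w) \<and> (\<forall>u\<in>Cn n. gen_smooth n W (dg u)) \<and>
    (\<forall>u\<in>Cn n. \<forall>z\<in>W. ((\<lambda>t. f (shift z u t)) has_real_derivative dg u z) (at 0))" if z: "z \<in> D" for z
  proof -
    obtain W g dg where W: "z \<in> W" "W \<subseteq> D" "gen_smooth n W g" "\<forall>w\<in>W. g w = f w"
     "\<forall>u\<in>Cn n. gen_smooth n W (dg u)"
     "\<forall>u\<in>Cn n. \<forall>z\<in>W. ((\<lambda>t. g (shift z u t)) has_real_derivative dg u z) (at 0)"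
      using local(2)[OF z] by blast
    moreover have "\<forall>u\<in>Cn n. \<forall>z\<in>W. ((\<lambda>t. f (shift z u t)) has_real_derivative dg u z) (at 0)"
    proof (intro ballI)
      fix u y assume "u \<in> Cn n" "y \<in> W"
      then show "((\<lambda>t. f (shift y u t)) has_real_derivative dg u y) (at 0)"
        using W(4,6) by (intro has_real_derivative_shift_cong[OF gen_smooth_open[OF W(3)], of y u g f]) auto
    qed
    ultimately show ?thesis using gen_smooth_open[OF W(3)]
      by (intro exI[of _ W] exI[of _ g] exI[of _ dg]) simp
  qed
  have "gen_smooth n D (dir_deriv u f)" if u: "u \<in> Cn n" for u
  proof (rule gen_smooth.local[OF local(1)])
    fix z assume "z \<in> D"
    from loc[OF this] obtain W g dg where W: "z \<in> W" "W \<subseteq> D" "\<forall>u\<in>Cn n. gen_smooth n W (dg u)"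
      "\<forall>u\<in>Cn n. \<forall>z\<in>W. ((\<lambda>t. f (shift z u t)) has_real_derivative dg u z) (at 0)" by blast
    then show "\<exists>W g. z \<in> W \<and> W \<subseteq> D \<and> gen_smooth n W g \<and> (\<forall>w\<in>W. g w = dir_deriv u f w)"
      using u by (intro exI[of _ W] exI[of _ "dg u"]) (auto intro!: dir_deriv_eqI[symmetric])
  qed
  moreover have "((\<lambda>t. f (shift z u t)) has_real_derivative dir_deriv u f z) (at 0)" if uz: "u \<in> Cn n" "z \<in> D" for u z
  proof -
    obtain d where "((\<lambda>t. f (shift z u t)) has_real_derivative d) (at 0)"
      using loc[OF uz(2)] uz(1) by blast
    then show ?thesis by (simp add: dir_deriv_eqI)
  qed
  ultimately show ?case by (intro exI[of _ "\<lambda>u. dir_deriv u f"]) auto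
qed

lemma gen_smooth_has_derivative:
  assumes "gen_smooth n D f" "u \<in> Cn n" "z \<in> D"
  shows "((\<lambda>t. f (shift z u t)) has_real_derivative dir_deriv u f z) (at 0)"
proof -
  obtain d where "((\<lambda>t. f (shift z u t)) has_real_derivative d) (at 0)"
    using gen_smooth_dir_derivs[OF assms(1)] assms(2,3) by blast
  then show ?thesis by (simp add: dir_deriv_eqI)
qed

lemma gen_smooth_dir_deriv:
  assumes "gen_smooth n D f" "u \<in> Cn n" shows "gen_smooth n D (dir_deriv u f)"
proof -
  obtain df where df: "\<forall>u\<in>Cn n. gen_smooth n D (df u)"
    "\<forall>u\<in>Cn n. \<forall>z\<in>D. ((\<lambda>t. f (shift z u t)) has_real_derivative df u z) (at 0)"
    using gen_smooth_dir_derivs[OF assms(1)] by (elim exE conjE)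
  show ?thesis
  proof (rule gen_smooth_cong)
    show "gen_smooth n D (df u)" using df(1) assms(2) by simp
    show "df u z = dir_deriv u f z" if "z \<in> D" for z
      using df(2) assms(2) that by (intro dir_deriv_eqI[symmetric]) simp
  qed
qed

lemma gen_smooth_continuous: "gen_smooth n D f \<Longrightarrow> continuous_on D f"
proof (induction rule: gen_smooth.induct)
  case (comp D f A F)
  obtain F' where "\<And>t. t \<in> A \<Longrightarrow> (F has_real_derivative F' t) (at t)"
    using smooth_real_deriv[OF comp(2)] by blast
  then have "continuous_on A F"
    by (intro continuous_at_imp_continuous_on) (auto intro: DERIV_isCont)
  then have "continuous_on (f ` D) F" using comp(3) continuous_on_subset by blast
  then show ?case
    using continuous_on_compose[OF comp(4)] by (simp add: o_def)
next
  case (local D f)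
  have "continuous (at z within D) f" if z: "z \<in> D" for z
  proof -
    obtain W g where W: "z \<in> W" "W \<subseteq> D" "gen_smooth n W g" "\<forall>w\<in>W. g w = f w" "continuous_on W g"
      using local(2)[OF z] by blast
    then have "continuous_on W f" using continuous_on_cong[of W W g f] by blast
    have "openin (top_of_set D) W"
      using openin_subset_trans[OF gen_smooth_open[OF W(3)] W(2) open_Cn_subset[OF local(1)]] .
    then have "at z within D = at z within W" using at_within_openin[OF _ W(1)] by blast
    moreover have "continuous (at z within W) f"
      using \<open>continuous_on W f\<close> W(1) unfolding continuous_on_eq_continuous_within by blast
    ultimately show ?thesis by simp
  qed
  then show ?case unfolding continuous_on_eq_continuous_within by blast
next
  case (Re D h)
  then show ?case by (intro continuous_on_Re holomorphic_Cn_continuous)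
qed (auto intro: continuous_on_add continuous_on_mult)

lemma gen_smooth_imp_smooth_Cn:
  assumes "gen_smooth n D f" shows "smooth_Cn n D f"
proof -
  have *: "gen_smooth n D (foldr dir_deriv us f)" if "set us \<subseteq> Cn n" for us
    using that
  proof (induction us)
    case (Cons u us)
    then show ?case using gen_smooth_dir_deriv[of n D "foldr dir_deriv us f" u] by simp
  qed (simp add: assms)
  show ?thesis
    unfolding smooth_Cn_def
  proof (intro allI impI conjI ballI)
    fix us assume us: "set us \<subseteq> Cn n"
    show "continuous_on D (foldr dir_deriv us f)"
      using gen_smooth_continuous[OF *[OF us]] .
    fix z u assume "z \<in> D" "u \<in> Cn n"
    then have "((\<lambda>t. foldr dir_deriv us f (shift z u t)) has_real_derivative
        dir_deriv u (foldr dir_deriv us f) z) (at 0)"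
      by (intro gen_smooth_has_derivative[OF *[OF us]])
    then show "(\<lambda>t. foldr dir_deriv us f (shift z u t)) differentiable at 0"
      unfolding real_differentiable_def by (rule exI)
  qed
qed


lemma dir_deriv_add:
  assumes "gen_smooth n D f" "gen_smooth n D g" "u \<in> Cn n" "z \<in> D"
  shows "dir_deriv u (\<lambda>z. f z + g z) z = dir_deriv u f z + dir_deriv u g z"
  by (intro dir_deriv_eqI DERIV_add gen_smooth_has_derivative[of n D]) (use assms in auto)

lemma dir_deriv_mult:
  assumes "gen_smooth n D f" "gen_smooth n D g" "u \<in> Cn n" "z \<in> D"
  shows "dir_deriv u (\<lambda>z. f z * g z) z = dir_deriv u f z * g z + f z * dir_deriv u g z"
  using DERIV_mult[OF gen_smooth_has_derivative[OF assms(1,3,4)] gen_smooth_has_derivative[OF assms(2,3,4)]]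
  by (intro dir_deriv_eqI) (simp add: mult.commute add.commute)

lemma dir_deriv_comp:
  assumes "gen_smooth n D f" "u \<in> Cn n" "z \<in> D" "(F has_real_derivative F') (at (f z))"
  shows "dir_deriv u (\<lambda>z. F (f z)) z = F' * dir_deriv u f z"
  using DERIV_chain2[OF _ gen_smooth_has_derivative[OF assms(1-3)], of F F'] assms(4)
  by (intro dir_deriv_eqI) simp

lemma dir_deriv_cmult:
  assumes "gen_smooth n D f" "u \<in> Cn n" "z \<in> D"
  shows "dir_deriv u (\<lambda>z. a * f z) z = a * dir_deriv u f z"
  using dir_deriv_comp[OF assms, of "\<lambda>x. a * x" a] by (simp add: DERIV_cmult_Id)

lemma dir_deriv_minus:
  assumes "gen_smooth n D f" "u \<in> Cn n" "z \<in> D"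
  shows "dir_deriv u (\<lambda>z. - f z) z = - dir_deriv u f z"
  using dir_deriv_cmult[OF assms, of "-1"] by simp

lemma dir_deriv_diff:
  assumes "gen_smooth n D f" "gen_smooth n D g" "u \<in> Cn n" "z \<in> D"
  shows "dir_deriv u (\<lambda>z. f z - g z) z = dir_deriv u f z - dir_deriv u g z"
  using dir_deriv_add[OF assms(1) gen_smooth_minus[OF assms(2)] assms(3,4)] dir_deriv_minus[OF assms(2-4)] by simp

lemma dir_deriv_const [simp]: "dir_deriv u (\<lambda>z. a) z = 0"
  by (simp add: dir_deriv_def)

lemma dir_deriv_sum:
  assumes "open_Cn n D" "\<And>j. j \<in> J \<Longrightarrow> gen_smooth n D (f j)" "u \<in> Cn n" "z \<in> D"
  shows "dir_deriv u (\<lambda>z. \<Sum>j\<in>J. f j z) z = (\<Sum>j\<in>J. dir_deriv u (f j) z)"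
  using assms(2)
proof (induction J rule: infinite_finite_induct)
  case (insert j J)
  then have "dir_deriv u (\<lambda>z. f j z + (\<Sum>j\<in>J. f j z)) z = dir_deriv u (f j) z + dir_deriv u (\<lambda>z. \<Sum>j\<in>J. f j z) z"
    using assms by (intro dir_deriv_add[of n D] gen_smooth_sum) auto
  with insert show ?case by simp
qed auto

lemma dir_deriv_Re:
  assumes "holomorphic_Cn n D h" "u \<in> Cn n" "z \<in> D"
  shows "dir_deriv u (\<lambda>z. Re (h z)) z = Re (cdir n u h z)"
  using bounded_linear.has_vector_derivative[OF bounded_linear_Re cdir_has_derivative[OF assms(1,3,2)]]
  by (intro dir_deriv_eqI) (simp add: has_real_derivative_iff_has_vector_derivative)

lemma dir_deriv_Im:
  assumes "holomorphic_Cn n D h" "u \<in> Cn n" "z \<in> D"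
  shows "dir_deriv u (\<lambda>z. Im (h z)) z = Im (cdir n u h z)"
  using bounded_linear.has_vector_derivative[OF bounded_linear_Im cdir_has_derivative[OF assms(1,3,2)]]
  by (intro dir_deriv_eqI) (simp add: has_real_derivative_iff_has_vector_derivative)

text \<open>
  Linearity in the direction is not part of the definition of \<open>dir_deriv\<close>; it is inherited from the
  complex linearity of \<open>cdir\<close>.
\<close>

lemma dir_deriv_linear:
  assumes "gen_smooth n D f"
  shows "u \<in> Cn n \<Longrightarrow> v \<in> Cn n \<Longrightarrow> z \<in> D \<Longrightarrow> dir_deriv (add_cvec u v) f z = dir_deriv u f z + dir_deriv v f z"
    and "u \<in> Cn n \<Longrightarrow> z \<in> D \<Longrightarrow> dir_deriv (scale_cvec (of_real a) u) f z = a * dir_deriv u f z"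
proof -
  have "\<forall>u\<in>Cn n. \<forall>v\<in>Cn n. \<forall>z\<in>D. \<forall>a::real. dir_deriv (add_cvec u v) f z = dir_deriv u f z + dir_deriv v f z \<and>
     dir_deriv (scale_cvec (of_real a) u) f z = a * dir_deriv u f z"
    using assms
  proof (induction rule: gen_smooth.induct)
    case (Re D h)
    then show ?case by (simp add: dir_deriv_Re[of n D] cdir_add cdir_scale)
  next
    case (add D f g)
    then show ?case by (simp add: dir_deriv_add[of n D] algebra_simps)
  next
    case (mult D f g)
    then show ?case by (simp add: dir_deriv_mult[of n D] algebra_simps)
  next
    case (comp D f A F)
    obtain F' where F': "\<And>t. t \<in> A \<Longrightarrow> (F has_real_derivative F' t) (at t)"
      using smooth_real_deriv[OF comp(2)] by blast
    have "dir_deriv u (\<lambda>z. F (f z)) z = F' (f z) * dir_deriv u f z" if "u \<in> Cn n" "z \<in> D" for u z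
      using dir_deriv_comp[OF comp(1) that F'] comp(3) that by blast
    with comp show ?case by (simp add: algebra_simps)
  next
    case (local D f)
    show ?case
    proof (intro ballI)
      fix u v z assume u: "u \<in> Cn n" and v: "v \<in> Cn n" and z: "z \<in> D"
      obtain W g where W: "z \<in> W" "gen_smooth n W g" "\<forall>w\<in>W. g w = f w"
        and IH: "\<forall>u\<in>Cn n. \<forall>v\<in>Cn n. \<forall>z\<in>W. \<forall>a::real. dir_deriv (add_cvec u v) g z = dir_deriv u g z + dir_deriv v g z \<and>
          dir_deriv (scale_cvec (of_real a) u) g z = a * dir_deriv u g z"
        using local(2)[OF z] by auto
      have "dir_deriv u f z = dir_deriv u g z" if "u \<in> Cn n" for u
        using dir_deriv_cong[OF gen_smooth_open[OF W(2)] W(1) that] W(3) by metis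
      with IH u v W(1) show "\<forall>a::real. dir_deriv (add_cvec u v) f z = dir_deriv u f z + dir_deriv v f z \<and>
          dir_deriv (scale_cvec (of_real a) u) f z = a * dir_deriv u f z" by auto
    qed
  qed
  then show "u \<in> Cn n \<Longrightarrow> v \<in> Cn n \<Longrightarrow> z \<in> D \<Longrightarrow> dir_deriv (add_cvec u v) f z = dir_deriv u f z + dir_deriv v f z"
    and "u \<in> Cn n \<Longrightarrow> z \<in> D \<Longrightarrow> dir_deriv (scale_cvec (of_real a) u) f z = a * dir_deriv u f z" by auto
qed

text \<open>
  The symmetry of second derivatives reduces to that of the complex partial derivatives.
\<close>

lemma dir_deriv_commute:
  "gen_smooth n D f \<Longrightarrow> u \<in> Cn n \<Longrightarrow> v \<in> Cn n \<Longrightarrow> z \<in> D \<Longrightarrow>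
     dir_deriv u (dir_deriv v f) z = dir_deriv v (dir_deriv u f) z"
proof (induction arbitrary: z u v rule: gen_smooth.induct)
  case (Re D h)
  have "dir_deriv u (dir_deriv v (\<lambda>z. Re (h z))) z = Re (cdir n u (cdir n v h) z)"
    if "u \<in> Cn n" "v \<in> Cn n" for u v
  proof -
    have "dir_deriv u (dir_deriv v (\<lambda>z. Re (h z))) z = dir_deriv u (\<lambda>z. Re (cdir n v h z)) z"
      using Re that by (intro dir_deriv_cong[of n D] dir_deriv_Re[of n D]) (auto dest: holomorphic_Cn_open)
    also have "\<dots> = Re (cdir n u (cdir n v h) z)"
      using Re that by (intro dir_deriv_Re[of n D] holomorphic_cdir) auto
    finally show ?thesis .
  qed
  from this[of u v] this[of v u] show ?case using Re(2,3) cdir_commute[OF Re(1,4), of u v] by simp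
next
  case (add D f g)
  have o: "open_Cn n D" using gen_smooth_open[OF add.hyps(1)] .
  have "dir_deriv u (dir_deriv v (\<lambda>z. f z + g z)) z = dir_deriv u (dir_deriv v f) z + dir_deriv u (dir_deriv v g) z"
    if uv: "u \<in> Cn n" "v \<in> Cn n" for u v
  proof -
    have "dir_deriv u (dir_deriv v (\<lambda>z. f z + g z)) z = dir_deriv u (\<lambda>z. dir_deriv v f z + dir_deriv v g z) z"
      using add.hyps add.prems uv by (intro dir_deriv_cong[OF o] dir_deriv_add[of n D]) auto
    also have "\<dots> = dir_deriv u (dir_deriv v f) z + dir_deriv u (dir_deriv v g) z"
      using add.hyps add.prems uv by (intro dir_deriv_add[of n D] gen_smooth_dir_deriv) auto
    finally show ?thesis .
  qed
  from this[of u v] this[of v u] show ?case using add.prems(1,2) add.IH(1,2)[OF add.prems] by simp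
next
  case (mult D f g)
  have o: "open_Cn n D" using gen_smooth_open[OF mult.hyps(1)] .
  have "dir_deriv u (dir_deriv v (\<lambda>z. f z * g z)) z =
      dir_deriv u (dir_deriv v f) z * g z + dir_deriv v f z * dir_deriv u g z +
      (dir_deriv u f z * dir_deriv v g z + f z * dir_deriv u (dir_deriv v g) z)"
    if uv: "u \<in> Cn n" "v \<in> Cn n" for u v
  proof -
    note sm = mult.hyps gen_smooth_dir_deriv[OF mult.hyps(1) uv(2)] gen_smooth_dir_deriv[OF mult.hyps(2) uv(2)]
    have "dir_deriv u (dir_deriv v (\<lambda>z. f z * g z)) z = dir_deriv u (\<lambda>z. dir_deriv v f z * g z + f z * dir_deriv v g z) z"
      using mult.hyps mult.prems uv by (intro dir_deriv_cong[OF o] dir_deriv_mult[of n D]) auto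
    also have "\<dots> = dir_deriv u (\<lambda>z. dir_deriv v f z * g z) z + dir_deriv u (\<lambda>z. f z * dir_deriv v g z) z"
      using sm mult.prems uv by (intro dir_deriv_add[of n D] gen_smooth.mult) auto
    also have "dir_deriv u (\<lambda>z. dir_deriv v f z * g z) z = dir_deriv u (dir_deriv v f) z * g z + dir_deriv v f z * dir_deriv u g z"
      using sm mult.prems uv by (intro dir_deriv_mult[of n D]) auto
    also have "dir_deriv u (\<lambda>z. f z * dir_deriv v g z) z = dir_deriv u f z * dir_deriv v g z + f z * dir_deriv u (dir_deriv v g) z"
      using sm mult.prems uv by (intro dir_deriv_mult[of n D]) auto
    finally show ?thesis .
  qed
  from this[of u v] this[of v u] show ?case
    using mult.prems(1,2) mult.IH(1,2)[OF mult.prems] by (simp add: algebra_simps)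
next
  case (comp D f A F)
  have o: "open_Cn n D" using gen_smooth_open[OF comp.hyps(1)] .
  obtain F' where F': "smooth_real A F'" "\<And>t. t \<in> A \<Longrightarrow> (F has_real_derivative F' t) (at t)"
    using smooth_real_deriv[OF comp(2)] by blast
  obtain F'' where F'': "\<And>t. t \<in> A \<Longrightarrow> (F' has_real_derivative F'' t) (at t)"
    using smooth_real_deriv[OF F'(1)] by blast
  have "dir_deriv u (dir_deriv v (\<lambda>z. F (f z))) z =
      F'' (f z) * dir_deriv u f z * dir_deriv v f z + F' (f z) * dir_deriv u (dir_deriv v f) z"
    if uv: "u \<in> Cn n" "v \<in> Cn n" for u v
  proof -
    have "dir_deriv u (dir_deriv v (\<lambda>z. F (f z))) z = dir_deriv u (\<lambda>z. F' (f z) * dir_deriv v f z) z"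
      using comp.hyps comp.prems uv F' by (intro dir_deriv_cong[OF o] dir_deriv_comp[of n D]) auto
    also have "\<dots> = dir_deriv u (\<lambda>z. F' (f z)) z * dir_deriv v f z + F' (f z) * dir_deriv u (dir_deriv v f) z"
      using comp.hyps comp.prems uv F'
      by (intro dir_deriv_mult[of n D] gen_smooth_dir_deriv gen_smooth.comp[of n D f A F']) auto
    also have "dir_deriv u (\<lambda>z. F' (f z)) z = F'' (f z) * dir_deriv u f z"
      using comp.hyps comp.prems uv F'' by (intro dir_deriv_comp[of n D]) auto
    finally show ?thesis .
  qed
  from this[of u v] this[of v u] show ?case
    using comp.prems(1,2) comp.IH[OF comp.prems] by (simp add: algebra_simps)
next
  case (local D f)
  obtain W g where W: "z \<in> W" "gen_smooth n W g" "\<forall>w\<in>W. g w = f w"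
    and IH: "\<And>z u v. u \<in> Cn n \<Longrightarrow> v \<in> Cn n \<Longrightarrow> z \<in> W \<Longrightarrow> dir_deriv u (dir_deriv v g) z = dir_deriv v (dir_deriv u g) z"
    using local(2)[OF local(5)] by auto
  note o = gen_smooth_open[OF W(2)]
  have "dir_deriv u (dir_deriv v f) z = dir_deriv u (dir_deriv v g) z" if "u \<in> Cn n" "v \<in> Cn n" for u v
    using that W by (intro dir_deriv_cong[OF o]) auto
  from this[of u v] this[of v u] show ?case using local(3,4) IH[OF local(3,4) W(1)] by simp
qed

text \<open>
  The differential of \<open>\<Phi>\<close> at \<open>z\<close> applied to \<open>u\<close>; in charts this is \<open>push\<close>.
\<close>

definition jac :: "(cvec \<Rightarrow> cvec) \<Rightarrow> cvec \<Rightarrow> cvec \<Rightarrow> cvec" where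
  "jac \<Phi> u z = (\<lambda>k. dir_deriv u (\<lambda>w. \<Phi> w k) z)"

lemma jac_eq:
  assumes "holomorphic_to m D n D' \<Phi>" "z \<in> D" "u \<in> Cn m"
  shows "jac \<Phi> u z = (\<lambda>k. if k < n then cdir m u (\<lambda>w. \<Phi> w k) z else 0)"
proof
  fix k
  show "jac \<Phi> u z k = (if k < n then cdir m u (\<lambda>w. \<Phi> w k) z else 0)"
  proof (cases "k < n")
    case True
    then show ?thesis
      using assms dir_deriv_holomorphic[of m D "\<lambda>w. \<Phi> w k"] by (simp add: jac_def holomorphic_to_def)
  next
    case False
    have "\<Phi> w k = 0" if w: "w \<in> D" for w
    proof -
      have "\<Phi> w \<in> D'" "open_Cn n D'" using assms(1) w by (auto simp: holomorphic_to_def)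
      then have "\<Phi> w \<in> Cn n" using open_Cn_subset by auto
      then show ?thesis using False by (auto simp: Cn_def)
    qed
    then have "dir_deriv u (\<lambda>w. \<Phi> w k) z = dir_deriv u (\<lambda>w. 0) z"
      using assms by (intro dir_deriv_cong[of m D]) (auto simp: holomorphic_to_def)
    then show ?thesis using False by (simp add: jac_def)
  qed
qed

lemma jac_Cn: "holomorphic_to m D n D' \<Phi> \<Longrightarrow> z \<in> D \<Longrightarrow> u \<in> Cn m \<Longrightarrow> jac \<Phi> u z \<in> Cn n"
  by (subst jac_eq) (auto simp: Cn_def)

lemma cdir_compose:
  assumes \<Phi>: "holomorphic_to m D n D' \<Phi>" and h: "holomorphic_Cn n D' h" and z: "z \<in> D" "u \<in> Cn m"
  shows "cdir m u (\<lambda>w. h (\<Phi> w)) z = cdir n (jac \<Phi> u z) h (\<Phi> z)"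
  using holomorphic_Cn_compose(2)[OF \<Phi> h z(1)]
  by (simp add: cdir_def jac_eq[OF \<Phi> z] sum_distrib_left sum_distrib_right sum.swap[of _ "{..<n}"] mult.assoc)

lemma holomorphic_to_restrict:
  assumes \<Phi>: "holomorphic_to m D n D' \<Phi>" and W: "open_Cn n W"
  shows "holomorphic_to m (D \<inter> \<Phi> -` W) n W \<Phi>"
proof -
  have D: "open_Cn m D" using \<Phi> by (auto simp: holomorphic_to_def)
  obtain T where T: "open T" "W = Cn n \<inter> T" using W by (auto simp: openin_open)
  have "\<Phi> ` D \<subseteq> Cn n" using \<Phi> open_Cn_subset[of n D'] by (auto simp: holomorphic_to_def)
  then have "D \<inter> \<Phi> -` W = D \<inter> \<Phi> -` T" using T by auto
  then have "openin (top_of_set D) (D \<inter> \<Phi> -` W)"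
    using continuous_openin_preimage_gen[OF holomorphic_to_continuous[OF \<Phi>] T(1)] by simp
  then have "open_Cn m (D \<inter> \<Phi> -` W)" using D openin_trans by blast
  then show ?thesis using \<Phi> W holomorphic_Cn_subset[of m D _ "D \<inter> \<Phi> -` W"]
    by (simp add: holomorphic_to_def image_subset_iff)
qed

lemma gen_smooth_chain_rule:
  "gen_smooth n D' f \<Longrightarrow> holomorphic_to m D n D' \<Phi> \<Longrightarrow> gen_smooth m D (\<lambda>w. f (\<Phi> w)) \<and>
     (\<forall>z\<in>D. \<forall>u\<in>Cn m. dir_deriv u (\<lambda>w. f (\<Phi> w)) z = dir_deriv (jac \<Phi> u z) f (\<Phi> z))"
proof (induction arbitrary: D rule: gen_smooth.induct)
  case (Re D' h)
  have h: "holomorphic_Cn m D (\<lambda>w. h (\<Phi> w))"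
    using holomorphic_Cn_compose(1)[OF Re(2,1)] .
  have "\<Phi> z \<in> D'" if "z \<in> D" for z using that Re(2) by (auto simp: holomorphic_to_def)
  then show ?case
    using dir_deriv_Re[OF h] dir_deriv_Re[OF Re(1) jac_Cn[OF Re(2)]] cdir_compose[OF Re(2,1)] gen_smooth.Re[OF h] by simp
next
  case (add D' f g)
  have "\<Phi> z \<in> D'" if "z \<in> D" for z using that add.prems by (auto simp: holomorphic_to_def)
  then show ?case
    using add.IH[OF add.prems] dir_deriv_add[OF add.hyps jac_Cn[OF add.prems]]
    by (auto simp: dir_deriv_add[of m D] intro: gen_smooth.add)
next
  case (mult D' f g)
  have "\<Phi> z \<in> D'" if "z \<in> D" for z using that mult.prems by (auto simp: holomorphic_to_def)
  then show ?case
    using mult.IH[OF mult.prems] dir_deriv_mult[OF mult.hyps jac_Cn[OF mult.prems]]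
    by (auto simp: dir_deriv_mult[of m D] intro: gen_smooth.mult)
next
  case (comp D' f A F)
  have in': "\<Phi> z \<in> D'" if "z \<in> D" for z using that comp.prems by (auto simp: holomorphic_to_def)
  obtain F' where F': "\<And>t. t \<in> A \<Longrightarrow> (F has_real_derivative F' t) (at t)"
    using smooth_real_deriv[OF comp(2)] by blast
  have IH: "gen_smooth m D (\<lambda>w. f (\<Phi> w))"
     "\<And>z u. z \<in> D \<Longrightarrow> u \<in> Cn m \<Longrightarrow> dir_deriv u (\<lambda>w. f (\<Phi> w)) z = dir_deriv (jac \<Phi> u z) f (\<Phi> z)"
    using comp.IH[OF comp.prems] by auto
  have "dir_deriv u (\<lambda>w. F (f (\<Phi> w))) z = dir_deriv (jac \<Phi> u z) (\<lambda>w. F (f w)) (\<Phi> z)"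
    if "z \<in> D" "u \<in> Cn m" for z u
    using dir_deriv_comp[OF IH(1) that(2,1), of F "F' (f (\<Phi> z))"] in'[OF that(1)] comp.hyps
      dir_deriv_comp[OF comp.hyps(1) jac_Cn[OF comp.prems that] in'[OF that(1)], of F "F' (f (\<Phi> z))"] F' IH(2)[OF that]
    by (simp add: image_subset_iff)
  moreover have "gen_smooth m D (\<lambda>w. F (f (\<Phi> w)))"
    using gen_smooth.comp[OF IH(1) comp.hyps(2)] in' comp.hyps by auto
  ultimately show ?case by blast
next
  case (local D' f)
  have D: "open_Cn m D" using local.prems by (auto simp: holomorphic_to_def)
  have loc: "\<exists>W g. z \<in> W \<and> W \<subseteq> D \<and> gen_smooth m W (\<lambda>w. g (\<Phi> w)) \<and> (\<forall>w\<in>W. g (\<Phi> w) = f (\<Phi> w)) \<and>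
     (\<forall>u\<in>Cn m. dir_deriv u (\<lambda>w. f (\<Phi> w)) z = dir_deriv (jac \<Phi> u z) f (\<Phi> z))" if z: "z \<in> D" for z
  proof -
    have z': "\<Phi> z \<in> D'" using z local.prems by (auto simp: holomorphic_to_def)
    obtain W g where W: "\<Phi> z \<in> W" "W \<subseteq> D'" "gen_smooth n W g" "\<forall>w\<in>W. g w = f w"
      and IH: "\<And>D. holomorphic_to m D n W \<Phi> \<Longrightarrow> gen_smooth m D (\<lambda>w. g (\<Phi> w)) \<and>
         (\<forall>z\<in>D. \<forall>u\<in>Cn m. dir_deriv u (\<lambda>w. g (\<Phi> w)) z = dir_deriv (jac \<Phi> u z) g (\<Phi> z))"
      using local(2)[OF z'] by auto
    let ?V = "D \<inter> \<Phi> -` W"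
    have V: "holomorphic_to m ?V n W \<Phi>"
      using holomorphic_to_restrict[OF local.prems gen_smooth_open[OF W(3)]] .
    then have Vo: "open_Cn m ?V" by (auto simp: holomorphic_to_def)
    have "dir_deriv u (\<lambda>w. f (\<Phi> w)) z = dir_deriv (jac \<Phi> u z) f (\<Phi> z)" if u: "u \<in> Cn m" for u
    proof -
      have "dir_deriv u (\<lambda>w. f (\<Phi> w)) z = dir_deriv u (\<lambda>w. g (\<Phi> w)) z"
        using z W u by (intro dir_deriv_cong[OF Vo]) auto
      also have "\<dots> = dir_deriv (jac \<Phi> u z) g (\<Phi> z)" using IH[OF V] z u W by auto
      also have "\<dots> = dir_deriv (jac \<Phi> u z) f (\<Phi> z)"
        using z W u jac_Cn[OF local.prems z u] by (intro dir_deriv_cong[OF gen_smooth_open[OF W(3)]]) auto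
      finally show ?thesis .
    qed
    then show ?thesis using IH[OF V] z W by (intro exI[of _ ?V] exI[of _ g]) auto
  qed
  have "gen_smooth m D (\<lambda>w. f (\<Phi> w))"
  proof (rule gen_smooth.local[OF D])
    fix z assume "z \<in> D"
    from loc[OF this] obtain W g where "z \<in> W" "W \<subseteq> D" "gen_smooth m W (\<lambda>w. g (\<Phi> w))" "\<forall>w\<in>W. g (\<Phi> w) = f (\<Phi> w)"
      by auto
    then show "\<exists>W g. z \<in> W \<and> W \<subseteq> D \<and> gen_smooth m W g \<and> (\<forall>w\<in>W. g w = f (\<Phi> w))"
      by (intro exI[of _ W] exI[of _ "\<lambda>w. g (\<Phi> w)"]) auto
  qed
  moreover have "\<forall>z\<in>D. \<forall>u\<in>Cn m. dir_deriv u (\<lambda>w. f (\<Phi> w)) z = dir_deriv (jac \<Phi> u z) f (\<Phi> z)"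
    using loc by blast
  ultimately show ?case by blast
qed

lemma gen_smooth_compose:
  "gen_smooth n D' f \<Longrightarrow> holomorphic_to m D n D' \<Phi> \<Longrightarrow> gen_smooth m D (\<lambda>w. f (\<Phi> w))"
  using gen_smooth_chain_rule by blast

lemma dir_deriv_compose:
  "gen_smooth n D' f \<Longrightarrow> holomorphic_to m D n D' \<Phi> \<Longrightarrow> z \<in> D \<Longrightarrow> u \<in> Cn m \<Longrightarrow>
    dir_deriv u (\<lambda>w. f (\<Phi> w)) z = dir_deriv (jac \<Phi> u z) f (\<Phi> z)"
  using gen_smooth_chain_rule by blast

section \<open>The form ddc f and its Levi form\<close>

abbreviation iscale :: "cvec \<Rightarrow> cvec" where "iscale \<equiv> scale_cvec \<i>"

abbreviation second_deriv :: "(cvec \<Rightarrow> real) \<Rightarrow> cvec \<Rightarrow> cvec \<Rightarrow> cvec \<Rightarrow> real" where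
  "second_deriv f z u v \<equiv> dir_deriv u (dir_deriv v f) z"

lemma iscale_iscale: "iscale (iscale u) = scale_cvec (of_real (-1)) u"
  by (auto simp: scale_cvec_def)

lemma iscale_add: "iscale (add_cvec u v) = add_cvec (iscale u) (iscale v)"
  and iscale_scale: "iscale (scale_cvec a u) = scale_cvec a (iscale u)"
  by (auto simp: scale_cvec_def add_cvec_def algebra_simps)

lemma second_deriv_linear_left:
  assumes "gen_smooth n D f" "v \<in> Cn n" "z \<in> D"
  shows "u \<in> Cn n \<Longrightarrow> w \<in> Cn n \<Longrightarrow> second_deriv f z (add_cvec u w) v = second_deriv f z u v + second_deriv f z w v"
    and "u \<in> Cn n \<Longrightarrow> second_deriv f z (scale_cvec (of_real a) u) v = a * second_deriv f z u v"
  using dir_deriv_linear[OF gen_smooth_dir_deriv[OF assms(1,2)]] assms(3) by blast+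

lemma second_deriv_linear_right:
  assumes "gen_smooth n D f" "v \<in> Cn n" "z \<in> D"
  shows "u \<in> Cn n \<Longrightarrow> w \<in> Cn n \<Longrightarrow> second_deriv f z v (add_cvec u w) = second_deriv f z v u + second_deriv f z v w"
    and "u \<in> Cn n \<Longrightarrow> second_deriv f z v (scale_cvec (of_real a) u) = a * second_deriv f z v u"
  using second_deriv_linear_left[OF assms] dir_deriv_commute[OF assms(1) _ assms(2,3)]
  by (metis add_cvec_Cn) (metis second_deriv_linear_left(2)[OF assms] dir_deriv_commute[OF assms(1) _ assms(2,3)] scale_cvec_Cn)

lemma ddc_eq:
  assumes "gen_smooth n D f" "z \<in> D" "u \<in> Cn n" "v \<in> Cn n"
  shows "ddc f z u v = second_deriv f z v (iscale u) - second_deriv f z u (iscale v)"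
  using assms
  by (simp add: ddc_def ext_deriv1_def dc_def dir_deriv_minus[OF gen_smooth_dir_deriv])

lemma gen_smooth_ddc:
  assumes "gen_smooth n D f" "u \<in> Cn n" "v \<in> Cn n"
  shows "gen_smooth n D (\<lambda>z. ddc f z u v)"
proof (rule gen_smooth_cong)
  show "gen_smooth n D (\<lambda>z. second_deriv f z v (iscale u) - second_deriv f z u (iscale v))"
    using assms by (intro gen_smooth_diff gen_smooth_dir_deriv) auto
qed (use ddc_eq assms in simp)

lemma ddc_skew: "ddc f z v u = - ddc f z u v"
  by (simp add: ddc_def ext_deriv1_def)

lemma ddc_cong:
  assumes "open_Cn n W" "z \<in> W" "\<And>w. w \<in> W \<Longrightarrow> f w = g w" "u \<in> Cn n" "v \<in> Cn n"
  shows "ddc f z u v = ddc g z u v"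
  unfolding ddc_def ext_deriv1_def dc_def
  using assms by (intro arg_cong2[where f = "(-)"] dir_deriv_cong[OF assms(1,2)] arg_cong[where f = uminus] dir_deriv_cong[OF assms(1)]) auto

lemma ddc_linear:
  assumes "gen_smooth n D f" "z \<in> D" "u \<in> Cn n" "v \<in> Cn n"
  shows "w \<in> Cn n \<Longrightarrow> ddc f z (add_cvec u w) v = ddc f z u v + ddc f z w v"
    and "ddc f z (scale_cvec (of_real a) u) v = a * ddc f z u v"
  using assms second_deriv_linear_left[OF assms(1)] second_deriv_linear_right[OF assms(1)]
  by (simp_all add: ddc_eq[OF assms(1)] iscale_add iscale_scale algebra_simps)

lemma ddc_cmult:
  assumes "gen_smooth n D f" "z \<in> D" "u \<in> Cn n" "v \<in> Cn n"
  shows "ddc (\<lambda>z. a * f z) z u v = a * ddc f z u v"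
proof -
  have o: "open_Cn n D" using gen_smooth_open[OF assms(1)] .
  have "second_deriv (\<lambda>z. a * f z) z u v = a * second_deriv f z u v" if "u \<in> Cn n" "v \<in> Cn n" for u v
  proof -
    have "second_deriv (\<lambda>z. a * f z) z u v = dir_deriv u (\<lambda>z. a * dir_deriv v f z) z"
      using that assms by (intro dir_deriv_cong[OF o] dir_deriv_cmult[of n D]) auto
    also have "\<dots> = a * second_deriv f z u v"
      using that assms by (intro dir_deriv_cmult[of n D] gen_smooth_dir_deriv) auto
    finally show ?thesis .
  qed
  then show ?thesis
    using assms by (simp add: ddc_eq[OF gen_smooth_cmult[OF assms(1)]] ddc_eq[OF assms(1)] algebra_simps)
qed

text \<open>
  This says that \<open>ddc f\<close> is of type (1,1).
\<close>

lemma ddc_invariant: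
  assumes "gen_smooth n D f" "z \<in> D" "u \<in> Cn n" "v \<in> Cn n"
  shows "ddc f z (iscale u) (iscale v) = ddc f z u v"
proof -
  have 1: "second_deriv f z (iscale v) (scale_cvec (of_real (-1)) u) = - second_deriv f z u (iscale v)"
       "second_deriv f z (iscale u) (scale_cvec (of_real (-1)) v) = - second_deriv f z v (iscale u)"
    using assms second_deriv_linear_right(2)[OF assms(1) _ assms(2), of "iscale v" u "-1"]
      second_deriv_linear_right(2)[OF assms(1) _ assms(2), of "iscale u" v "-1"]
      dir_deriv_commute[OF assms(1) _ _ assms(2), of u "iscale v"]
      dir_deriv_commute[OF assms(1) _ _ assms(2), of v "iscale u"] by auto
  show ?thesis
    using assms 1 by (simp add: ddc_eq[OF assms(1)] iscale_iscale)
qed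

text \<open>
  The six third derivatives cancel in pairs, by the symmetry of derivatives of the functions
  \<open>dir_deriv (iscale u) f\<close>.
\<close>

lemma ddc_closed:
  assumes f: "gen_smooth n D f" and z: "z \<in> D" and uvw: "u \<in> Cn n" "v \<in> Cn n" "w \<in> Cn n"
  shows "ext_deriv2 (ddc f) z u v w = 0"
proof -
  have o: "open_Cn n D" using gen_smooth_open[OF f] .
  have 1: "dir_deriv a (\<lambda>x. ddc f x b c) z =
      second_deriv (dir_deriv (iscale b) f) z a c - second_deriv (dir_deriv (iscale c) f) z a b"
    if "a \<in> Cn n" "b \<in> Cn n" "c \<in> Cn n" for a b c
  proof -
    have "dir_deriv a (\<lambda>x. ddc f x b c) z = dir_deriv a (\<lambda>x. second_deriv f x c (iscale b) - second_deriv f x b (iscale c)) z"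
      using that z by (intro dir_deriv_cong[OF o] ddc_eq[OF f]) auto
    also have "\<dots> = second_deriv (dir_deriv (iscale b) f) z a c - second_deriv (dir_deriv (iscale c) f) z a b"
      using that z f by (intro dir_deriv_diff[of n D] gen_smooth_dir_deriv) auto
    finally show ?thesis .
  qed
  have 2: "second_deriv (dir_deriv (iscale c) f) z a b = second_deriv (dir_deriv (iscale c) f) z b a"
    if "a \<in> Cn n" "b \<in> Cn n" "c \<in> Cn n" for a b c
    using dir_deriv_commute[OF gen_smooth_dir_deriv[OF f scale_cvec_Cn[OF that(3)]] that(1,2) z] .
  show ?thesis
    unfolding ext_deriv2_def using uvw 2[of u v w] 2[of u w v] 2[of v w u] by (simp add: 1)
qed

definition unit_cvec :: "nat \<Rightarrow> cvec" where "unit_cvec k = (\<lambda>j. if j = k then 1 else 0)"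

lemma unit_cvec_Cn: "k < n \<Longrightarrow> unit_cvec k \<in> Cn n"
  by (auto simp: Cn_def unit_cvec_def)

text \<open>
  The first derivative of \<open>f \<circ> \<Phi>\<close> is a derivative of \<open>f\<close> in a direction that varies with the point. It
  can be differentiated again after it is expanded along a fixed real basis.
\<close>

lemma dir_deriv_coordinates:
  assumes f: "gen_smooth n D f" and z: "z \<in> D" and w: "w \<in> Cn n"
  shows "dir_deriv w f z = (\<Sum>k<n. Re (w k) * dir_deriv (unit_cvec k) f z + Im (w k) * dir_deriv (iscale (unit_cvec k)) f z)"
proof -
  have "dir_deriv (\<lambda>k. if k < m then w k else 0) f z =
      (\<Sum>k<m. Re (w k) * dir_deriv (unit_cvec k) f z + Im (w k) * dir_deriv (iscale (unit_cvec k)) f z)"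
    if "m \<le> n" for m
    using that
  proof (induction m)
    case 0
    have "dir_deriv (scale_cvec (of_real 0) w) f z = 0"
      using dir_deriv_linear(2)[OF f w z, of 0] by simp
    then show ?case by (simp add: scale_cvec_def)
  next
    case (Suc m)
    have e: "(\<lambda>k. if k < Suc m then w k else 0) = add_cvec (\<lambda>k. if k < m then w k else 0)
       (add_cvec (scale_cvec (of_real (Re (w m))) (unit_cvec m)) (scale_cvec (of_real (Im (w m))) (iscale (unit_cvec m))))"
      by (auto simp: fun_eq_iff add_cvec_def scale_cvec_def unit_cvec_def less_Suc_eq complex_eq_iff)
    have C: "(\<lambda>k. if k < m then w k else 0) \<in> Cn n" "unit_cvec m \<in> Cn n" "iscale (unit_cvec m) \<in> Cn n"
      using w Suc.prems by (auto simp: Cn_def unit_cvec_def scale_cvec_def)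
    show ?case unfolding e
      using C Suc z by (simp add: dir_deriv_linear(1)[OF f] dir_deriv_linear(2)[OF f])
  qed
  from this[of n] have "dir_deriv (\<lambda>k. if k < n then w k else 0) f z =
      (\<Sum>k<n. Re (w k) * dir_deriv (unit_cvec k) f z + Im (w k) * dir_deriv (iscale (unit_cvec k)) f z)" by simp
  moreover have "(\<lambda>k. if k < n then w k else 0) = w" using w by (auto simp: Cn_def)
  ultimately show ?thesis by simp
qed

text \<open>
  The last summand is the derivative of \<open>f\<close> along the second derivative of \<open>\<Phi>\<close>.
\<close>

lemma second_deriv_compose:
  assumes f: "gen_smooth n D' f" and \<Phi>: "holomorphic_to m D n D' \<Phi>" and z: "z \<in> D" and u: "u \<in> Cn m" and v: "v \<in> Cn m"
  shows "second_deriv (\<lambda>w. f (\<Phi> w)) z u v = second_deriv f (\<Phi> z) (jac \<Phi> u z) (jac \<Phi> v z) +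
     dir_deriv (\<lambda>k. if k < n then cdir m u (cdir m v (\<lambda>w. \<Phi> w k)) z else 0) f (\<Phi> z)"
proof -
  let ?E = unit_cvec and ?I = "\<lambda>k. iscale (unit_cvec k)"
  let ?J = "\<lambda>k. cdir m v (\<lambda>w. \<Phi> w k)"
  let ?H = "\<lambda>k. if k < n then cdir m u (?J k) z else 0"
  have o: "open_Cn m D" and hol: "\<And>k. k < n \<Longrightarrow> holomorphic_Cn m D (\<lambda>w. \<Phi> w k)"
    and inD: "\<And>w. w \<in> D \<Longrightarrow> \<Phi> w \<in> D'"
    using \<Phi> by (auto simp: holomorphic_to_def)
  note Ju = jac_Cn[OF \<Phi> z u] and Jv = jac_Cn[OF \<Phi> z v]
  have sE: "gen_smooth m D (\<lambda>w. dir_deriv e f (\<Phi> w))" if "e \<in> Cn n" for e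
    using gen_smooth_compose[OF gen_smooth_dir_deriv[OF f that] \<Phi>] .
  have EC: "?E k \<in> Cn n" "?I k \<in> Cn n" if "k < n" for k using unit_cvec_Cn[OF that] by auto
  have sJ: "gen_smooth m D (\<lambda>w. Re (?J k w))" "gen_smooth m D (\<lambda>w. Im (?J k w))" if "k < n" for k
    using holomorphic_cdir[OF hol[OF that]] by (auto intro: gen_smooth.Re gen_smooth_Im)
  have "second_deriv (\<lambda>w. f (\<Phi> w)) z u v = dir_deriv u (\<lambda>w. \<Sum>k<n. Re (?J k w) * dir_deriv (?E k) f (\<Phi> w) + Im (?J k w) * dir_deriv (?I k) f (\<Phi> w)) z"
  proof (rule dir_deriv_cong[OF o z u])
    fix w assume w: "w \<in> D"
    show "dir_deriv v (\<lambda>w. f (\<Phi> w)) w = (\<Sum>k<n. Re (?J k w) * dir_deriv (?E k) f (\<Phi> w) + Im (?J k w) * dir_deriv (?I k) f (\<Phi> w))"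
      unfolding dir_deriv_compose[OF f \<Phi> w v] dir_deriv_coordinates[OF f inD[OF w] jac_Cn[OF \<Phi> w v]]
      using jac_eq[OF \<Phi> w v] by simp
  qed
  also have "\<dots> = (\<Sum>k<n. dir_deriv u (\<lambda>w. Re (?J k w) * dir_deriv (?E k) f (\<Phi> w) + Im (?J k w) * dir_deriv (?I k) f (\<Phi> w)) z)"
    using EC sE sJ by (intro dir_deriv_sum[OF o _ u z] gen_smooth.add gen_smooth.mult) auto
  also have "\<dots> = (\<Sum>k<n. (Re (?H k) * dir_deriv (?E k) f (\<Phi> z) + Im (?H k) * dir_deriv (?I k) f (\<Phi> z)) +
       (Re (jac \<Phi> v z k) * second_deriv f (\<Phi> z) (?E k) (jac \<Phi> u z) + Im (jac \<Phi> v z k) * second_deriv f (\<Phi> z) (?I k) (jac \<Phi> u z)))"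
  proof (intro sum.cong refl)
    fix k assume "k \<in> {..<n}"
    then have k: "k < n" by simp
    have d: "dir_deriv u (\<lambda>w. dir_deriv e f (\<Phi> w)) z = second_deriv f (\<Phi> z) e (jac \<Phi> u z)" if "e \<in> Cn n" for e
      using dir_deriv_compose[OF gen_smooth_dir_deriv[OF f that] \<Phi> z u] dir_deriv_commute[OF f Ju that inD[OF z]] by simp
    have "dir_deriv u (\<lambda>w. Re (?J k w) * dir_deriv (?E k) f (\<Phi> w) + Im (?J k w) * dir_deriv (?I k) f (\<Phi> w)) z
      = dir_deriv u (\<lambda>w. Re (?J k w) * dir_deriv (?E k) f (\<Phi> w)) z + dir_deriv u (\<lambda>w. Im (?J k w) * dir_deriv (?I k) f (\<Phi> w)) z"
      using EC[OF k] sE sJ[OF k] u z by (intro dir_deriv_add[of m D] gen_smooth.mult) auto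
    also have "dir_deriv u (\<lambda>w. Re (?J k w) * dir_deriv (?E k) f (\<Phi> w)) z =
       dir_deriv u (\<lambda>w. Re (?J k w)) z * dir_deriv (?E k) f (\<Phi> z) + Re (?J k z) * dir_deriv u (\<lambda>w. dir_deriv (?E k) f (\<Phi> w)) z"
      using EC[OF k] sE sJ[OF k] u z by (intro dir_deriv_mult[of m D]) auto
    also have "dir_deriv u (\<lambda>w. Im (?J k w) * dir_deriv (?I k) f (\<Phi> w)) z =
       dir_deriv u (\<lambda>w. Im (?J k w)) z * dir_deriv (?I k) f (\<Phi> z) + Im (?J k z) * dir_deriv u (\<lambda>w. dir_deriv (?I k) f (\<Phi> w)) z"
      using EC[OF k] sE sJ[OF k] u z by (intro dir_deriv_mult[of m D]) auto
    finally show "dir_deriv u (\<lambda>w. Re (?J k w) * dir_deriv (?E k) f (\<Phi> w) + Im (?J k w) * dir_deriv (?I k) f (\<Phi> w)) z =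
      (Re (?H k) * dir_deriv (?E k) f (\<Phi> z) + Im (?H k) * dir_deriv (?I k) f (\<Phi> z)) +
       (Re (jac \<Phi> v z k) * second_deriv f (\<Phi> z) (?E k) (jac \<Phi> u z) + Im (jac \<Phi> v z k) * second_deriv f (\<Phi> z) (?I k) (jac \<Phi> u z))"
      using k d[OF EC(1)[OF k]] d[OF EC(2)[OF k]] dir_deriv_Re[OF holomorphic_cdir[OF hol[OF k]] u z]
        dir_deriv_Im[OF holomorphic_cdir[OF hol[OF k]] u z] jac_eq[OF \<Phi> z v] by simp
  qed
  also have "\<dots> = dir_deriv ?H f (\<Phi> z) + dir_deriv (jac \<Phi> v z) (dir_deriv (jac \<Phi> u z) f) (\<Phi> z)"
    unfolding sum.distrib[of "\<lambda>k. Re (?H k) * dir_deriv (?E k) f (\<Phi> z) + Im (?H k) * dir_deriv (?I k) f (\<Phi> z)"]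
    using dir_deriv_coordinates[OF f inD[OF z], of ?H]
      dir_deriv_coordinates[OF gen_smooth_dir_deriv[OF f Ju] inD[OF z] Jv]
    by (simp add: Cn_def)
  also have "dir_deriv (jac \<Phi> v z) (dir_deriv (jac \<Phi> u z) f) (\<Phi> z) = second_deriv f (\<Phi> z) (jac \<Phi> u z) (jac \<Phi> v z)"
    by (rule dir_deriv_commute[OF f Jv Ju inD[OF z]])
  finally show ?thesis by simp
qed

text \<open>
  The second derivative of a holomorphic map is symmetric and complex bilinear, so the first-order term
  of the second-order chain rule cancels in \<open>ddc\<close>. Hence \<open>ddc\<close> is compatible with changes of charts.
\<close>

lemma ddc_compose:
  assumes f: "gen_smooth n D' f" and \<Phi>: "holomorphic_to m D n D' \<Phi>" and z: "z \<in> D" and u: "u \<in> Cn m" and v: "v \<in> Cn m"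
  shows "ddc (\<lambda>w. f (\<Phi> w)) z u v = ddc f (\<Phi> z) (jac \<Phi> u z) (jac \<Phi> v z)"
proof -
  have hol: "\<And>k. k < n \<Longrightarrow> holomorphic_Cn m D (\<lambda>w. \<Phi> w k)" and inD: "\<Phi> z \<in> D'" and o: "open_Cn m D"
    using \<Phi> z by (auto simp: holomorphic_to_def)
  have J: "jac \<Phi> (iscale u) z = iscale (jac \<Phi> u z)" if "u \<in> Cn m" for u
  proof
    fix k show "jac \<Phi> (iscale u) z k = iscale (jac \<Phi> u z) k"
      using that jac_eq[OF \<Phi> z that] jac_eq[OF \<Phi> z, of "iscale u"]
      unfolding scale_cvec_def[of \<i> "jac \<Phi> u z"] by (cases "k < n") (auto simp: cdir_scale)
  qed
  have H: "cdir m v (cdir m (iscale u) (\<lambda>w. \<Phi> w k)) z = cdir m u (cdir m (iscale v) (\<lambda>w. \<Phi> w k)) z" if "k < n" for k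
  proof -
    have "cdir m v (cdir m (iscale u) (\<lambda>w. \<Phi> w k)) z = \<i> * cdir m v (cdir m u (\<lambda>w. \<Phi> w k)) z" for u v
      using cdir_cong[OF o z, of "cdir m (iscale u) (\<lambda>w. \<Phi> w k)" "\<lambda>z. \<i> * cdir m u (\<lambda>w. \<Phi> w k) z" v]
        cdir_scale_right[OF holomorphic_cdir[OF hol[OF that]] z] by (simp add: cdir_scale)
    then show ?thesis using cdir_commute[OF hol[OF that] z, of u v] by simp
  qed
  have "(\<lambda>k. if k < n then cdir m v (cdir m (iscale u) (\<lambda>w. \<Phi> w k)) z else 0) =
     (\<lambda>k. if k < n then cdir m u (cdir m (iscale v) (\<lambda>w. \<Phi> w k)) z else 0)"
    using H by auto
  then show ?thesis
    using u v jac_Cn[OF \<Phi> z]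
    by (simp add: ddc_eq[OF gen_smooth_compose[OF f \<Phi>] z] ddc_eq[OF f inD] second_deriv_compose[OF f \<Phi> z] J)
qed

text \<open>
  The value on \<open>(u, Iu)\<close> is the Laplacian of \<open>f\<close> along the complex line spanned by \<open>u\<close>, a positive multiple
  of the usual Levi form.
\<close>

definition levi :: "(cvec \<Rightarrow> real) \<Rightarrow> cvec \<Rightarrow> cvec \<Rightarrow> real" where
  "levi f z u = ddc f z u (iscale u)"

lemma levi_eq:
  assumes "gen_smooth n D f" "z \<in> D" "u \<in> Cn n"
  shows "levi f z u = second_deriv f z u u + second_deriv f z (iscale u) (iscale u)"
  using assms second_deriv_linear_right(2)[OF assms(1,3,2), of u "-1"]
  by (simp add: levi_def ddc_eq[OF assms(1)] iscale_iscale)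

lemma levi_cong:
  assumes "open_Cn n W" "z \<in> W" "\<And>w. w \<in> W \<Longrightarrow> f w = g w" "u \<in> Cn n"
  shows "levi f z u = levi g z u"
  unfolding levi_def using assms by (intro ddc_cong[OF assms(1-3)]) auto

lemma levi_comp:
  assumes f: "gen_smooth n D f" and z: "z \<in> D" and u: "u \<in> Cn n"
    and F: "gen_smooth n D (\<lambda>z. F (f z))" "gen_smooth n D (\<lambda>z. F' (f z))"
      "\<And>t. (F has_real_derivative F' t) (at t)" "\<And>t. (F' has_real_derivative F'' t) (at t)"
  shows "levi (\<lambda>z. F (f z)) z u = F' (f z) * levi f z u +
     F'' (f z) * ((dir_deriv u f z)\<^sup>2 + (dir_deriv (iscale u) f z)\<^sup>2)"
proof -
  have o: "open_Cn n D" using gen_smooth_open[OF f] .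
  have "second_deriv (\<lambda>z. F (f z)) z v v = F'' (f z) * (dir_deriv v f z)\<^sup>2 + F' (f z) * second_deriv f z v v"
    if v: "v \<in> Cn n" for v
  proof -
    have "second_deriv (\<lambda>z. F (f z)) z v v = dir_deriv v (\<lambda>z. F' (f z) * dir_deriv v f z) z"
      using f z v F by (intro dir_deriv_cong[OF o] dir_deriv_comp[of n D]) auto
    also have "\<dots> = dir_deriv v (\<lambda>z. F' (f z)) z * dir_deriv v f z + F' (f z) * second_deriv f z v v"
      using f z v F by (intro dir_deriv_mult[of n D] gen_smooth_dir_deriv) auto
    also have "dir_deriv v (\<lambda>z. F' (f z)) z = F'' (f z) * dir_deriv v f z"
      using f z v F by (intro dir_deriv_comp[of n D]) auto
    finally show ?thesis by (simp add: power2_eq_square)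
  qed
  then show ?thesis
    using u by (simp add: levi_eq[OF F(1) z] levi_eq[OF f z] algebra_simps)
qed

lemma levi_sum:
  assumes "open_Cn n D" "\<And>j. j \<in> J \<Longrightarrow> gen_smooth n D (f j)" "z \<in> D" "u \<in> Cn n"
  shows "levi (\<lambda>z. \<Sum>j\<in>J. f j z) z u = (\<Sum>j\<in>J. levi (f j) z u)"
proof -
  have "second_deriv (\<lambda>z. \<Sum>j\<in>J. f j z) z v v = (\<Sum>j\<in>J. second_deriv (f j) z v v)" if v: "v \<in> Cn n" for v
  proof -
    have "second_deriv (\<lambda>z. \<Sum>j\<in>J. f j z) z v v = dir_deriv v (\<lambda>z. \<Sum>j\<in>J. dir_deriv v (f j) z) z"
      using assms v by (intro dir_deriv_cong[OF assms(1)] dir_deriv_sum[of n D]) auto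
    also have "\<dots> = (\<Sum>j\<in>J. second_deriv (f j) z v v)"
      using assms v by (intro dir_deriv_sum[of n D] gen_smooth_dir_deriv) auto
    finally show ?thesis .
  qed
  then show ?thesis
    using assms by (simp add: levi_eq[OF gen_smooth_sum[OF assms(1,2)]] levi_eq[of n D] sum.distrib)
qed

lemma levi_cmult:
  assumes "gen_smooth n D f" "z \<in> D" "u \<in> Cn n"
  shows "levi (\<lambda>z. a * f z) z u = a * levi f z u"
  unfolding levi_def using assms by (intro ddc_cmult[of n D]) auto

lemma levi_const: "levi (\<lambda>z. a) z u = 0"
  by (simp add: levi_def ddc_def ext_deriv1_def dc_def)

definition sum_norms :: "nat \<Rightarrow> (nat \<Rightarrow> cvec \<Rightarrow> complex) \<Rightarrow> cvec \<Rightarrow> real" where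
  "sum_norms N h z = (\<Sum>j<N. (cmod (h j z))\<^sup>2)"

text \<open>
  The third claim is the Cauchy-Schwarz inequality: it bounds the squared gradient of \<open>|h|\<^sup>2\<close> along a complex
  line by the Levi form of \<open>|h|\<^sup>2\<close>. It controls the term with \<open>F''\<close> in \<open>levi_comp\<close> where \<open>F\<close> is not convex.
\<close>

lemma sum_norms_derivs:
  assumes o: "open_Cn n D" and h: "\<And>j. j < N \<Longrightarrow> holomorphic_Cn n D (h j)" and z: "z \<in> D" and u: "u \<in> Cn n"
  shows "gen_smooth n D (sum_norms N h)"
    and "levi (sum_norms N h) z u = 4 * (\<Sum>j<N. (cmod (cdir n u (h j) z))\<^sup>2)"
    and "(dir_deriv u (sum_norms N h) z)\<^sup>2 + (dir_deriv (iscale u) (sum_norms N h) z)\<^sup>2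
           \<le> sum_norms N h z * levi (sum_norms N h) z u"
proof -
  define q where "q j z = Re (h j z) * Re (h j z) + Im (h j z) * Im (h j z)" for j z
  have sq: "gen_smooth n D (q j)" if "j < N" for j
    unfolding q_def using h[OF that] by (intro gen_smooth.add gen_smooth.mult gen_smooth.Re gen_smooth_Im)
  have eq: "sum_norms N h = (\<lambda>z. \<Sum>j<N. q j z)"
    unfolding sum_norms_def q_def cmod_power2 by (simp add: power2_eq_square)
  show sm: "gen_smooth n D (sum_norms N h)"
    unfolding eq using o sq by (intro gen_smooth_sum) auto
  have dq: "dir_deriv v (q j) w = 2 * (Re (h j w) * Re (cdir n v (h j) w) + Im (h j w) * Im (cdir n v (h j) w))"
    if j: "j < N" and v: "v \<in> Cn n" and w: "w \<in> D" for j v w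
  proof -
    have s: "gen_smooth n D (\<lambda>z. Re (h j z))" "gen_smooth n D (\<lambda>z. Im (h j z))"
      using h[OF j] by (auto intro: gen_smooth.Re gen_smooth_Im)
    have "dir_deriv v (q j) w = dir_deriv v (\<lambda>z. Re (h j z) * Re (h j z)) w + dir_deriv v (\<lambda>z. Im (h j z) * Im (h j z)) w"
      unfolding q_def using s v w by (intro dir_deriv_add[of n D] gen_smooth.mult) auto
    then show ?thesis
      using s v w dir_deriv_Re[OF h[OF j] v w] dir_deriv_Im[OF h[OF j] v w] by (simp add: dir_deriv_mult[of n D])
  qed
  have ddq: "second_deriv (q j) z v v = 2 * ((cmod (cdir n v (h j) z))\<^sup>2 +
      Re (h j z) * Re (cdir n v (cdir n v (h j)) z) + Im (h j z) * Im (cdir n v (cdir n v (h j)) z))"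
    if j: "j < N" and v: "v \<in> Cn n" for j v
  proof -
    note hc = holomorphic_cdir[OF h[OF j], of v]
    have s: "gen_smooth n D (\<lambda>z. Re (h j z))" "gen_smooth n D (\<lambda>z. Im (h j z))"
       "gen_smooth n D (\<lambda>z. Re (cdir n v (h j) z))" "gen_smooth n D (\<lambda>z. Im (cdir n v (h j) z))"
      using h[OF j] hc by (auto intro: gen_smooth.Re gen_smooth_Im)
    have "second_deriv (q j) z v v = dir_deriv v (\<lambda>w. 2 * (Re (h j w) * Re (cdir n v (h j) w) + Im (h j w) * Im (cdir n v (h j) w))) z"
      using z v dq[OF j v] by (intro dir_deriv_cong[OF o]) auto
    also have "\<dots> = 2 * (dir_deriv v (\<lambda>w. Re (h j w) * Re (cdir n v (h j) w)) z + dir_deriv v (\<lambda>w. Im (h j w) * Im (cdir n v (h j) w)) z)"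
      using s v z by (subst dir_deriv_cmult[of n D] dir_deriv_add[of n D], auto intro!: gen_smooth.add gen_smooth.mult)+
    also have "\<dots> = 2 * ((cmod (cdir n v (h j) z))\<^sup>2 +
      Re (h j z) * Re (cdir n v (cdir n v (h j)) z) + Im (h j z) * Im (cdir n v (cdir n v (h j)) z))"
      using s v z dir_deriv_Re[OF h[OF j] v z] dir_deriv_Im[OF h[OF j] v z] dir_deriv_Re[OF hc v z] dir_deriv_Im[OF hc v z]
      unfolding cmod_power2 by (simp add: dir_deriv_mult[of n D] power2_eq_square)
    finally show ?thesis .
  qed
  have lq: "levi (q j) z u = 4 * (cmod (cdir n u (h j) z))\<^sup>2" if j: "j < N" for j
  proof -
    have "cdir n (iscale u) (cdir n (iscale u) (h j)) z = - cdir n u (cdir n u (h j)) z"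
      using cdir_cong[OF o z, of "cdir n (iscale u) (h j)" "\<lambda>z. \<i> * cdir n u (h j) z" "iscale u"]
        cdir_scale_right[OF holomorphic_cdir[OF h[OF j]] z] by (simp add: cdir_scale)
    then show ?thesis
      using u by (simp add: levi_eq[OF sq[OF j] z] ddq[OF j] cdir_scale norm_mult)
  qed
  show lev: "levi (sum_norms N h) z u = 4 * (\<Sum>j<N. (cmod (cdir n u (h j) z))\<^sup>2)"
    unfolding eq using lq levi_sum[OF o _ z u, of "{..<N}" q] sq by (simp add: sum_distrib_left)
  have d: "dir_deriv v (sum_norms N h) z = 2 * Re (\<Sum>j<N. cnj (h j z) * cdir n v (h j) z)" if "v \<in> Cn n" for v
    unfolding eq using dir_deriv_sum[OF o _ that z, of "{..<N}" q] sq dq[OF _ that z] by (simp add: sum_distrib_left)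
  let ?S = "\<Sum>j<N. cnj (h j z) * cdir n u (h j) z"
  have di: "dir_deriv (iscale u) (sum_norms N h) z = 2 * Re (\<i> * ?S)"
    using d[of "iscale u"] u by (simp add: cdir_scale sum_distrib_left mult.left_commute)
  have "(2 * Re c)\<^sup>2 + (2 * Re (\<i> * c))\<^sup>2 = 4 * (cmod c)\<^sup>2" for c
    unfolding cmod_power2 by (simp add: power2_eq_square)
  then have "(dir_deriv u (sum_norms N h) z)\<^sup>2 + (dir_deriv (iscale u) (sum_norms N h) z)\<^sup>2 = 4 * (cmod ?S)\<^sup>2"
    unfolding di d[OF u] .
  also have "(cmod ?S)\<^sup>2 \<le> (\<Sum>j<N. cmod (h j z) * cmod (cdir n u (h j) z))\<^sup>2"
    by (intro power_mono order_trans[OF norm_sum]) (auto simp: norm_mult)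
  also have "\<dots> \<le> (\<Sum>j<N. (cmod (h j z))\<^sup>2) * (\<Sum>j<N. (cmod (cdir n u (h j) z))\<^sup>2)"
    by (rule Cauchy_Schwarz_ineq_sum)
  finally show "(dir_deriv u (sum_norms N h) z)\<^sup>2 + (dir_deriv (iscale u) (sum_norms N h) z)\<^sup>2
           \<le> sum_norms N h z * levi (sum_norms N h) z u"
    by (simp add: lev sum_norms_def)
qed

section \<open>A flat bump function\<close>

text \<open>
  For \<open>p = 1\<close> this is the classical flat function. The polynomial factor makes the family closed under
  differentiation.
\<close>

definition flat :: "real poly \<Rightarrow> real \<Rightarrow> real" where
  "flat p t = (if t > 0 then poly p (inverse t) * exp (- inverse t) else 0)"

lemma poly_exp_tendsto_0: "((\<lambda>x. x ^ k * poly p x * exp (- x)) \<longlongrightarrow> (0::real)) at_top"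
proof (induction p arbitrary: k)
  case (pCons a p)
  have "((\<lambda>x. a * (x ^ k / exp x) + x ^ Suc k * poly p x * exp (- x)) \<longlongrightarrow> a * 0 + 0) at_top"
    by (intro tendsto_intros tendsto_power_div_exp_0 pCons)
  then show ?case by (simp add: algebra_simps exp_minus divide_inverse)
qed simp

lemma flat_tendsto_0: "(flat p \<longlongrightarrow> 0) (at 0)"
proof -
  have "((\<lambda>t. poly p (inverse t) * exp (- inverse t)) \<longlongrightarrow> 0) (at_right 0)"
    using filterlim_compose[OF poly_exp_tendsto_0[of 0 p] filterlim_inverse_at_top_right] by simp
  then have "(flat p \<longlongrightarrow> 0) (at_right 0)"
    by (rule Lim_transform_eventually) (auto simp: flat_def eventually_at intro!: exI[of _ 1])
  moreover have "(flat p \<longlongrightarrow> 0) (at_left 0)"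
    by (rule Lim_transform_eventually[OF tendsto_const]) (auto simp: flat_def eventually_at intro!: exI[of _ 1])
  ultimately show ?thesis by (simp add: filterlim_at_split)
qed

definition flat_step :: "real poly \<Rightarrow> real poly" where
  "flat_step p = [:0, 0, 1:] * (p - pderiv p)"

lemma flat_has_derivative: "(flat p has_real_derivative flat (flat_step p) t) (at t)"
proof -
  consider "t > 0" | "t < 0" | "t = 0" by linarith
  then show ?thesis
  proof cases
    case 1
    have "((\<lambda>t. poly p (inverse t) * exp (- inverse t)) has_real_derivative flat (flat_step p) t) (at t)"
      using 1 by (auto intro!: derivative_eq_intros DERIV_chain2[OF poly_DERIV]
         simp: flat_def flat_step_def algebra_simps power2_eq_square)
    then show ?thesis
      by (rule has_field_derivative_transform_within_open[of _ _ _ "{0<..}"]) (use 1 in \<open>auto simp: flat_def\<close>)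
  next
    case 2
    have "((\<lambda>t. 0) has_real_derivative flat (flat_step p) t) (at t)"
      using 2 by (auto simp: flat_def)
    then show ?thesis
      by (rule has_field_derivative_transform_within_open[of _ _ _ "{..<0}"]) (use 2 in \<open>auto simp: flat_def\<close>)
  next
    case 3
    have "(\<lambda>h. flat p h / h) = flat ([:0, 1:] * p)"
      by (auto simp: flat_def field_simps fun_eq_iff)
    moreover have "flat q 0 = 0" for q by (simp add: flat_def)
    ultimately show ?thesis
      using 3 flat_tendsto_0[of "[:0, 1:] * p"] by (simp add: has_field_derivative_iff del: mult_pCons_left)
  qed
qed

lemma smooth_real_flat: "smooth_real UNIV (flat p)"
  unfolding smooth_real_def
  by (intro exI[of _ "\<lambda>k. flat ((flat_step ^^ k) p)"]) (auto intro: flat_has_derivative)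

lemma smooth_real_inverse: "smooth_real {0<..} inverse"
  unfolding smooth_real_def
proof (intro exI[of _ "\<lambda>k t. (-1) ^ k * fact k * inverse t ^ Suc k"] conjI allI ballI)
  fix k and t :: real assume "t \<in> {0<..}"
  then show "((\<lambda>t. (-1) ^ k * fact k * inverse t ^ Suc k) has_real_derivative (-1) ^ Suc k * fact (Suc k) * inverse t ^ Suc (Suc k)) (at t)"
    using DERIV_cmult[OF DERIV_power[OF DERIV_inverse[of t], of "Suc k"], of "(-1) ^ k * fact k"]
    by (simp add: algebra_simps)
qed simp

lemma gen_smooth_flat: "gen_smooth n D f \<Longrightarrow> gen_smooth n D (\<lambda>z. flat p (f z))"
  by (rule gen_smooth.comp[OF _ smooth_real_flat]) auto

lemma gen_smooth_inverse: "gen_smooth n D f \<Longrightarrow> (\<And>z. z \<in> D \<Longrightarrow> f z > 0) \<Longrightarrow> gen_smooth n D (\<lambda>z. inverse (f z))"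
  by (rule gen_smooth.comp[OF _ smooth_real_inverse]) auto

lemma flat_nonneg: "flat 1 t \<ge> 0"
  and flat_zero: "t \<le> 0 \<Longrightarrow> flat p t = 0"
  by (auto simp: flat_def)

lemma flat_scaled_derivative:
  "((\<lambda>t. flat p (a * t + b)) has_real_derivative a * flat (flat_step p) (a * t + b)) (at t)"
proof -
  have "((\<lambda>t. a * t + b) has_real_derivative a) (at t)"
    by (auto intro!: derivative_eq_intros)
  from DERIV_chain2[where f = "flat p" and g = "\<lambda>t. a * t + b", OF flat_has_derivative this]
  show ?thesis by (simp add: mult.commute)
qed

text \<open>
  For \<open>p = q = 1\<close> this is \<open>exp (- 12 r / (t - \<epsilon>) - 6 r / (r - t))\<close> between \<open>\<epsilon>\<close> and \<open>r\<close>. The coefficients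
  \<open>12 r\<close> and \<open>6 r\<close> are chosen in order that it is increasing and convex up to \<open>r / 2\<close>. As for \<open>flat\<close>, the
  polynomials keep track of derivatives.
\<close>

definition bump :: "real \<Rightarrow> real \<Rightarrow> real poly \<Rightarrow> real poly \<Rightarrow> real \<Rightarrow> real" where
  "bump \<epsilon> r p q t = flat p (inverse (12 * r) * t + - \<epsilon> / (12 * r)) * flat q (- inverse (6 * r) * t + 1 / 6)"

definition bump' :: "real \<Rightarrow> real \<Rightarrow> real poly \<Rightarrow> real poly \<Rightarrow> real \<Rightarrow> real" where
  "bump' \<epsilon> r p q t = inverse (12 * r) * bump \<epsilon> r (flat_step p) q t - inverse (6 * r) * bump \<epsilon> r p (flat_step q) t"

definition bump'' :: "real \<Rightarrow> real \<Rightarrow> real poly \<Rightarrow> real poly \<Rightarrow> real \<Rightarrow> real" where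
  "bump'' \<epsilon> r p q t = inverse (12 * r) * bump' \<epsilon> r (flat_step p) q t - inverse (6 * r) * bump' \<epsilon> r p (flat_step q) t"

lemma bump_has_derivative: "(bump \<epsilon> r p q has_real_derivative bump' \<epsilon> r p q t) (at t)"
  using DERIV_mult[OF flat_scaled_derivative[of p "inverse (12 * r)" "- \<epsilon> / (12 * r)" t]
     flat_scaled_derivative[of q "- inverse (6 * r)" "1 / 6" t]]
  unfolding bump_def[abs_def] bump'_def by (simp add: algebra_simps)

lemma bump'_has_derivative: "(bump' \<epsilon> r p q has_real_derivative bump'' \<epsilon> r p q t) (at t)"
  unfolding bump'_def[abs_def] bump''_def
  by (intro DERIV_diff DERIV_cmult bump_has_derivative[unfolded bump'_def])

lemma gen_smooth_bump:
  assumes f: "gen_smooth n D f"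
  shows "gen_smooth n D (\<lambda>z. bump \<epsilon> r p q (f z))" "gen_smooth n D (\<lambda>z. bump' \<epsilon> r p q (f z))"
proof -
  note o = gen_smooth_open[OF f]
  have 1: "gen_smooth n D (\<lambda>z. bump \<epsilon> r p q (f z))" for p q
    unfolding bump_def
    by (intro gen_smooth.mult gen_smooth_flat gen_smooth.add gen_smooth_cmult f gen_smooth_const o)
  then show "gen_smooth n D (\<lambda>z. bump \<epsilon> r p q (f z))" .
  show "gen_smooth n D (\<lambda>z. bump' \<epsilon> r p q (f z))"
    unfolding bump'_def by (intro gen_smooth_diff gen_smooth_cmult 1)
qed

lemma continuous_on_bump: "continuous_on S (bump \<epsilon> r p q)"
  "continuous_on S (bump' \<epsilon> r p q)" "continuous_on S (bump'' \<epsilon> r p q)"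
proof -
  have 1: "continuous_on S (bump' \<epsilon> r p q)" for p q
    by (rule continuous_at_imp_continuous_on) (auto intro: DERIV_isCont[OF bump'_has_derivative])
  then show "continuous_on S (bump' \<epsilon> r p q)" .
  show "continuous_on S (bump \<epsilon> r p q)"
    by (rule continuous_at_imp_continuous_on) (auto intro: DERIV_isCont[OF bump_has_derivative])
  show "continuous_on S (bump'' \<epsilon> r p q)"
    unfolding bump''_def[abs_def] by (intro continuous_intros 1)
qed

lemma bump_zero:
  assumes "r > 0" "t \<le> \<epsilon> \<or> t \<ge> r"
  shows "bump \<epsilon> r p q t = 0" "bump' \<epsilon> r p q t = 0" "bump'' \<epsilon> r p q t = 0"
proof -
  have 1: "bump \<epsilon> r p q t = 0" for p q
  proof -
    have "inverse (12 * r) * t + - \<epsilon> / (12 * r) = (t - \<epsilon>) / (12 * r)" "- inverse (6 * r) * t + 1 / 6 = (r - t) / (6 * r)"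
      using assms by (auto simp: field_simps)
    then show ?thesis
      using assms unfolding bump_def by (auto simp: flat_zero divide_nonpos_pos)
  qed
  have 2: "bump' \<epsilon> r p q t = 0" for p q by (simp add: bump'_def 1)
  show "bump \<epsilon> r p q t = 0" "bump' \<epsilon> r p q t = 0" "bump'' \<epsilon> r p q t = 0"
    by (simp_all add: 1 2 bump''_def)
qed

lemma bump_nonneg: "bump \<epsilon> r 1 1 t \<ge> 0"
  by (simp add: bump_def flat_nonneg)

text \<open>
  The logarithmic derivative is \<open>X - Y\<close> with \<open>X = 12 r / (t - \<epsilon>)\<^sup>2\<close> and \<open>Y = 6 r / (r - t)\<^sup>2\<close>. On the left half
  \<open>Y \<le> X / 2\<close>, so the square of the logarithmic derivative is at least \<open>X\<^sup>2 / 4\<close>, and this dominates the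
  negative derivative of \<open>X - Y\<close> because of the factor 12.
\<close>

lemma bump_convex_part:
  assumes \<epsilon>: "0 < \<epsilon>" "\<epsilon> < t" "t \<le> r / 2"
  shows "bump \<epsilon> r 1 1 t > 0" "bump' \<epsilon> r 1 1 t > 0" "bump'' \<epsilon> r 1 1 t \<ge> 0"
proof -
  define p w where "p = t - \<epsilon>" and "w = r - t"
  have r: "r > 0" and p: "p > 0" and w: "w \<ge> r / 2" "w > 0" and pw: "p \<le> w" and pr: "p \<le> r"
    using \<epsilon> by (auto simp: p_def w_def)
  define a b where "a = inverse (12 * r)" and "b = inverse (6 * r)"
  define s q where "s = p / (12 * r)" and "q = w / (6 * r)"
  have sq: "a * t + - \<epsilon> / (12 * r) = s" "- b * t + 1 / 6 = q"
    using r by (auto simp: s_def q_def a_def b_def p_def w_def field_simps)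
  have pos: "s > 0" "q > 0" using p w r by (auto simp: s_def q_def)
  define e where "e = exp (- inverse s) * exp (- inverse q)"
  have e: "e > 0" by (simp add: e_def)
  have B: "bump \<epsilon> r P Q t = poly P (inverse s) * poly Q (inverse q) * e" for P Q
    unfolding bump_def a_def[symmetric] b_def[symmetric] sq using pos by (simp add: flat_def e_def)
  define X Y where "X = 12 * r / p\<^sup>2" and "Y = 6 * r / w\<^sup>2"
  have XY: "a * (inverse s)\<^sup>2 = X" "b * (inverse q)\<^sup>2 = Y"
    "a\<^sup>2 * (inverse s) ^ 3 = 12 * r / p ^ 3" "b\<^sup>2 * (inverse q) ^ 3 = 6 * r / w ^ 3"
    using r p w by (simp_all add: a_def b_def s_def q_def X_def Y_def field_simps power2_eq_square power3_eq_cube)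
  show "bump \<epsilon> r 1 1 t > 0" using B e by simp
  have st: "flat_step 1 = [:0, 0, 1:]" by (simp add: flat_step_def)
  have st2: "poly (flat_step [:0, 0, 1:]) x = x ^ 4 - 2 * x ^ 3" for x :: real
    by (simp add: flat_step_def pderiv_pCons algebra_simps power4_eq_xxxx power3_eq_cube)
  have b1: "bump' \<epsilon> r 1 1 t = (X - Y) * e"
    unfolding bump'_def st B a_def[symmetric] b_def[symmetric] XY[symmetric]
    by (simp add: algebra_simps power2_eq_square)
  have YX: "Y \<le> X / 2"
  proof -
    have "6 * r / w\<^sup>2 \<le> 6 * r / p\<^sup>2" using pw p r by (intro divide_left_mono power_mono) auto
    then show ?thesis by (simp add: X_def Y_def)
  qed
  have X: "X > 0" using r p by (simp add: X_def)
  show "bump' \<epsilon> r 1 1 t > 0" using b1 YX X e by simp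
  have "bump'' \<epsilon> r 1 1 t = ((X - Y)\<^sup>2 - 2 * (12 * r / p ^ 3) - 2 * (6 * r / w ^ 3)) * e"
    unfolding bump''_def bump'_def st B st2 a_def[symmetric] b_def[symmetric] XY[symmetric]
    by (simp add: algebra_simps power2_eq_square power4_eq_xxxx power3_eq_cube)
  moreover have "2 * (12 * r / p ^ 3) + 2 * (6 * r / w ^ 3) \<le> (X - Y)\<^sup>2"
  proof -
    have "6 * r / w ^ 3 \<le> 6 * r / p ^ 3" using pw p r by (intro divide_left_mono power_mono) auto
    then have "2 * (12 * r / p ^ 3) + 2 * (6 * r / w ^ 3) \<le> 36 * r / p ^ 3" by simp
    also have "\<dots> \<le> 36 * r\<^sup>2 / p ^ 4"
      using p r pr by (simp add: field_simps power2_eq_square power4_eq_xxxx power3_eq_cube)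
    also have "\<dots> = (X / 2)\<^sup>2" using p by (simp add: X_def field_simps power2_eq_square power4_eq_xxxx)
    also have "\<dots> \<le> (X - Y)\<^sup>2" using YX X by (intro power_mono) auto
    finally show ?thesis .
  qed
  ultimately show "bump'' \<epsilon> r 1 1 t \<ge> 0" using e by simp
qed

section \<open>Charts and local isomorphisms of complex spaces\<close>

lemma sheaf_restrict:
  assumes "is_function_sheaf X" "openin (Top X) U" "openin (Top X) W" "W \<subseteq> U" "f \<in> hol_fns X U"
  shows "f \<in> hol_fns X W"
  using assms(1)[unfolded is_function_sheaf_def, THEN conjunct1, rule_format, of U W f] assms(2-5) by auto

lemma sheaf_cong:
  assumes "is_function_sheaf X" "openin (Top X) U" "f \<in> hol_fns X U" "\<And>y. y \<in> U \<Longrightarrow> g y = f y"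
  shows "g \<in> hol_fns X U"
  using assms(1)[unfolded is_function_sheaf_def, THEN conjunct2, THEN conjunct2, rule_format, of U f g] assms(2-4) by auto

lemma sheaf_local:
  assumes X: "is_function_sheaf X" and "openin (Top X) U"
    and loc: "\<And>y. y \<in> U \<Longrightarrow> \<exists>W g. openin (Top X) W \<and> y \<in> W \<and> W \<subseteq> U \<and> g \<in> hol_fns X W \<and> (\<forall>w\<in>W. f w = g w)"
  shows "f \<in> hol_fns X U"
proof -
  define \<U> where "\<U> = {W. openin (Top X) W \<and> W \<subseteq> U \<and> f \<in> hol_fns X W}"
  have "\<exists>W\<in>\<U>. y \<in> W" if y: "y \<in> U" for y
  proof -
    obtain W g where W: "openin (Top X) W" "y \<in> W" "W \<subseteq> U" "g \<in> hol_fns X W" "\<forall>w\<in>W. f w = g w"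
      using loc[OF y] by blast
    then have "f \<in> hol_fns X W" using sheaf_cong[OF X W(1,4)] by blast
    then show ?thesis using W by (auto simp: \<U>_def)
  qed
  then have "\<Union>\<U> = U" by (auto simp: \<U>_def)
  moreover have "f \<in> hol_fns X (\<Union>\<U>)"
    using X[unfolded is_function_sheaf_def, THEN conjunct2, THEN conjunct1, rule_format, of \<U> f]
    by (auto simp: \<U>_def)
  ultimately show ?thesis by simp
qed

lemma complex_manifoldD:
  assumes "complex_manifold X"
  shows "is_function_sheaf X" "Hausdorff_space (Top X)" "second_countable (Top X)"
    "\<And>y. y \<in> points X \<Longrightarrow> \<exists>c\<in>charts X. y \<in> cdom c"
  using assms by (auto simp: complex_manifold_def complex_variety_def)

lemma homeomorphic_map_inverse:
  assumes "homeomorphic_map X Y f" "\<And>x. x \<in> topspace X \<Longrightarrow> g (f x) = x"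
  shows "homeomorphic_map Y X g"
proof -
  obtain g' where g': "homeomorphic_maps X Y f g'"
    using assms(1) homeomorphic_map_maps by blast
  have "homeomorphic_map Y X g'" using g' homeomorphic_maps_map by blast
  moreover have "g' y = g y" if yY: "y \<in> topspace Y" for y
  proof -
    have "f ` topspace X = topspace Y" using assms(1) homeomorphic_imp_surjective_map by blast
    then obtain x where "x \<in> topspace X" "y = f x" using yY by auto
    then show ?thesis using assms(2) g' by (simp add: homeomorphic_maps_def)
  qed
  ultimately show ?thesis by (rule homeomorphic_map_eq)
qed

context
  fixes X :: "'a complex_space" and c :: "'a chart"
  assumes c: "local_model X c"
begin

lemma local_model_open: "openin (Top X) (cdom c)"
  and local_model_homeo: "homeomorphic_map (subtopology (Top X) (cdom c)) (top_of_set (cimage c)) (coord c)"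
  using c by (auto simp: local_model_def)

lemma local_model_inj: "inj_on (coord c) (cdom c)"
proof -
  have "topspace (subtopology (Top X) (cdom c)) = cdom c"
    using openin_subset[OF local_model_open] by auto
  then show ?thesis using homeomorphic_imp_injective_map[OF local_model_homeo] by simp
qed

lemma cinv_coord [simp]: "y \<in> cdom c \<Longrightarrow> cinv c (coord c y) = y"
  by (simp add: cinv_def local_model_inj)

lemma coord_cinv [simp]: "z \<in> cimage c \<Longrightarrow> coord c (cinv c z) = z"
  by (simp add: cinv_def cimage_def f_inv_into_f)

lemma cinv_in [simp]: "z \<in> cimage c \<Longrightarrow> cinv c z \<in> cdom c"
  by (simp add: cinv_def cimage_def inv_into_into)

lemma coord_in: "y \<in> cdom c \<Longrightarrow> coord c y \<in> cimage c"
  by (simp add: cimage_def)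

lemma local_model_image_subset: "cimage c \<subseteq> Cn (cdim c)"
  using c unfolding local_model_def analytic_subset_def by (meson open_Cn_subset subset_trans)

lemma local_model_open_image:
  assumes "openin (Top X) W" "W \<subseteq> cdom c"
  shows "openin (top_of_set (cimage c)) (coord c ` W)"
proof -
  have "openin (subtopology (Top X) (cdom c)) W"
    using assms local_model_open openin_open_subtopology by blast
  then show ?thesis using homeomorphic_imp_open_map[OF local_model_homeo] by (auto simp: open_map_def)
qed

lemma local_model_open_preimage:
  assumes "openin (top_of_set (cimage c)) T"
  shows "openin (Top X) {y\<in>cdom c. coord c y \<in> T}"
proof -
  have "continuous_map (subtopology (Top X) (cdom c)) (top_of_set (cimage c)) (coord c)"
    using local_model_homeo homeomorphic_imp_continuous_map by blast
  then have "openin (subtopology (Top X) (cdom c)) {y\<in>topspace (subtopology (Top X) (cdom c)). coord c y \<in> T}"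
    using assms openin_continuous_map_preimage by blast
  moreover have "topspace (subtopology (Top X) (cdom c)) = cdom c"
    using openin_subset[OF local_model_open] by auto
  ultimately show ?thesis using local_model_open openin_trans_full by fastforce
qed

lemma local_model_hol_fns:
  "openin (Top X) W \<Longrightarrow> W \<subseteq> cdom c \<Longrightarrow>
     f \<in> hol_fns X W \<longleftrightarrow> holomorphic_on_set (cdim c) (coord c ` W) (f \<circ> cinv c)"
  using c by (simp add: local_model_def)

lemma local_model_coord_holomorphic: "(\<lambda>y. coord c y k) \<in> hol_fns X (cdom c)"
proof -
  obtain D where "analytic_subset (cdim c) D (cimage c)"
    using c by (auto simp: local_model_def)
  then have D: "open_Cn (cdim c) D" "cimage c \<subseteq> D"
    by (auto simp: analytic_subset_def)
  have "holomorphic_on_set (cdim c) (coord c ` cdom c) ((\<lambda>y. coord c y k) \<circ> cinv c)"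
    unfolding holomorphic_on_set_def
  proof (intro ballI exI conjI)
    show "holomorphic_Cn (cdim c) D (\<lambda>z. z k)" using D(1) by (rule holomorphic_Cn_coord)
  qed (use D in \<open>auto simp: cimage_def\<close>)
  then show ?thesis using local_model_hol_fns local_model_open by blast
qed

end

lemma chartsD: "c \<in> charts X \<Longrightarrow> local_model X c" "c \<in> charts X \<Longrightarrow> open_Cn (cdim c) (cimage c)"
  by (auto simp: charts_def)

lemma chart_open_image:
  assumes "c \<in> charts X" "openin (Top X) W" "W \<subseteq> cdom c"
  shows "open_Cn (cdim c) (coord c ` W)"
  using local_model_open_image[OF chartsD(1)[OF assms(1)] assms(2,3)] chartsD(2)[OF assms(1)] openin_trans by blast

lemma holomorphic_on_set_open:
  assumes "open_Cn n D" shows "holomorphic_on_set n D f \<longleftrightarrow> holomorphic_Cn n D f"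
proof
  assume "holomorphic_on_set n D f"
  then show "holomorphic_Cn n D f"
    by (intro holomorphic_Cn_local[OF assms]) (auto simp: holomorphic_on_set_def)
next
  assume "holomorphic_Cn n D f"
  then show "holomorphic_on_set n D f"
    unfolding holomorphic_on_set_def by (intro ballI exI[of _ D] exI[of _ f]) auto
qed

lemma chart_hol_fns:
  assumes "c \<in> charts X" "openin (Top X) W" "W \<subseteq> cdom c"
  shows "f \<in> hol_fns X W \<longleftrightarrow> holomorphic_Cn (cdim c) (coord c ` W) (\<lambda>z. f (cinv c z))"
  using local_model_hol_fns[OF chartsD(1)[OF assms(1)] assms(2,3)]
    holomorphic_on_set_open[OF chart_open_image[OF assms]] by (simp add: o_def)

lemma chart_simps [simp]:
  "cdim (n, U, k) = n" "cdom (n, U, k) = U" "coord (n, U, k) = k"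
  by (auto simp: cdim_def cdom_def coord_def)

lemma cimage_tuple [simp]: "cimage (n, U, k) = k ` U"
  by (simp add: cimage_def)

lemma chartI:
  assumes "openin (Top X) U" "open_Cn n (k ` U)"
    and "homeomorphic_map (subtopology (Top X) U) (top_of_set (k ` U)) k"
    and "\<And>W f. openin (Top X) W \<Longrightarrow> W \<subseteq> U \<Longrightarrow>
        f \<in> hol_fns X W \<longleftrightarrow> holomorphic_on_set n (k ` W) (f \<circ> cinv (n, U, k))"
  shows "(n, U, k) \<in> charts X"
proof -
  have "analytic_subset n (k ` U) (k ` U)"
    unfolding analytic_subset_def using assms(2)
    by (intro conjI ballI exI[of _ "k ` U"] exI[of _ "{}"]) auto
  then show ?thesis using assms by (auto simp: charts_def local_model_def)
qed

lemma holomorphic_on_set_cong: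
  assumes "B = B'" "\<And>z. z \<in> B \<Longrightarrow> f z = g z"
  shows "holomorphic_on_set n B f \<longleftrightarrow> holomorphic_on_set n B' g"
  using assms unfolding holomorphic_on_set_def by (metis IntD2)

text \<open>
  Local biholomorphisms. They carry charts in both directions, so that manifold structures and local
  conditions can be transported along them.
\<close>

definition local_iso :: "'a complex_space \<Rightarrow> 'b complex_space \<Rightarrow> ('a \<Rightarrow> 'b) \<Rightarrow> bool" where
  "local_iso X Y \<pi> \<longleftrightarrow> continuous_map (Top X) (Top Y) \<pi> \<and> open_map (Top X) (Top Y) \<pi> \<and>
     (\<forall>y\<in>points X. \<exists>U. openin (Top X) U \<and> y \<in> U \<and> inj_on \<pi> U) \<and>
     (\<forall>U f. openin (Top X) U \<and> inj_on \<pi> U \<longrightarrow> (f \<in> hol_fns Y (\<pi> ` U) \<longleftrightarrow> f \<circ> \<pi> \<in> hol_fns X U))"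

context
  fixes X :: "'a complex_space" and Y :: "'b complex_space" and \<pi>
  assumes iso: "local_iso X Y \<pi>"
begin

lemma local_iso_hol: "openin (Top X) U \<Longrightarrow> inj_on \<pi> U \<Longrightarrow> f \<in> hol_fns Y (\<pi> ` U) \<longleftrightarrow> f \<circ> \<pi> \<in> hol_fns X U"
  using iso by (auto simp: local_iso_def)

lemma local_iso_open: "openin (Top X) U \<Longrightarrow> openin (Top Y) (\<pi> ` U)"
  using iso by (auto simp: local_iso_def open_map_def)

lemma local_iso_preimage: "openin (Top Y) W \<Longrightarrow> openin (Top X) {y\<in>points X. \<pi> y \<in> W}"
  using iso openin_continuous_map_preimage by (fastforce simp: local_iso_def)

lemma local_iso_homeo:
  assumes U: "openin (Top X) U" "inj_on \<pi> U"
  shows "homeomorphic_map (subtopology (Top X) U) (subtopology (Top Y) (\<pi> ` U)) \<pi>"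
proof (rule bijective_open_imp_homeomorphic_map)
  have t: "topspace (subtopology (Top X) U) = U" "topspace (subtopology (Top Y) (\<pi> ` U)) = \<pi> ` U"
    using openin_subset[OF U(1)] openin_subset[OF local_iso_open[OF U(1)]] by auto
  show "continuous_map (subtopology (Top X) U) (subtopology (Top Y) (\<pi> ` U)) \<pi>"
    using iso t by (auto simp: local_iso_def continuous_map_in_subtopology continuous_map_from_subtopology)
  show "open_map (subtopology (Top X) U) (subtopology (Top Y) (\<pi> ` U)) \<pi>"
    using iso t U by (intro open_map_into_subtopology open_map_from_subtopology) (auto simp: local_iso_def)
  show "\<pi> ` topspace (subtopology (Top X) U) = topspace (subtopology (Top Y) (\<pi> ` U))"
    "inj_on \<pi> (topspace (subtopology (Top X) U))" using t U by auto
qed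

lemma push_chart:
  assumes c: "c \<in> charts X" and U: "openin (Top X) U" "U \<subseteq> cdom c" "inj_on \<pi> U"
  shows "(cdim c, \<pi> ` U, \<lambda>w. coord c (inv_into U \<pi> w)) \<in> charts Y"
proof (rule chartI)
  note lm = chartsD(1)[OF c]
  let ?k = "\<lambda>w. coord c (inv_into U \<pi> w)"
  have im: "?k ` (\<pi> ` W) = coord c ` W" if "W \<subseteq> U" for W
    using U(3) that by (force simp: image_iff subset_iff)
  show "openin (Top Y) (\<pi> ` U)" using local_iso_open U by blast
  show "open_Cn (cdim c) (?k ` (\<pi> ` U))" using im chart_open_image[OF c U(1,2)] by simp
  have t: "topspace (subtopology (Top X) U) = U" using openin_subset[OF U(1)] by auto
  have tc: "topspace (subtopology (Top X) (cdom c)) = cdom c" using openin_subset[OF local_model_open[OF lm]] by auto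
  have "homeomorphic_map (subtopology (Top Y) (\<pi> ` U)) (subtopology (Top X) U) (inv_into U \<pi>)"
    using homeomorphic_map_inverse[OF local_iso_homeo[OF U(1,3)]] t U(3) by simp
  moreover have "homeomorphic_map (subtopology (subtopology (Top X) (cdom c)) U) (subtopology (top_of_set (cimage c)) (coord c ` U)) (coord c)"
    using tc U(2) by (intro homeomorphic_map_subtopologies[OF local_model_homeo[OF lm]]) (auto simp: cimage_def)
  moreover have "subtopology (subtopology (Top X) (cdom c)) U = subtopology (Top X) U"
    "subtopology (top_of_set (cimage c)) (coord c ` U) = top_of_set (coord c ` U)"
    using U(2) by (auto simp: subtopology_subtopology cimage_def Int_absorb1 image_mono)
  ultimately show "homeomorphic_map (subtopology (Top Y) (\<pi> ` U)) (top_of_set (?k ` (\<pi> ` U))) ?k"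
    using homeomorphic_map_compose im[of U] by (fastforce simp: o_def)
  fix W and f :: "_ \<Rightarrow> complex" assume W: "openin (Top Y) W" "W \<subseteq> \<pi> ` U"
  define W' where "W' = {y\<in>points X. \<pi> y \<in> W} \<inter> U"
  have W': "openin (Top X) W'" "W' \<subseteq> U"
    using U(1) local_iso_preimage[OF W(1)] by (auto simp: W'_def)
  have "x \<in> \<pi> ` W'" if x: "x \<in> W" for x
  proof -
    obtain y where "y \<in> U" "x = \<pi> y" using x W(2) by auto
    then show ?thesis using x openin_subset[OF U(1)] by (auto simp: W'_def)
  qed
  then have "\<pi> ` W' = W" by (auto simp: W'_def)
  note W' = W' this
  have inv: "cinv (cdim c, \<pi> ` U, ?k) (coord c y) = \<pi> y" if "y \<in> W'" for y
  proof -
    have "inj_on ?k (\<pi> ` U)"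
    proof (rule inj_on_imageI)
      have "inj_on (?k \<circ> \<pi>) U \<longleftrightarrow> inj_on (coord c) U"
        using U(3) by (intro inj_on_cong) simp
      then show "inj_on (?k \<circ> \<pi>) U" using inj_on_subset[OF local_model_inj[OF lm] U(2)] by simp
    qed
    moreover have eq: "coord c y = ?k (\<pi> y)" and "\<pi> y \<in> \<pi> ` U"
      using that W' U(3) by (auto simp: inv_into_f_f subset_iff)
    ultimately show ?thesis
      unfolding cinv_def chart_simps eq by (intro inv_into_f_f)
  qed
  have "f \<in> hol_fns Y W \<longleftrightarrow> f \<circ> \<pi> \<in> hol_fns X W'"
    using local_iso_hol[OF W'(1), of f] W' inj_on_subset[OF U(3)] by auto
  also have "\<dots> \<longleftrightarrow> holomorphic_on_set (cdim c) (coord c ` W') ((f \<circ> \<pi>) \<circ> cinv c)"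
    using local_model_hol_fns[OF lm W'(1)] W' U(2) by blast
  also have "\<dots> \<longleftrightarrow> holomorphic_on_set (cdim c) (?k ` W) (f \<circ> cinv (cdim c, \<pi> ` U, ?k))"
    using im[OF W'(2)] W' inv U(2) cinv_coord[OF lm]
    by (intro holomorphic_on_set_cong) (auto simp: subset_iff)
  finally show "f \<in> hol_fns Y W \<longleftrightarrow> holomorphic_on_set (cdim c) (?k ` W) (f \<circ> cinv (cdim c, \<pi> ` U, ?k))" .
qed

lemma lift_chart:
  assumes X: "is_function_sheaf X" and c: "c \<in> charts Y" and U: "openin (Top X) U" "\<pi> ` U \<subseteq> cdom c" "inj_on \<pi> U"
  shows "(cdim c, U, \<lambda>y. coord c (\<pi> y)) \<in> charts X"
    and "y \<in> U \<Longrightarrow> cinv (cdim c, U, \<lambda>y. coord c (\<pi> y)) (coord c (\<pi> y)) = y"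
proof -
  note lm = chartsD(1)[OF c]
  let ?k = "\<lambda>y. coord c (\<pi> y)"
  have im: "?k ` W = coord c ` (\<pi> ` W)" for W by auto
  have "inj_on ?k U"
    using comp_inj_on[OF U(3) inj_on_subset[OF local_model_inj[OF lm] U(2)]] by (simp add: o_def)
  then have inv: "cinv (cdim c, U, ?k) (coord c (\<pi> y)) = y" if "y \<in> U" for y
    using that by (simp add: cinv_def inv_into_f_f[of ?k U y])
  then show "y \<in> U \<Longrightarrow> cinv (cdim c, U, \<lambda>y. coord c (\<pi> y)) (coord c (\<pi> y)) = y" .
  show "(cdim c, U, ?k) \<in> charts X"
  proof (rule chartI[OF U(1)])
    show "open_Cn (cdim c) (?k ` U)" unfolding im using chart_open_image[OF c local_iso_open[OF U(1)] U(2)] .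
    have tc: "topspace (subtopology (Top Y) (cdom c)) = cdom c" using openin_subset[OF local_model_open[OF lm]] by auto
    have "homeomorphic_map (subtopology (subtopology (Top Y) (cdom c)) (\<pi> ` U)) (subtopology (top_of_set (cimage c)) (coord c ` \<pi> ` U)) (coord c)"
      using tc U(2) by (intro homeomorphic_map_subtopologies[OF local_model_homeo[OF lm]]) (auto simp: cimage_def)
    moreover have "subtopology (subtopology (Top Y) (cdom c)) (\<pi> ` U) = subtopology (Top Y) (\<pi> ` U)"
      "subtopology (top_of_set (cimage c)) (coord c ` \<pi> ` U) = top_of_set (?k ` U)"
      using U(2) by (auto simp: subtopology_subtopology cimage_def Int_absorb1 image_mono im)
    ultimately show "homeomorphic_map (subtopology (Top X) U) (top_of_set (?k ` U)) ?k"
      using homeomorphic_map_compose[OF local_iso_homeo[OF U(1,3)]] by (fastforce simp: o_def)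
    fix W and f :: "_ \<Rightarrow> complex" assume W: "openin (Top X) W" "W \<subseteq> U"
    let ?g = "f \<circ> inv_into U \<pi>"
    have g: "?g (\<pi> y) = f y" if "y \<in> W" for y using that W U(3) by auto
    have "f \<in> hol_fns X W \<longleftrightarrow> ?g \<circ> \<pi> \<in> hol_fns X W"
      using sheaf_cong[OF X W(1), of f "?g \<circ> \<pi>"] sheaf_cong[OF X W(1), of "?g \<circ> \<pi>" f] g by auto
    also have "\<dots> \<longleftrightarrow> ?g \<in> hol_fns Y (\<pi> ` W)"
      using local_iso_hol[OF W(1) inj_on_subset[OF U(3) W(2)]] by simp
    also have "\<dots> \<longleftrightarrow> holomorphic_on_set (cdim c) (coord c ` \<pi> ` W) (?g \<circ> cinv c)"
      using local_model_hol_fns[OF lm local_iso_open[OF W(1)]] W U(2) by blast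
    also have "\<dots> \<longleftrightarrow> holomorphic_on_set (cdim c) (?k ` W) (f \<circ> cinv (cdim c, U, ?k))"
    proof (rule holomorphic_on_set_cong[OF im[symmetric]])
      fix z assume "z \<in> coord c ` \<pi> ` W"
      then obtain y where y: "y \<in> W" "z = coord c (\<pi> y)" by auto
      then have "\<pi> y \<in> cdom c" using W U(2) by auto
      then show "(?g \<circ> cinv c) z = (f \<circ> cinv (cdim c, U, ?k)) z"
        using y inv[of y] W g[of y] cinv_coord[OF lm] by auto
    qed
    finally show "f \<in> hol_fns X W \<longleftrightarrow> holomorphic_on_set (cdim c) (?k ` W) (f \<circ> cinv (cdim c, U, ?k))" .
  qed
qed

lemma local_iso_injective_nbhd:
  assumes "openin (Top X) N" "y \<in> N"
  obtains U where "openin (Top X) U" "y \<in> U" "U \<subseteq> N" "inj_on \<pi> U"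
proof -
  have "y \<in> points X" using assms openin_subset by blast
  then obtain U where "openin (Top X) U" "y \<in> U" "inj_on \<pi> U"
    using iso by (auto simp: local_iso_def)
  then show ?thesis using assms that[of "U \<inter> N"] inj_on_subset[of \<pi> U "U \<inter> N"] by auto
qed

lemma local_iso_manifold:
  assumes X: "complex_manifold X" and surj: "\<pi> ` points X = points Y"
    and Y: "Hausdorff_space (Top Y)" "second_countable (Top Y)" "is_function_sheaf Y"
  shows "complex_manifold Y"
proof -
  have "\<exists>c\<in>charts Y. w \<in> cdom c" if w: "w \<in> points Y" for w
  proof -
    obtain y where y: "y \<in> points X" "w = \<pi> y" using w surj by auto
    obtain c where c: "c \<in> charts X" "y \<in> cdom c" using complex_manifoldD(4)[OF X y(1)] by blast
    obtain U where U: "openin (Top X) U" "y \<in> U" "U \<subseteq> cdom c" "inj_on \<pi> U"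
      using local_iso_injective_nbhd[OF local_model_open[OF chartsD(1)[OF c(1)]] c(2)] .
    show ?thesis
      using push_chart[OF c(1) U(1,3,4)] U(2) y(2) by (intro bexI) auto
  qed
  then have ch: "\<forall>w\<in>points Y. \<exists>c\<in>charts Y. w \<in> cdom c" by blast
  have "\<exists>c. local_model Y c \<and> w \<in> cdom c" if w: "w \<in> points Y" for w
  proof -
    obtain c where "c \<in> charts Y" "w \<in> cdom c" using ch w by auto
    then show ?thesis using chartsD(1)[of c Y] by blast
  qed
  then have "complex_variety Y" unfolding complex_variety_def using Y by (intro conjI ballI) auto
  then show ?thesis using ch unfolding complex_manifold_def by (intro conjI)
qed

end

section \<open>Smooth potentials and their forms\<close>

definition smooth_potential :: "'a complex_space \<Rightarrow> ('a \<Rightarrow> real) \<Rightarrow> bool" where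
  "smooth_potential X \<psi> \<longleftrightarrow> (\<forall>c\<in>charts X. gen_smooth (cdim c) (cimage c) (\<psi> \<circ> cinv c))"

definition strictly_psh :: "'a complex_space \<Rightarrow> ('a \<Rightarrow> real) \<Rightarrow> bool" where
  "strictly_psh X \<psi> \<longleftrightarrow> smooth_potential X \<psi> \<and>
     (\<forall>c\<in>charts X. \<forall>z\<in>cimage c. \<forall>u\<in>Cn (cdim c). u \<noteq> (\<lambda>_. 0) \<longrightarrow> levi (\<psi> \<circ> cinv c) z u > 0)"

definition ddc_form :: "('a \<Rightarrow> real) \<Rightarrow> 'a form2" where
  "ddc_form \<psi> = (\<lambda>c. ddc (\<psi> \<circ> cinv c))"

lemma smooth_potential_imp_smooth_function: "smooth_potential X \<psi> \<Longrightarrow> smooth_function X \<psi>"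
  by (auto simp: smooth_potential_def smooth_function_def intro: gen_smooth_imp_smooth_Cn)

lemma holomorphic_map_id: "holomorphic_map X X id"
proof -
  have "hol_fns X {y \<in> points X. y \<in> W} = hol_fns X W" if "openin (Top X) W" for W
    using openin_subset[OF that] by (intro arg_cong[where f = "hol_fns X"]) auto
  then show ?thesis by (auto simp: holomorphic_map_def)
qed

text \<open>
  It suffices that \<open>F\<close> agrees near \<open>y\<close> with a holomorphic map, since a deck transformation is a power of
  \<open>\<gamma>\<close> only on each component.
\<close>

lemma chart_transition:
  assumes X: "is_function_sheaf X" and c: "c \<in> charts X" and d: "d \<in> charts Y"
    and y: "y \<in> cdom c" "F y \<in> cdom d"
    and F: "holomorphic_map X Y F'" "openin (Top X) N" "y \<in> N" "\<And>w. w \<in> N \<Longrightarrow> F w = F' w"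
  shows "\<exists>D. D \<subseteq> cimage c \<and> coord c y \<in> D \<and>
    holomorphic_to (cdim c) D (cdim d) (cimage d) (\<lambda>w. coord d (F (cinv c w))) \<and>
    (\<forall>w\<in>D. F (cinv c w) \<in> cdom d)"
proof -
  note lc = chartsD(1)[OF c] and ld = chartsD(1)[OF d]
  define P where "P = {y\<in>points X. F' y \<in> cdom d}"
  have P: "openin (Top X) P"
    using F(1) local_model_open[OF ld] unfolding P_def holomorphic_map_def
    by (auto intro: openin_continuous_map_preimage)
  define U where "U = cdom c \<inter> N \<inter> P"
  have U: "openin (Top X) U" "U \<subseteq> cdom c" "U \<subseteq> N" "U \<subseteq> P"
    using P F(2) local_model_open[OF lc] by (auto simp: U_def)
  have yU: "y \<in> U"
    using y F openin_subset[OF F(2)] by (auto simp: U_def P_def)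
  let ?\<Phi> = "\<lambda>w. coord d (F (cinv c w))"
  have o: "open_Cn (cdim c) (coord c ` U)" by (rule chart_open_image[OF c U(1,2)])
  have inv: "cinv c (coord c w) = w" if "w \<in> U" for w using that U(2) cinv_coord[OF lc] by auto
  have "holomorphic_Cn (cdim c) (coord c ` U) (\<lambda>w. ?\<Phi> w k)" for k
  proof -
    have "(\<lambda>y. coord d y k) \<circ> F' \<in> hol_fns X P"
      using F(1) local_model_coord_holomorphic[OF ld] local_model_open[OF ld]
      unfolding holomorphic_map_def P_def by blast
    then have "(\<lambda>y. coord d y k) \<circ> F' \<in> hol_fns X U"
      using sheaf_restrict[OF X P U(1,4)] by blast
    then have "holomorphic_Cn (cdim c) (coord c ` U) (\<lambda>w. coord d (F' (cinv c w)) k)"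
      using chart_hol_fns[OF c U(1,2)] by simp
    then show ?thesis
      by (rule holomorphic_Cn_cong) (use inv F(4) U(3) in auto)
  qed
  moreover have dom: "F (cinv c w) \<in> cdom d" if w: "w \<in> coord c ` U" for w
  proof -
    obtain x where x: "x \<in> U" "w = coord c x" using w by auto
    then have "F x = F' x" using F(4) U(3) by auto
    then show ?thesis using x inv[OF x(1)] U(4) by (auto simp: P_def)
  qed
  ultimately have "holomorphic_to (cdim c) (coord c ` U) (cdim d) (cimage d) ?\<Phi>"
    unfolding holomorphic_to_def using o chartsD(2)[OF d] coord_in[OF ld] by blast
  then show ?thesis using dom yU U(2) by (intro exI[of _ "coord c ` U"]) (auto simp: cimage_def)
qed

lemma push_eq_jac: "push F c d z u = jac (\<lambda>w. coord d (F (cinv c w))) u z"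
  by (simp add: push_def jac_def)

lemma ddc_form_pullback:
  assumes X: "is_function_sheaf X" and \<psi>: "smooth_potential Y \<psi>" and c: "c \<in> charts X" and d: "d \<in> charts Y"
    and y: "y \<in> cdom c" "F y \<in> cdom d"
    and F: "holomorphic_map X Y F'" "openin (Top X) N" "y \<in> N" "\<And>w. w \<in> N \<Longrightarrow> F w = F' w"
    and uv: "u \<in> Cn (cdim c)" "v \<in> Cn (cdim c)"
    and eq: "\<And>w. w \<in> N \<Longrightarrow> \<psi>' w = \<psi> (F w)"
  shows "ddc_form \<psi>' c (coord c y) u v =
     ddc_form \<psi> d (coord d (F y)) (push F c d (coord c y) u) (push F c d (coord c y) v)"
proof -
  obtain D where D: "D \<subseteq> cimage c" "coord c y \<in> D"
    "holomorphic_to (cdim c) D (cdim d) (cimage d) (\<lambda>w. coord d (F (cinv c w)))"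
    "\<And>w. w \<in> D \<Longrightarrow> F (cinv c w) \<in> cdom d"
    using chart_transition[where F = F and F' = F', OF X c d y F] by auto
  note lc = chartsD(1)[OF c] and ld = chartsD(1)[OF d]
  have s: "gen_smooth (cdim d) (cimage d) (\<psi> \<circ> cinv d)" using \<psi> d by (auto simp: smooth_potential_def)
  define D' where "D' = D \<inter> coord c ` (N \<inter> cdom c)"
  have oD: "open_Cn (cdim c) D" using D(3) by (auto simp: holomorphic_to_def)
  have "open_Cn (cdim c) (coord c ` (N \<inter> cdom c))"
    using chart_open_image[OF c, of "N \<inter> cdom c"] F(2) local_model_open[OF lc] by auto
  then have o: "open_Cn (cdim c) D'" using oD by (auto simp: D'_def)
  have y': "coord c y \<in> D'" using D(2) y F(3) by (auto simp: D'_def)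
  have "ddc_form \<psi>' c (coord c y) u v = ddc (\<lambda>w. (\<psi> \<circ> cinv d) (coord d (F (cinv c w)))) (coord c y) u v"
    unfolding ddc_form_def
  proof (rule ddc_cong[OF o y' _ uv])
    fix w assume w: "w \<in> D'"
    then have "cinv c w \<in> N" "w \<in> D" using cinv_coord[OF lc] by (auto simp: D'_def)
    then show "(\<psi>' \<circ> cinv c) w = (\<psi> \<circ> cinv d) (coord d (F (cinv c w)))"
      using eq D(4) cinv_coord[OF ld] by simp
  qed
  also have "\<dots> = ddc_form \<psi> d (coord d (F y)) (push F c d (coord c y) u) (push F c d (coord c y) v)"
    using ddc_compose[OF s D(3,2) uv] y cinv_coord[OF lc] by (simp add: push_eq_jac ddc_form_def)
  finally show ?thesis .
qed

lemma kaehler_metric_ddc_form: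
  assumes X: "is_function_sheaf X" and \<psi>: "strictly_psh X \<psi>"
  shows "kaehler_metric X (ddc_form \<psi>)" "kaehler_potential X (ddc_form \<psi>) \<psi>"
proof -
  have s: "gen_smooth (cdim c) (cimage c) (\<psi> \<circ> cinv c)" if "c \<in> charts X" for c
    using \<psi> that by (auto simp: strictly_psh_def smooth_potential_def)
  have sp: "smooth_potential X \<psi>" using \<psi> by (simp add: strictly_psh_def)
  show "kaehler_potential X (ddc_form \<psi>) \<psi>"
    using smooth_potential_imp_smooth_function[OF sp] by (simp add: kaehler_potential_def ddc_form_def)
  have "is_pullback_on (points X) X X id (ddc_form \<psi>) (ddc_form \<psi>)"
    unfolding is_pullback_on_def
  proof (intro ballI impI)
    fix c d y u v
    assume c: "c \<in> charts X" and d: "d \<in> charts X" and y: "y \<in> points X \<inter> cdom c" "id y \<in> cdom d"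
      and uv: "u \<in> Cn (cdim c)" "v \<in> Cn (cdim c)"
    show "ddc_form \<psi> c (coord c y) u v =
      ddc_form \<psi> d (coord d (id y)) (push id c d (coord c y) u) (push id c d (coord c y) v)"
      by (rule ddc_form_pullback[where F = id and F' = id and N = "points X", OF X sp c d _ y(2) holomorphic_map_id _ _ refl uv])
         (use y in auto)
  qed
  then have "smooth_form2 X (ddc_form \<psi>)"
    unfolding smooth_form2_def
  proof (intro conjI ballI allI)
    fix c z u v assume c: "c \<in> charts X" and z: "z \<in> cimage c" and uv: "u \<in> Cn (cdim c)" "v \<in> Cn (cdim c)"
    show "ddc_form \<psi> c z v u = - ddc_form \<psi> c z u v" unfolding ddc_form_def by (rule ddc_skew)
    show "ddc_form \<psi> c z (add_cvec u w) v = ddc_form \<psi> c z u v + ddc_form \<psi> c z w v" if "w \<in> Cn (cdim c)" for w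
      unfolding ddc_form_def by (rule ddc_linear(1)[OF s[OF c] z uv that])
    show "ddc_form \<psi> c z (scale_cvec (of_real a) u) v = a * ddc_form \<psi> c z u v" for a
      unfolding ddc_form_def by (rule ddc_linear(2)[OF s[OF c] z uv])
  next
    fix c u v assume c: "c \<in> charts X" and uv: "u \<in> Cn (cdim c)" "v \<in> Cn (cdim c)"
    show "smooth_Cn (cdim c) (cimage c) (\<lambda>z. ddc_form \<psi> c z u v)"
      unfolding ddc_form_def by (rule gen_smooth_imp_smooth_Cn[OF gen_smooth_ddc[OF s[OF c] uv]])
  qed
  then have "hermitian_metric X (ddc_form \<psi>)"
    unfolding hermitian_metric_def
    using ddc_invariant[OF s] \<psi> by (auto simp: ddc_form_def strictly_psh_def levi_def)
  then show "kaehler_metric X (ddc_form \<psi>)"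
    unfolding kaehler_metric_def using ddc_closed[OF s] by (auto simp: ddc_form_def)
qed

section \<open>Compact neighbourhoods in local models\<close>

definition chart_norm :: "'a chart \<Rightarrow> 'a \<Rightarrow> 'a \<Rightarrow> real" where
  "chart_norm c y w = (\<Sum>i<cdim c. (cmod (coord c w i - coord c y i))\<^sup>2)"

lemma analytic_subset_closed:
  assumes "analytic_subset n D A" shows "open_Cn n (D - A)"
proof (subst openin_subopen, intro ballI)
  fix z assume z: "z \<in> D - A"
  obtain W F where W: "open_Cn n W" "z \<in> W" "W \<subseteq> D" "finite F" "\<forall>f\<in>F. holomorphic_Cn n W f"
    "A \<inter> W = {w\<in>W. \<forall>f\<in>F. f w = 0}"
    using assms[unfolded analytic_subset_def, THEN conjunct2, THEN conjunct2, rule_format, of z, OF DiffD1[OF z]] by auto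
  have "z \<notin> A \<inter> W" using z by simp
  then obtain f where f: "f \<in> F" "f z \<noteq> 0" unfolding W(6) using W(2) by blast
  have "openin (top_of_set W) (W \<inter> f -` (- {0}))"
    using W f by (intro continuous_openin_preimage_gen) (auto dest: holomorphic_Cn_continuous)
  then have "open_Cn n (W \<inter> f -` (- {0}))" using W(1) openin_trans by blast
  then show "\<exists>T. open_Cn n T \<and> z \<in> T \<and> T \<subseteq> D - A"
    using W f by (intro exI[of _ "W \<inter> f -` (- {0})"]) auto
qed

lemma compact_closed_ball_Cn:
  assumes s: "s \<ge> 0" shows "compact {w\<in>Cn n. (\<Sum>i<n. (cmod (w i - z i))\<^sup>2) \<le> s\<^sup>2}"
proof -
  let ?P = "PiE UNIV (\<lambda>i. if i < n then cball (z i) s else {0})"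
  have "compactin (product_topology (\<lambda>i. euclidean) UNIV) ?P"
    unfolding compactin_PiE by auto
  then have "compact ?P" by (simp add: euclidean_product_topology)
  moreover have "closed {w::cvec. (\<Sum>i<n. (cmod (w i - z i))\<^sup>2) \<le> s\<^sup>2}"
    by (intro closed_Collect_le continuous_intros continuous_on_product_coordinates)
  ultimately have "compact (?P \<inter> {w. (\<Sum>i<n. (cmod (w i - z i))\<^sup>2) \<le> s\<^sup>2})" by blast
  moreover have "?P \<inter> {w. (\<Sum>i<n. (cmod (w i - z i))\<^sup>2) \<le> s\<^sup>2} = {w\<in>Cn n. (\<Sum>i<n. (cmod (w i - z i))\<^sup>2) \<le> s\<^sup>2}"
  proof (intro equalityI subsetI)
    fix w assume w: "w \<in> {w\<in>Cn n. (\<Sum>i<n. (cmod (w i - z i))\<^sup>2) \<le> s\<^sup>2}"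
    have "cmod (w i - z i) \<le> s" if "i < n" for i
    proof -
      have "(cmod (w i - z i))\<^sup>2 \<le> (\<Sum>i<n. (cmod (w i - z i))\<^sup>2)"
        using that by (intro member_le_sum) auto
      also have "\<dots> \<le> s\<^sup>2" using w by blast
      finally show ?thesis using s by (rule power2_le_imp_le)
    qed
    then have "w i \<in> (if i < n then cball (z i) s else {0})" for i
      using w by (cases "i < n") (auto simp: Cn_def dist_norm norm_minus_commute)
    then have "w \<in> ?P" unfolding PiE_iff by simp
    then show "w \<in> ?P \<inter> {w. (\<Sum>i<n. (cmod (w i - z i))\<^sup>2) \<le> s\<^sup>2}"
      using w by simp
  next
    fix w assume w: "w \<in> ?P \<inter> {w. (\<Sum>i<n. (cmod (w i - z i))\<^sup>2) \<le> s\<^sup>2}"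
    have "w i = 0" if "i \<ge> n" for i
      using PiE_mem[of w UNIV "\<lambda>i. if i < n then cball (z i) s else {0}" i] w that by auto
    then show "w \<in> {w\<in>Cn n. (\<Sum>i<n. (cmod (w i - z i))\<^sup>2) \<le> s\<^sup>2}" using w by (auto simp: Cn_def)
  qed
  ultimately show ?thesis by simp
qed

text \<open>
  The image of a local model is closed in an open set of \<open>C\<^sup>n\<close>, so it meets small closed balls in compact
  sets.
\<close>

lemma local_model_compact_nbhd:
  assumes c: "local_model X c" and y: "y \<in> cdom c"
  obtains r where "r > 0" "compactin (Top X) {w\<in>cdom c. chart_norm c y w \<le> r}"
proof -
  let ?n = "cdim c" and ?z = "coord c y" and ?A = "cimage c"
  obtain D where D: "analytic_subset ?n D ?A" using c by (auto simp: local_model_def)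
  have Do: "open_Cn ?n D" "?A \<subseteq> D" using D by (auto simp: analytic_subset_def)
  have z: "?z \<in> D" "?z \<in> Cn ?n" using coord_in[OF c y] Do open_Cn_subset[OF Do(1)] by auto
  obtain e where e: "e > 0" "polydisc ?n ?z e \<subseteq> D" using open_contains_polydisc[OF Do(1) z(1)] .
  define s where "s = e / 2"
  have s: "s > 0" "s < e" using e by (auto simp: s_def)
  define C where "C = {w\<in>Cn ?n. (\<Sum>i<?n. (cmod (w i - ?z i))\<^sup>2) \<le> s\<^sup>2}"
  have "C \<subseteq> polydisc ?n ?z e"
  proof
    fix w assume w: "w \<in> C"
    have "cmod (w i - ?z i) < e" if "i < ?n" for i
    proof -
      have "(cmod (w i - ?z i))\<^sup>2 \<le> (\<Sum>i<?n. (cmod (w i - ?z i))\<^sup>2)"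
        using that by (intro member_le_sum) auto
      also have "\<dots> \<le> s\<^sup>2" using w unfolding C_def by blast
      finally have "cmod (w i - ?z i) \<le> s" by (rule power2_le_imp_le[OF _ less_imp_le[OF s(1)]])
      then show ?thesis using s by simp
    qed
    then show "w \<in> polydisc ?n ?z e" using w by (auto simp: polydisc_def C_def)
  qed
  then have CD: "C \<subseteq> D" using e by auto
  obtain T where T: "open T" "D - ?A = Cn ?n \<inter> T"
    using analytic_subset_closed[OF D] by (auto simp: openin_open)
  have "?A \<inter> C = C \<inter> - T" using CD T Do open_Cn_subset[OF Do(1)] by blast
  then have "compact (?A \<inter> C)"
    using compact_Int_closed[OF compact_closed_ball_Cn[of s ?n ?z], of "- T"] T(1) s by (simp add: C_def closed_Compl)
  then have K: "compactin (top_of_set ?A) (?A \<inter> C)" by (simp add: compactin_subtopology)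
  have t: "topspace (subtopology (Top X) (cdom c)) = cdom c"
    using openin_subset[OF local_model_open[OF c]] by auto
  have "homeomorphic_map (top_of_set ?A) (subtopology (Top X) (cdom c)) (cinv c)"
    using homeomorphic_map_inverse[OF local_model_homeo[OF c]] t cinv_coord[OF c] by simp
  then have "compactin (subtopology (Top X) (cdom c)) (cinv c ` (?A \<inter> C))"
    using image_compactin[OF K] homeomorphic_imp_continuous_map by blast
  then have "compactin (Top X) (cinv c ` (?A \<inter> C))" by (simp add: compactin_subtopology)
  moreover have "cinv c ` (?A \<inter> C) = {w\<in>cdom c. chart_norm c y w \<le> s\<^sup>2}"
  proof (intro equalityI subsetI)
    fix w assume "w \<in> {w\<in>cdom c. chart_norm c y w \<le> s\<^sup>2}"
    then have w: "w \<in> cdom c" "chart_norm c y w \<le> s\<^sup>2" by auto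
    then have "coord c w \<in> ?A \<inter> C"
      using coord_in[OF c w(1)] local_model_image_subset[OF c] by (auto simp: C_def chart_norm_def)
    then show "w \<in> cinv c ` (?A \<inter> C)" using cinv_coord[OF c w(1)] by force
  qed (auto simp: C_def chart_norm_def coord_cinv[OF c] cinv_in[OF c])
  ultimately show ?thesis using that[of "s\<^sup>2"] s by simp
qed

lemma chart_norm_continuous:
  assumes c: "local_model X c"
  shows "continuous_map (subtopology (Top X) (cdom c)) euclideanreal (chart_norm c y)"
proof -
  have 1: "continuous_map (subtopology (Top X) (cdom c)) (top_of_set (cimage c)) (coord c)"
    using local_model_homeo[OF c] homeomorphic_imp_continuous_map by blast
  have "continuous_on (cimage c) (\<lambda>v. \<Sum>i<cdim c. (cmod (v i - coord c y i))\<^sup>2)"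
    by (intro continuous_on_sum continuous_on_power continuous_on_norm continuous_on_diff continuous_on_const
        continuous_on_subset[OF continuous_on_product_coordinates subset_UNIV])
  then have "continuous_map (top_of_set (cimage c)) euclideanreal (\<lambda>v. \<Sum>i<cdim c. (cmod (v i - coord c y i))\<^sup>2)"
    by simp
  from continuous_map_compose[OF 1 this] show ?thesis unfolding o_def chart_norm_def[abs_def] .
qed

lemma chart_norm_open:
  assumes c: "local_model X c" and "open T"
  shows "openin (Top X) {w\<in>cdom c. chart_norm c y w \<in> T}"
proof -
  have t: "topspace (subtopology (Top X) (cdom c)) = cdom c"
    using openin_subset[OF local_model_open[OF c]] by auto
  have "openin (subtopology (Top X) (cdom c)) {w\<in>topspace (subtopology (Top X) (cdom c)). chart_norm c y w \<in> T}"
    using chart_norm_continuous[OF c] assms(2) by (intro openin_continuous_map_preimage) auto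
  then show ?thesis using t local_model_open[OF c] openin_trans_full by fastforce
qed

lemma chart_norm_nonneg: "chart_norm c y w \<ge> 0"
  by (simp add: chart_norm_def sum_nonneg)

lemma chart_norm_eq_0:
  assumes c: "local_model X c" and "y \<in> cdom c" "w \<in> cdom c"
  shows "chart_norm c y w = 0 \<longleftrightarrow> w = y"
proof
  assume "chart_norm c y w = 0"
  then have "\<forall>i<cdim c. coord c w i = coord c y i"
    by (auto simp: chart_norm_def sum_nonneg_eq_0_iff)
  moreover have "coord c w \<in> Cn (cdim c)" "coord c y \<in> Cn (cdim c)"
    using assms(2,3) coord_in[OF c] local_model_image_subset[OF c] by auto
  ultimately have "coord c w i = coord c y i" for i by (cases "i < cdim c") (auto simp: Cn_def)
  then have "coord c w = coord c y" by blast
  then show "w = y" using inj_onD[OF local_model_inj[OF c]] assms by blast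
qed (simp add: chart_norm_def)

lemma complex_variety_compact_nbhd:
  assumes "complex_variety X" "y \<in> points X"
  obtains U K where "openin (Top X) U" "y \<in> U" "U \<subseteq> K" "compactin (Top X) K"
proof -
  obtain c where c: "local_model X c" "y \<in> cdom c" using assms by (auto simp: complex_variety_def)
  obtain r where r: "r > 0" "compactin (Top X) {w\<in>cdom c. chart_norm c y w \<le> r}"
    using local_model_compact_nbhd[OF c] .
  have "openin (Top X) {w\<in>cdom c. chart_norm c y w \<in> {..<r}}" by (rule chart_norm_open[OF c(1)]) simp
  then show ?thesis
    using c(2) r chart_norm_eq_0[OF c(1) c(2) c(2)]
    by (intro that[of "{w\<in>cdom c. chart_norm c y w \<in> {..<r}}" "{w\<in>cdom c. chart_norm c y w \<le> r}"]) auto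
qed

section \<open>Iterates of an invertible contraction\<close>

lemma holomorphic_map_compose:
  assumes f: "holomorphic_map X Y f" and g: "holomorphic_map Y Z g"
  shows "holomorphic_map X Z (g \<circ> f)"
  unfolding holomorphic_map_def
proof (intro conjI allI impI)
  show "continuous_map (Top X) (Top Z) (g \<circ> f)"
    using f g continuous_map_compose by (auto simp: holomorphic_map_def)
  fix W h assume W: "openin (Top Z) W \<and> h \<in> hol_fns Z W"
  let ?W = "{y\<in>points Y. g y \<in> W}"
  have "openin (Top Y) ?W" using g W by (auto simp: holomorphic_map_def intro: openin_continuous_map_preimage)
  moreover have "h \<circ> g \<in> hol_fns Y ?W" using g W by (auto simp: holomorphic_map_def)
  ultimately have "(h \<circ> g) \<circ> f \<in> hol_fns X {y\<in>points X. f y \<in> ?W}" using f unfolding holomorphic_map_def by blast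
  moreover have "f y \<in> points Y" if "y \<in> points X" for y
    using f that continuous_map_image_subset_topspace unfolding holomorphic_map_def by blast
  then have "{y\<in>points X. f y \<in> ?W} = {y\<in>points X. (g \<circ> f) y \<in> W}" by auto
  ultimately show "h \<circ> (g \<circ> f) \<in> hol_fns X {y\<in>points X. (g \<circ> f) y \<in> W}" by (simp add: o_assoc)
qed

lemma holomorphic_map_points: "holomorphic_map X Y f \<Longrightarrow> y \<in> points X \<Longrightarrow> f y \<in> points Y"
  using continuous_map_image_subset_topspace unfolding holomorphic_map_def by blast

lemma holomorphic_map_funpow: "holomorphic_map X X f \<Longrightarrow> holomorphic_map X X (f ^^ n)"
  by (induction n) (auto intro: holomorphic_map_compose simp: holomorphic_map_id[unfolded id_def] id_def holomorphic_map_id)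

locale invertible_contraction =
  fixes V :: "'a complex_space" and x :: 'a and \<gamma> \<delta> :: "'a \<Rightarrow> 'a"
  assumes variety: "complex_variety V" and x: "x \<in> points V"
    and contraction: "holomorphic_contraction V x \<gamma>" and inverse: "holomorphic_map V V \<delta>"
    and \<delta>\<gamma>: "\<And>y. y \<in> points V \<Longrightarrow> \<delta> (\<gamma> y) = y" and \<gamma>\<delta>: "\<And>y. y \<in> points V \<Longrightarrow> \<gamma> (\<delta> y) = y"
    and manifold: "complex_manifold (open_subspace V (points V - {x}))"
begin

abbreviation "S \<equiv> points V - {x}"
abbreviation "M \<equiv> open_subspace V S"

lemma sheaf: "is_function_sheaf V" and Hausdorff: "Hausdorff_space (Top V)"
  using variety by (auto simp: complex_variety_def)

lemma hol_\<gamma>: "holomorphic_map V V \<gamma>" and \<gamma>_x: "\<gamma> x = x"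
  using contraction by (auto simp: holomorphic_contraction_def)

definition iter :: "int \<Rightarrow> 'a \<Rightarrow> 'a" where
  "iter k = (if 0 \<le> k then \<gamma> ^^ nat k else \<delta> ^^ nat (- k))"

lemma iter_holomorphic: "holomorphic_map V V (iter k)"
  unfolding iter_def using hol_\<gamma> inverse by (auto intro: holomorphic_map_funpow)

lemma iter_points: "y \<in> points V \<Longrightarrow> iter k y \<in> points V"
  using holomorphic_map_points[OF iter_holomorphic] .

lemma iter_0 [simp]: "iter 0 y = y" and iter_1 [simp]: "iter 1 y = \<gamma> y"
  by (auto simp: iter_def)

lemma iter_Suc: assumes "y \<in> points V" shows "iter (k + 1) y = \<gamma> (iter k y)"
proof (cases "0 \<le> k")
  case True
  then have "nat (k + 1) = Suc (nat k)" by simp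
  then show ?thesis using True by (simp add: iter_def)
next
  case False
  define m where "m = nat (- (k + 1))"
  have m: "nat (- k) = Suc m" using False by (simp add: m_def)
  have p: "(\<delta> ^^ m) y \<in> points V"
    using holomorphic_map_points[OF holomorphic_map_funpow[OF inverse] assms] .
  have "iter (k + 1) y = (\<delta> ^^ m) y"
    using False by (cases "k = -1") (auto simp: iter_def m_def)
  then show ?thesis using False m \<gamma>\<delta>[OF p] by (simp add: iter_def)
qed

lemma \<gamma>_inj: "y \<in> points V \<Longrightarrow> y' \<in> points V \<Longrightarrow> \<gamma> y = \<gamma> y' \<Longrightarrow> y = y'"
  using \<delta>\<gamma> by metis

lemma iter_add: assumes y: "y \<in> points V" shows "iter (j + k) y = iter j (iter k y)"
proof (induction j rule: int_induct[where k = 0])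
  case (step1 j)
  have "iter (j + 1 + k) y = \<gamma> (iter (j + k) y)" using iter_Suc[OF y, of "j + k"] by (simp add: add.commute add.left_commute)
  also have "\<dots> = iter (j + 1) (iter k y)" using step1 iter_Suc[OF iter_points[OF y]] by simp
  finally show ?case .
next
  case (step2 j)
  have "\<gamma> (iter (j - 1 + k) y) = iter (j + k) y" using iter_Suc[OF y, of "j - 1 + k"] by (simp add: algebra_simps)
  also have "\<dots> = \<gamma> (iter (j - 1) (iter k y))" using step2 iter_Suc[OF iter_points[OF y], of "j - 1" k] by simp
  finally show ?case using \<gamma>_inj iter_points y by blast
qed simp

lemma iter_inverse: "y \<in> points V \<Longrightarrow> iter (- k) (iter k y) = y" "y \<in> points V \<Longrightarrow> iter k (iter (- k) y) = y"
  using iter_add[of y "- k" k] iter_add[of y k "- k"] by auto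

lemma iter_x [simp]: "iter k x = x"
proof (induction k rule: int_induct[where k = 0])
  case (step1 k) then show ?case using iter_Suc[OF x] \<gamma>_x by simp
next
  case (step2 k) then show ?case using iter_Suc[OF x, of "k - 1"] \<gamma>_x \<gamma>_inj[OF iter_points[OF x] x] by simp
qed simp

lemma iter_S: assumes "y \<in> S" shows "iter k y \<in> S"
proof -
  have "iter k y \<noteq> x"
  proof
    assume "iter k y = x"
    then have "iter (- k) (iter k y) = x" by simp
    then show False using iter_inverse(1)[of y k] assms by simp
  qed
  then show ?thesis using iter_points[of y k] assms by simp
qed

lemma iter_S_iff: "y \<in> points V \<Longrightarrow> iter k y \<in> S \<longleftrightarrow> y \<in> S"
  using iter_S iter_points by auto

lemma iter_shrinks:
  assumes "compactin (Top V) K" "openin (Top V) U" "x \<in> U"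
  obtains N where "\<And>k. k > N \<Longrightarrow> iter k ` K \<subseteq> U" "N > 0"
proof -
  obtain N :: nat where N: "N > 0" "\<forall>n>N. (\<gamma> ^^ n) ` K \<subseteq> U"
    using contraction[unfolded holomorphic_contraction_def, THEN conjunct2, THEN conjunct2, rule_format, of K U] assms
    by auto
  have "iter k ` K \<subseteq> U" if "k > int N" for k
    using N(2)[rule_format, of "nat k"] that by (simp add: iter_def)
  then show ?thesis using that[of "int N"] N(1) by simp
qed

text \<open>
  Large powers move \<open>K\<close> into the neighbourhood \<open>points V - K\<close> of \<open>x\<close>. For large negative \<open>k\<close>, a point of
  \<open>iter k ` K \<inter> K\<close> would be moved by \<open>iter (- k)\<close> from \<open>K\<close> back to \<open>K\<close>.
\<close>

lemma iter_wandering: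
  assumes K: "compactin (Top V) K" "x \<notin> K"
  obtains N where "\<And>k. \<bar>k\<bar> > N \<Longrightarrow> iter k ` K \<inter> K = {}"
proof -
  have "closedin (Top V) K" using compactin_imp_closedin[OF Hausdorff K(1)] .
  then have "openin (Top V) (points V - K)" by blast
  then obtain N where N: "\<And>k. k > N \<Longrightarrow> iter k ` K \<subseteq> points V - K"
    using iter_shrinks[OF K(1), of "points V - K"] x K by (metis DiffI)
  have "iter k ` K \<inter> K = {}" if "\<bar>k\<bar> > N" for k
  proof (cases "k > N")
    case False
    then have "- k > N" using that by auto
    show ?thesis
    proof (rule ccontr)
      assume "\<not> ?thesis"
      then obtain y where y: "y \<in> K" "iter k y \<in> K" by auto
      then have "iter (- k) (iter k y) = y" using K(1) compactin_subset_topspace iter_inverse by blast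
      then show False using N[OF \<open>- k > N\<close>] y by force
    qed
  qed (use N in blast)
  then show ?thesis using that by blast
qed

lemma iter_multiple: "y \<in> points V \<Longrightarrow> iter k y = y \<Longrightarrow> iter (int m * k) y = y"
proof (induction m)
  case (Suc m)
  then show ?case using iter_add[of y k "int m * k"] by (simp add: algebra_simps)
qed simp

lemma iter_free: assumes "y \<in> S" "iter k y = y" shows "k = 0"
proof (rule ccontr)
  assume k: "k \<noteq> 0"
  have "compactin (Top V) {y}" using assms by simp
  then obtain N where N: "\<And>k. \<bar>k\<bar> > N \<Longrightarrow> iter k ` {y} \<inter> {y} = {}"
    using iter_wandering[of "{y}"] assms by auto
  have "\<bar>int (nat \<bar>N\<bar> + 1) * k\<bar> > N"
  proof -
    have "\<bar>int (nat \<bar>N\<bar> + 1)\<bar> * 1 \<le> \<bar>int (nat \<bar>N\<bar> + 1)\<bar> * \<bar>k\<bar>" using k by (intro mult_left_mono) auto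
    then show ?thesis by (simp add: abs_mult)
  qed
  note empty = N[OF this]
  have "iter (int (nat \<bar>N\<bar> + 1) * k) y = y" using iter_multiple[OF _ assms(2)] assms(1) by blast
  then show False using empty by blast
qed

lemma iter_S_inj: "y \<in> S \<Longrightarrow> iter j y = iter k y \<Longrightarrow> j = k"
proof -
  assume y: "y \<in> S" and e: "iter j y = iter k y"
  have "iter (j - k) y = iter (- k) (iter j y)" using iter_add[of y "-k" j] y by simp
  also have "\<dots> = y" using e iter_inverse y by simp
  finally show ?thesis using iter_free[OF y] by fastforce
qed

subsection \<open>The action on the punctured variety\<close>

lemma open_S: "openin (Top V) S"
proof -
  have "closedin (Top V) {x}" using closedin_Hausdorff_singleton[OF Hausdorff x] .
  from openin_diff[OF openin_topspace this] show ?thesis .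
qed

lemma openin_M: "openin (Top M) U \<longleftrightarrow> openin (Top V) U \<and> U \<subseteq> S"
  using openin_open_subtopology[OF open_S] by (simp add: open_subspace_def)

lemma points_M [simp]: "points M = S"
  by (auto simp: open_subspace_def)

lemma hol_fns_M [simp]: "hol_fns M = hol_fns V"
  by (simp add: open_subspace_def)

lemma sheaf_M: "is_function_sheaf M" using complex_manifoldD(1)[OF manifold] .

lemma iter_image:
  assumes U: "U \<subseteq> S" shows "iter k ` U = {y\<in>S. iter (- k) y \<in> U}"
proof (intro equalityI subsetI)
  fix y assume y: "y \<in> {y\<in>S. iter (- k) y \<in> U}"
  then have "y = iter k (iter (- k) y)" using iter_inverse(2)[of y k] by simp
  then show "y \<in> iter k ` U" using y by blast
next
  fix y assume "y \<in> iter k ` U"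
  then obtain w where w: "w \<in> U" "y = iter k w" by blast
  then have "w \<in> S" using U by blast
  then show "y \<in> {y\<in>S. iter (- k) y \<in> U}" using iter_inverse(1)[of w k] iter_S[of w k] w by simp
qed

lemma iter_preimage_open:
  assumes "openin (Top M) U" shows "openin (Top M) {y\<in>S. iter k y \<in> U}"
proof -
  have "openin (Top V) {y\<in>points V. iter k y \<in> U}"
    using iter_holomorphic assms by (auto simp: holomorphic_map_def openin_M intro: openin_continuous_map_preimage)
  moreover have "{y\<in>points V. iter k y \<in> U} = {y\<in>S. iter k y \<in> U}"
    using assms iter_S_iff by (auto simp: openin_M)
  ultimately show ?thesis by (auto simp: openin_M)
qed

lemma iter_image_open: "openin (Top M) U \<Longrightarrow> openin (Top M) (iter k ` U)"
  using iter_image iter_preimage_open by (simp add: openin_M)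

lemma iter_hol_fns:
  assumes "openin (Top M) W" "f \<in> hol_fns V W" shows "(\<lambda>y. f (iter k y)) \<in> hol_fns V {y\<in>S. iter k y \<in> W}"
proof -
  have "f \<circ> iter k \<in> hol_fns V {y\<in>points V. iter k y \<in> W}"
    using iter_holomorphic[of k] assms unfolding holomorphic_map_def openin_M by blast
  moreover have "{y\<in>points V. iter k y \<in> W} = {y\<in>S. iter k y \<in> W}"
    using assms iter_S_iff by (auto simp: openin_M)
  ultimately show ?thesis by (simp add: o_def)
qed

lemma iter_separate:
  assumes y: "y \<in> S" "y' \<in> S" and F: "finite F" "\<And>k. k \<in> F \<Longrightarrow> iter k y \<noteq> y'"
  shows "\<exists>A B. openin (Top M) A \<and> openin (Top M) B \<and> y \<in> A \<and> y' \<in> B \<and> (\<forall>k\<in>F. iter k ` A \<inter> B = {})"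
  using F
proof (induction F)
  case empty
  have "openin (Top M) S" using open_S openin_M by blast
  then show ?case using y by blast
next
  case (insert k F)
  then obtain A B where AB: "openin (Top M) A" "openin (Top M) B" "y \<in> A" "y' \<in> B" "\<forall>k\<in>F. iter k ` A \<inter> B = {}" by auto
  have "iter k y \<in> points M" "y' \<in> points M" "iter k y \<noteq> y'" using iter_S[OF y(1)] y insert by auto
  then obtain A' B' where A': "openin (Top M) A'" "openin (Top M) B'" "iter k y \<in> A'" "y' \<in> B'" "disjnt A' B'"
    using complex_manifoldD(2)[OF manifold] unfolding Hausdorff_space_def by meson
  let ?A = "A \<inter> {w\<in>S. iter k w \<in> A'}" and ?B = "B \<inter> B'"
  have "openin (Top M) ?A" using AB A' iter_preimage_open by blast
  moreover have "openin (Top M) ?B" using AB A' by blast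
  moreover have "\<forall>j\<in>insert k F. iter j ` ?A \<inter> ?B = {}" using AB A' by (force simp: disjnt_def)
  moreover have "y \<in> ?A" "y' \<in> ?B" using AB A' y by auto
  ultimately show ?case by blast
qed

lemma M_compact_nbhd:
  assumes "y \<in> S"
  obtains U K where "openin (Top M) U" "y \<in> U" "U \<subseteq> K" "compactin (Top V) K" "x \<notin> K"
proof -
  have "complex_variety M" using manifold by (simp add: complex_manifold_def)
  from complex_variety_compact_nbhd[OF this, of y] assms
  obtain U K where "openin (Top M) U" "y \<in> U" "U \<subseteq> K" "compactin (Top M) K" by auto
  then show ?thesis using that by (auto simp: open_subspace_def compactin_subtopology)
qed

text \<open>
  By \<open>iter_wandering\<close> only finitely many powers can bring compact neighbourhoods of the two points
  together, and each of these is excluded by shrinking the neighbourhoods. Taking the powers different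
  from 0 and \<open>y = y'\<close> gives evenly covered neighbourhoods; taking all powers separates orbits.
\<close>

lemma separated_nbhds:
  assumes y: "y \<in> S" "y' \<in> S" and P: "\<And>k. P k \<Longrightarrow> iter k y \<noteq> y'"
  obtains A B where "openin (Top M) A" "openin (Top M) B" "y \<in> A" "y' \<in> B" "\<And>k. P k \<Longrightarrow> iter k ` A \<inter> B = {}"
proof -
  obtain U K where U: "openin (Top M) U" "y \<in> U" "U \<subseteq> K" "compactin (Top V) K" "x \<notin> K"
    using M_compact_nbhd[OF y(1)] .
  obtain U' K' where U': "openin (Top M) U'" "y' \<in> U'" "U' \<subseteq> K'" "compactin (Top V) K'" "x \<notin> K'"
    using M_compact_nbhd[OF y(2)] .
  obtain N where N: "\<And>k. \<bar>k\<bar> > N \<Longrightarrow> iter k ` (K \<union> K') \<inter> (K \<union> K') = {}"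
    using iter_wandering[of "K \<union> K'"] U U' compactin_Un by (metis UnE)
  have "{k. \<bar>k\<bar> \<le> N \<and> P k} \<subseteq> {- N..N}" by auto
  then have "finite {k. \<bar>k\<bar> \<le> N \<and> P k}" using finite_subset by blast
  from iter_separate[OF y this] P
  obtain A B where AB: "openin (Top M) A" "openin (Top M) B" "y \<in> A" "y' \<in> B"
     "\<forall>k\<in>{k. \<bar>k\<bar> \<le> N \<and> P k}. iter k ` A \<inter> B = {}" by auto
  show ?thesis
  proof (rule that[of "A \<inter> U" "B \<inter> U'"])
    fix k assume "P k"
    show "iter k ` (A \<inter> U) \<inter> (B \<inter> U') = {}"
    proof (cases "\<bar>k\<bar> \<le> N")
      case True
      then have "iter k ` A \<inter> B = {}" using AB(5) \<open>P k\<close> by blast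
      then show ?thesis by blast
    next
      case False
      then have "iter k ` (K \<union> K') \<inter> (K \<union> K') = {}" using N by auto
      then show ?thesis using U(3) U'(3) by blast
    qed
  qed (use AB U U' in auto)
qed

lemma free_nbhd:
  assumes "y \<in> S"
  obtains U where "openin (Top M) U" "y \<in> U" "\<And>k. k \<noteq> 0 \<Longrightarrow> iter k ` U \<inter> U = {}"
proof -
  obtain A B where AB: "openin (Top M) A" "openin (Top M) B" "y \<in> A" "y \<in> B" "\<And>k. k \<noteq> 0 \<Longrightarrow> iter k ` A \<inter> B = {}"
    using separated_nbhds[OF assms assms, of "\<lambda>k. k \<noteq> 0"] iter_free[OF assms] by metis
  show ?thesis by (rule that[of "A \<inter> B"]) (use AB in blast)+
qed

end

section \<open>The automorphic potential\<close>

lemma compactin_uniform_bound: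
  assumes K: "compactin X K"
    and loc: "\<And>v. v \<in> K \<Longrightarrow> \<exists>U C. openin X U \<and> v \<in> U \<and> (\<forall>w\<in>U \<inter> K. P w C)"
    and mono: "\<And>w C C'. P w C \<Longrightarrow> C \<le> C' \<Longrightarrow> P w C'"
  shows "\<exists>C::real. \<forall>w\<in>K. P w C"
proof -
  obtain U C where UC: "\<And>v. v \<in> K \<Longrightarrow> openin X (U v) \<and> v \<in> U v \<and> (\<forall>w\<in>U v \<inter> K. P w (C v))"
    using loc by metis
  have "\<exists>\<F>. finite \<F> \<and> \<F> \<subseteq> U ` K \<and> K \<subseteq> \<Union>\<F>"
    using K UC unfolding compactin_def by (elim conjE allE[of _ "U ` K"]) blast
  then obtain V where V: "finite V" "V \<subseteq> K" "K \<subseteq> \<Union>(U ` V)"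
    by (metis finite_subset_image)
  have "P w (Max (insert 0 (C ` V)))" if w: "w \<in> K" for w
  proof -
    obtain v where "v \<in> V" "w \<in> U v" using w V(3) by blast
    then have "P w (C v)" using UC V(2) w by blast
    then show ?thesis using mono \<open>v \<in> V\<close> V(1) by simp
  qed
  then show ?thesis by blast
qed

lemma compactin_positive_lower_bound:
  assumes "compactin X K" "continuous_map (subtopology X K) euclideanreal f" "\<And>w. w \<in> K \<Longrightarrow> f w > 0"
  obtains \<delta> where "\<delta> > (0::real)" "\<And>w. w \<in> K \<Longrightarrow> \<delta> < f w"
proof (cases "K = {}")
  case True
  then show ?thesis using that[of 1] by simp
next
  case False
  have "compactin (subtopology X K) K" using assms(1) by (simp add: compactin_subtopology)
  then have "compact (f ` K)" using image_compactin[OF _ assms(2)] by fastforce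
  then obtain m where "m \<in> f ` K" "\<forall>t\<in>f ` K. m \<le> t" using compact_attains_inf False by blast
  then show ?thesis using that[of "m / 2"] assms(3) by force
qed

lemma pd_coord:
  assumes "j < n" "i < n" shows "pd i (\<lambda>z. z j) z = (if i = j then 1 else 0)"
  unfolding pd_def by (cases "i = j") (auto intro!: DERIV_imp_deriv derivative_eq_intros)

lemma cdir_coord: "j < n \<Longrightarrow> cdir n u (\<lambda>z. z j) z = u j"
  by (simp add: cdir_def pd_coord if_distrib sum.delta cong: if_cong)

lemma cdir_diff_const:
  assumes "holomorphic_Cn n D h" "z \<in> D"
  shows "cdir n u (\<lambda>z. h z - a) z = cdir n u h z"
proof -
  have "pd i (\<lambda>z. h z - a) z = pd i h z" if "i < n" for i
    unfolding pd_def[of i "\<lambda>z. h z - a"]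
  proof (rule DERIV_imp_deriv)
    have "((\<lambda>w. h (z(i := w))) has_field_derivative pd i h z) (at (z i))"
      using pd_has_derivative[OF assms(1) _ that, of z "z i"] assms(2) by simp
    then show "((\<lambda>w. h (z(i := w)) - a) has_field_derivative pd i h z) (at (z i))"
      by (auto intro!: derivative_eq_intros)
  qed
  then show ?thesis by (simp add: cdir_def)
qed

lemma discrete_crossing:
  assumes "P (b::int)" "\<not> P a" "a \<le> b"
  obtains k where "P k" "\<not> P (k - 1)"
proof (rule ccontr)
  assume "\<not> thesis"
  then have *: "P k \<Longrightarrow> P (k - 1)" for k using that by blast
  have "P a" using assms(3)
    by (rule int_le_induct[of a b P]) (use assms(1) * in auto)
  then show False using assms(2) by simp
qed

locale contraction_chart = invertible_contraction +
  fixes c :: "'a chart" and r :: real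
  assumes c: "local_model V c" and xc: "x \<in> cdom c" and r: "r > 0"
    and compact_r: "compactin (Top V) {w\<in>cdom c. chart_norm c x w \<le> r}"
begin

abbreviation "B \<equiv> cdom c"
abbreviation "n \<equiv> cdim c"
abbreviation "\<phi> \<equiv> chart_norm c x"

lemma B_points: "w \<in> B \<Longrightarrow> w \<in> points V"
  using openin_subset[OF local_model_open[OF c]] by auto

lemma chart_preimage_open: "open_Cn n W \<Longrightarrow> openin (Top V) {y\<in>B. coord c y \<in> W}"
proof -
  assume "open_Cn n W"
  then obtain T where T: "open T" "W = Cn n \<inter> T" by (auto simp: openin_open)
  have "openin (top_of_set (cimage c)) (cimage c \<inter> T)" using T by (auto simp: openin_open)
  from local_model_open_preimage[OF c this]
  have "openin (Top V) {y\<in>B. coord c y \<in> cimage c \<inter> T}" .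
  moreover have "{y\<in>B. coord c y \<in> cimage c \<inter> T} = {y\<in>B. coord c y \<in> W}"
    using T coord_in[OF c] local_model_image_subset[OF c] by auto
  ultimately show ?thesis by simp
qed

text \<open>
  Holomorphy on the local model means local extension to the ambient space, so near \<open>v\<close> the function \<open>f\<close> is
  a holomorphic function of the coordinates of the local model.
\<close>

lemma ambient_extension:
  assumes N: "openin (Top V) N" "f \<in> hol_fns V N" and v: "v \<in> N" "v \<in> B"
  shows "\<exists>W F N'. holomorphic_Cn n W F \<and> openin (Top V) N' \<and> v \<in> N' \<and> N' \<subseteq> N \<inter> B \<and>
     (\<forall>y\<in>N'. coord c y \<in> W \<and> F (coord c y) = f y)"
proof -
  have NB: "openin (Top V) (N \<inter> B)" using N local_model_open[OF c] by blast
  have "f \<in> hol_fns V (N \<inter> B)" using sheaf_restrict[OF sheaf N(1) NB _ N(2)] by blast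
  then have "holomorphic_on_set n (coord c ` (N \<inter> B)) (f \<circ> cinv c)"
    using local_model_hol_fns[OF c NB] by blast
  from this[unfolded holomorphic_on_set_def, rule_format, of "coord c v"] v
  obtain W F where W: "coord c v \<in> W" "holomorphic_Cn n W F" "\<forall>w\<in>W \<inter> coord c ` (N \<inter> B). F w = f (cinv c w)"
    by auto
  let ?N = "N \<inter> {y\<in>B. coord c y \<in> W}"
  have "openin (Top V) ?N" using N chart_preimage_open[OF holomorphic_Cn_open[OF W(2)]] by blast
  moreover have "F (coord c y) = f y" if "y \<in> ?N" for y
    using W(3) that cinv_coord[OF c, of y] by force
  ultimately show ?thesis using W v by (intro exI[of _ W] exI[of _ F] exI[of _ ?N]) auto
qed

text \<open>
  The components of \<open>\<kappa> \<gamma>\<^sup>k - \<kappa>(x)\<close> in the chart \<open>d\<close>.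
\<close>

definition hcoord :: "'a chart \<Rightarrow> int \<Rightarrow> nat \<Rightarrow> cvec \<Rightarrow> complex" where
  "hcoord d k j z = coord c (iter k (cinv d z)) j - coord c x j"

definition hdom :: "'a chart \<Rightarrow> int \<Rightarrow> cvec set" where
  "hdom d k = {z\<in>cimage d. iter k (cinv d z) \<in> B}"

text \<open>
  The squared length of the image of \<open>u\<close> under the differential of \<open>\<kappa> \<gamma>\<^sup>k\<close>.
\<close>

definition speed :: "'a chart \<Rightarrow> int \<Rightarrow> cvec \<Rightarrow> cvec \<Rightarrow> real" where
  "speed d k z u = (\<Sum>j<n. (cmod (cdir (cdim d) u (hcoord d k j) z))\<^sup>2)"

lemma speed_nonneg: "speed d k z u \<ge> 0"
  by (simp add: speed_def sum_nonneg)

lemma chart_iter_holomorphic: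
  assumes d: "d \<in> charts M" and N: "openin (Top M) N" "f \<in> hol_fns V N"
  shows "open_Cn (cdim d) {z\<in>cimage d. iter k (cinv d z) \<in> N}"
    and "holomorphic_Cn (cdim d) {z\<in>cimage d. iter k (cinv d z) \<in> N} (\<lambda>z. f (iter k (cinv d z)))"
proof -
  note ld = chartsD(1)[OF d]
  let ?U = "{y\<in>S. iter k y \<in> N} \<inter> cdom d"
  have U: "openin (Top M) {y\<in>S. iter k y \<in> N}" "openin (Top M) ?U"
    using iter_preimage_open[OF N(1)] local_model_open[OF ld] by auto
  have sub: "cdom d \<subseteq> S" using local_model_open[OF ld] openin_M by blast
  have im: "coord d ` ?U = {z\<in>cimage d. iter k (cinv d z) \<in> N}"
  proof (intro equalityI subsetI)
    fix z assume z: "z \<in> {z\<in>cimage d. iter k (cinv d z) \<in> N}"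
    then have "cinv d z \<in> ?U" "z = coord d (cinv d z)" using sub cinv_in[OF ld] coord_cinv[OF ld] by auto
    then show "z \<in> coord d ` ?U" by blast
  qed (use cinv_coord[OF ld] in \<open>auto simp: cimage_def\<close>)
  show "open_Cn (cdim d) {z\<in>cimage d. iter k (cinv d z) \<in> N}"
    using chart_open_image[OF d U(2)] unfolding im by blast
  have "(\<lambda>y. f (iter k y)) \<in> hol_fns M {y\<in>S. iter k y \<in> N}" using iter_hol_fns[OF N] by simp
  then have "(\<lambda>y. f (iter k y)) \<in> hol_fns M ?U" using sheaf_restrict[OF sheaf_M U] by blast
  then show "holomorphic_Cn (cdim d) {z\<in>cimage d. iter k (cinv d z) \<in> N} (\<lambda>z. f (iter k (cinv d z)))"
    using chart_hol_fns[OF d U(2)] im by auto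
qed

lemma cinv_S: assumes "d \<in> charts M" "z \<in> cimage d" shows "cinv d z \<in> S"
proof -
  have "cdom d \<subseteq> S" using local_model_open[OF chartsD(1)[OF assms(1)]] openin_M by blast
  then show ?thesis using cinv_in[OF chartsD(1)[OF assms(1)] assms(2)] by blast
qed

lemma hcoord_holomorphic:
  assumes d: "d \<in> charts M"
  shows "open_Cn (cdim d) (hdom d k)"
    and "holomorphic_Cn (cdim d) (hdom d k) (\<lambda>z. coord c (iter k (cinv d z)) j)"
    and "holomorphic_Cn (cdim d) (hdom d k) (hcoord d k j)"
proof -
  have BS: "openin (Top M) (B \<inter> S)" using local_model_open[OF c] open_S openin_M by blast
  have "openin (Top V) (B \<inter> S)" using BS openin_M by blast
  from sheaf_restrict[OF sheaf local_model_open[OF c] this _ local_model_coord_holomorphic[OF c]]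
  have "(\<lambda>y. coord c y j) \<in> hol_fns V (B \<inter> S)" by simp
  note * = chart_iter_holomorphic[OF d BS this, of k]
  have "{z\<in>cimage d. iter k (cinv d z) \<in> B \<inter> S} = hdom d k"
    using cinv_S[OF d] iter_S by (auto simp: hdom_def)
  then show o: "open_Cn (cdim d) (hdom d k)" and h: "holomorphic_Cn (cdim d) (hdom d k) (\<lambda>z. coord c (iter k (cinv d z)) j)"
    using * by auto
  from holomorphic_Cn_add[OF h holomorphic_Cn_const[OF o, of "- coord c x j"]]
  show "holomorphic_Cn (cdim d) (hdom d k) (hcoord d k j)" by (simp add: hcoord_def[abs_def])
qed

text \<open>
  With \<open>f = F(\<kappa>)\<close> as in \<open>ambient_extension\<close>, this is the chain rule followed by the Cauchy-Schwarz inequality;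
  \<open>C\<close> bounds the squared gradient of \<open>F\<close>. The bound is uniform in the chart and in the power of \<open>\<gamma>\<close> that leads
  into the neighbourhood.
\<close>

lemma derivative_bound_near:
  assumes N: "openin (Top V) N" "f \<in> hol_fns V N" and v: "v \<in> N" "v \<in> B"
  shows "\<exists>N' C. openin (Top V) N' \<and> v \<in> N' \<and> N' \<subseteq> N \<inter> B \<and> (\<forall>d\<in>charts M. \<forall>z\<in>cimage d. \<forall>u\<in>Cn (cdim d). \<forall>k.
     iter k (cinv d z) \<in> N' \<longrightarrow> (cmod (cdir (cdim d) u (\<lambda>z. f (iter k (cinv d z))) z))\<^sup>2 \<le> C * speed d k z u)"
proof -
  obtain W F N1 where W: "holomorphic_Cn n W F" and N1: "openin (Top V) N1" "v \<in> N1" "N1 \<subseteq> N \<inter> B"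
    and F: "\<And>y. y \<in> N1 \<Longrightarrow> coord c y \<in> W \<and> F (coord c y) = f y"
    using ambient_extension[OF N v] by blast
  define G where "G w = (\<Sum>j<n. (cmod (pd j F w))\<^sup>2)" for w
  define C where "C = G (coord c v) + 1"
  have Wo: "open_Cn n W" using holomorphic_Cn_open[OF W] .
  have "continuous_on W G"
    unfolding G_def by (intro continuous_on_sum continuous_on_power continuous_on_norm continuous_pd[OF W]) auto
  then have "openin (top_of_set W) (W \<inter> G -` {..<C})" by (intro continuous_openin_preimage_gen) auto
  then have W'o: "open_Cn n (W \<inter> G -` {..<C})" using openin_trans Wo by blast
  define N' where "N' = N1 \<inter> {y\<in>B. coord c y \<in> W \<inter> G -` {..<C}}"
  have N': "openin (Top V) N'" "v \<in> N'" "N' \<subseteq> N1"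
    using N1 chart_preimage_open[OF W'o] v F by (auto simp: N'_def C_def)
  have "(cmod (cdir (cdim d) u (\<lambda>z. f (iter k (cinv d z))) z))\<^sup>2 \<le> C * speed d k z u"
    if d: "d \<in> charts M" and z: "z \<in> cimage d" and u: "u \<in> Cn (cdim d)" and k: "iter k (cinv d z) \<in> N'" for d z u k
  proof -
    let ?\<Phi> = "\<lambda>z. coord c (iter k (cinv d z))"
    let ?m = "cdim d"
    have NS: "openin (Top M) (N' \<inter> S)" using N'(1) open_S openin_M by blast
    have "f \<in> hol_fns V (N' \<inter> S)"
      using sheaf_restrict[OF sheaf N(1) _ _ N(2), of "N' \<inter> S"] NS openin_M N'(3) N1(3) by blast
    define D where "D = {z\<in>cimage d. iter k (cinv d z) \<in> N' \<inter> S}"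
    have Do: "open_Cn ?m D" unfolding D_def
      by (rule chart_iter_holomorphic(1)[OF d NS \<open>f \<in> hol_fns V (N' \<inter> S)\<close>])
    have zD: "z \<in> D" using z k iter_S[OF cinv_S[OF d z]] by (simp add: D_def)
    have Dh: "D \<subseteq> hdom d k" using N'(3) N1(3) by (auto simp: D_def hdom_def)
    have \<Phi>: "holomorphic_to ?m D n W ?\<Phi>"
      unfolding holomorphic_to_def
      using Do Wo F N'(3) holomorphic_Cn_subset[OF hcoord_holomorphic(2)[OF d] Do Dh] by (auto simp: D_def)
    have jac: "jac ?\<Phi> u z j = cdir ?m u (hcoord d k j) z" if "j < n" for j
      using cdir_diff_const[OF hcoord_holomorphic(2)[OF d], of z k u j "coord c x j"] zD Dh that jac_eq[OF \<Phi> zD u]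
      by (auto simp: hcoord_def[abs_def])
    have "cdir ?m u (\<lambda>z. f (iter k (cinv d z))) z = cdir ?m u (\<lambda>z. F (?\<Phi> z)) z"
      using F N'(3) by (intro cdir_cong[OF Do zD]) (auto simp: D_def)
    also have "\<dots> = cdir n (jac ?\<Phi> u z) F (?\<Phi> z)" by (rule cdir_compose[OF \<Phi> W zD u])
    finally have e: "cdir ?m u (\<lambda>z. f (iter k (cinv d z))) z = (\<Sum>j<n. cdir ?m u (hcoord d k j) z * pd j F (?\<Phi> z))"
      using jac by (simp add: cdir_def[of n])
    have "(cmod (cdir ?m u (\<lambda>z. f (iter k (cinv d z))) z))\<^sup>2
        \<le> (\<Sum>j<n. cmod (pd j F (?\<Phi> z)) * cmod (cdir ?m u (hcoord d k j) z))\<^sup>2"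
      unfolding e by (intro power_mono order_trans[OF norm_sum]) (auto simp: norm_mult mult.commute)
    also have "\<dots> \<le> G (?\<Phi> z) * speed d k z u"
      unfolding G_def speed_def by (rule Cauchy_Schwarz_ineq_sum)
    also have "\<dots> \<le> C * speed d k z u"
      using k speed_nonneg by (intro mult_right_mono) (auto simp: N'_def)
    finally show ?thesis .
  qed
  then show ?thesis using N' N1(3) by (intro exI[of _ N'] exI[of _ C]) blast
qed

text \<open>
  The coordinates of \<open>d\<close> are, after applying \<open>iter (- k)\<close>, holomorphic functions on a neighbourhood of a point
  of the local model. If \<open>speed\<close> vanished, their derivatives along \<open>u\<close> would vanish as well, but these
  are the components of \<open>u\<close>.
\<close>

lemma speed_positive:
  assumes d: "d \<in> charts M" and z: "z \<in> hdom d k" and u: "u \<in> Cn (cdim d)" "u \<noteq> (\<lambda>_. 0)"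
  shows "speed d k z u > 0"
proof (rule ccontr)
  assume "\<not> speed d k z u > 0"
  then have 0: "speed d k z u = 0" using speed_nonneg[of d k z u] by linarith
  note ld = chartsD(1)[OF d]
  have zi: "z \<in> cimage d" "iter k (cinv d z) \<in> B" using z by (auto simp: hdom_def)
  have sub: "cdom d \<subseteq> S" "openin (Top M) (cdom d)" using local_model_open[OF ld] openin_M by blast+
  have No: "openin (Top M) (iter k ` cdom d)" by (rule iter_image_open[OF sub(2)])
  have "u j = 0" if j: "j < cdim d" for j
  proof -
    have "(\<lambda>y. coord d y j) \<in> hol_fns V (cdom d)" using local_model_coord_holomorphic[OF ld, of j] by simp
    from iter_hol_fns[OF sub(2) this, of "- k"]
    have "(\<lambda>y. coord d (iter (- k) y) j) \<in> hol_fns V (iter k ` cdom d)" using iter_image[OF sub(1)] by simp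
    moreover have "openin (Top V) (iter k ` cdom d)" using No openin_M by blast
    moreover have "iter k (cinv d z) \<in> iter k ` cdom d" using cinv_in[OF ld zi(1)] by blast
    ultimately obtain N' C where N': "openin (Top V) N'" "iter k (cinv d z) \<in> N'"
      and bd: "\<forall>d'\<in>charts M. \<forall>z\<in>cimage d'. \<forall>u\<in>Cn (cdim d'). \<forall>k'. iter k' (cinv d' z) \<in> N' \<longrightarrow>
        (cmod (cdir (cdim d') u (\<lambda>z. coord d (iter (- k) (iter k' (cinv d' z))) j) z))\<^sup>2 \<le> C * speed d' k' z u"
      using derivative_bound_near[of "iter k ` cdom d" "\<lambda>y. coord d (iter (- k) y) j" "iter k (cinv d z)"] zi(2) by blast
    have "(cmod (cdir (cdim d) u (\<lambda>z. coord d (iter (- k) (iter k (cinv d z))) j) z))\<^sup>2 \<le> 0"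
      using bd d zi(1) u(1) N'(2) 0 by fastforce
    then have "cdir (cdim d) u (\<lambda>z. coord d (iter (- k) (iter k (cinv d z))) j) z = 0" by simp
    moreover have "cdir (cdim d) u (\<lambda>z. coord d (iter (- k) (iter k (cinv d z))) j) z = cdir (cdim d) u (\<lambda>z. z j) z"
    proof (rule cdir_cong[OF chartsD(2)[OF d] zi(1)])
      fix w assume w: "w \<in> cimage d"
      then show "coord d (iter (- k) (iter k (cinv d w))) j = w j"
        using iter_inverse(1)[of "cinv d w" k] cinv_S[OF d w] coord_cinv[OF ld w] by simp
    qed
    ultimately show ?thesis using cdir_coord[OF j] by simp
  qed
  then have "u j = 0" for j using u(1) by (cases "j < cdim d") (auto simp: Cn_def)
  then have "u = (\<lambda>_. 0)" by blast
  then show False using u(2) by simp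
qed

text \<open>
  The coordinates of the local model composed with \<open>iter (- N)\<close> are holomorphic near \<open>iter N v\<close>, so
  \<open>derivative_bound_near\<close> applies to them with \<open>k + N\<close> in place of \<open>k\<close>; compactness of \<open>K\<close> makes the constant uniform.
\<close>

lemma speed_comparison:
  assumes K: "compactin (Top V) K" "K \<subseteq> B" "x \<notin> K" and N: "iter N ` K \<subseteq> B"
  shows "\<exists>C. \<forall>v\<in>K. \<forall>d\<in>charts M. \<forall>z\<in>cimage d. \<forall>u\<in>Cn (cdim d). \<forall>k.
     iter k (cinv d z) = v \<longrightarrow> speed d k z u \<le> C * speed d (k + N) z u"
proof (rule compactin_uniform_bound[OF K(1)])
  fix v assume v: "v \<in> K"
  have "v \<in> S" using v K B_points by auto
  then have vS: "v \<in> S" "iter N v \<in> S" "iter N v \<in> B" using iter_S[of v N] v N by auto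
  have BS: "openin (Top M) (B \<inter> S)" using local_model_open[OF c] open_S openin_M by blast
  have o: "openin (Top V) (iter N ` (B \<inter> S))" using iter_image_open[OF BS] openin_M by blast
  have "\<exists>N' C. openin (Top V) N' \<and> iter N v \<in> N' \<and> (\<forall>d\<in>charts M. \<forall>z\<in>cimage d. \<forall>u\<in>Cn (cdim d). \<forall>k.
     iter k (cinv d z) \<in> N' \<longrightarrow> (cmod (cdir (cdim d) u (\<lambda>z. coord c (iter (- N) (iter k (cinv d z))) j) z))\<^sup>2 \<le> C * speed d k z u)" for j
  proof -
    have "openin (Top V) (B \<inter> S)" using BS openin_M by blast
    from sheaf_restrict[OF sheaf local_model_open[OF c] this _ local_model_coord_holomorphic[OF c]]
    have "(\<lambda>y. coord c y j) \<in> hol_fns V (B \<inter> S)" by simp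
    from iter_hol_fns[OF BS this, of "- N"]
    have "(\<lambda>y. coord c (iter (- N) y) j) \<in> hol_fns V (iter N ` (B \<inter> S))" using iter_image[of "B \<inter> S"] by simp
    from derivative_bound_near[OF o this, of "iter N v"] v K vS show ?thesis by blast
  qed
  then obtain N' C where N': "\<And>j. openin (Top V) (N' j)" "\<And>j. iter N v \<in> N' j"
    and bd: "\<And>j d z u k. d \<in> charts M \<Longrightarrow> z \<in> cimage d \<Longrightarrow> u \<in> Cn (cdim d) \<Longrightarrow> iter k (cinv d z) \<in> N' j \<Longrightarrow>
       (cmod (cdir (cdim d) u (\<lambda>z. coord c (iter (- N) (iter k (cinv d z))) j) z))\<^sup>2 \<le> C j * speed d k z u"
    by metis
  define U where "U = {y\<in>points V. iter N y \<in> S \<inter> (\<Inter>j\<in>{..<n}. N' j)}"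
  have "openin (Top V) (S \<inter> (\<Inter>j\<in>{..<n}. N' j))"
  proof (cases "n = 0")
    case False
    then have "openin (Top V) (\<Inter>j\<in>{..<n}. N' j)" using N'(1) by (intro openin_Inter) auto
    then show ?thesis using open_S by blast
  qed (simp add: open_S)
  note N'_open = this
  have "continuous_map (Top V) (Top V) (iter N)" using iter_holomorphic[of N] unfolding holomorphic_map_def by blast
  from openin_continuous_map_preimage[OF this N'_open] have "openin (Top V) U" unfolding U_def .
  moreover have "v \<in> U" using vS N'(2) by (auto simp: U_def)
  moreover have "speed d k z u \<le> (\<Sum>j<n. C j) * speed d (k + N) z u"
    if d: "d \<in> charts M" and z: "z \<in> cimage d" and u: "u \<in> Cn (cdim d)" and w: "iter k (cinv d z) \<in> U \<inter> K" for d z u k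
  proof -
    have yS: "cinv d z \<in> S" by (rule cinv_S[OF d z])
    have add: "iter (k + N) y = iter N (iter k y)" "iter (- N) (iter (k + N) y) = iter k y" if "y \<in> S" for y
      using that iter_add[of y N k] iter_add[of y "- N" "k + N"] by (auto simp: add.commute)
    have zh: "z \<in> hdom d k" using z w K(2) by (auto simp: hdom_def)
    have "(cmod (cdir (cdim d) u (hcoord d k j) z))\<^sup>2 \<le> C j * speed d (k + N) z u" if j: "j < n" for j
    proof -
      have "cdir (cdim d) u (hcoord d k j) z = cdir (cdim d) u (\<lambda>z. coord c (iter k (cinv d z)) j) z"
        using cdir_diff_const[OF hcoord_holomorphic(2)[OF d] zh] by (simp add: hcoord_def[abs_def])
      also have "\<dots> = cdir (cdim d) u (\<lambda>z. coord c (iter (- N) (iter (k + N) (cinv d z))) j) z"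
        using add(2) cinv_S[OF d] by (intro cdir_cong[OF chartsD(2)[OF d] z]) auto
      finally show ?thesis using bd[OF d z u, of "k + N" j] add(1)[OF yS] w j by (auto simp: U_def)
    qed
    then show ?thesis
      unfolding speed_def[of d k] sum_distrib_right by (intro sum_mono) auto
  qed
  ultimately show "\<exists>U C. openin (Top V) U \<and> v \<in> U \<and> (\<forall>w\<in>U \<inter> K. \<forall>d\<in>charts M. \<forall>z\<in>cimage d. \<forall>u\<in>Cn (cdim d). \<forall>k.
     iter k (cinv d z) = w \<longrightarrow> speed d k z u \<le> C * speed d (k + N) z u)"
    by (intro exI[of _ U] exI[of _ "\<Sum>j<n. C j"]) auto
next
  fix w and C C' :: real
  assume "\<forall>d\<in>charts M. \<forall>z\<in>cimage d. \<forall>u\<in>Cn (cdim d). \<forall>k. iter k (cinv d z) = w \<longrightarrow> speed d k z u \<le> C * speed d (k + N) z u"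
    and "C \<le> C'"
  note C = this
  show "\<forall>d\<in>charts M. \<forall>z\<in>cimage d. \<forall>u\<in>Cn (cdim d). \<forall>k. iter k (cinv d z) = w \<longrightarrow> speed d k z u \<le> C' * speed d (k + N) z u"
  proof (intro ballI allI impI)
    fix d z u k assume "d \<in> charts M" "z \<in> cimage d" "u \<in> Cn (cdim d)" "iter k (cinv d z) = w"
    then have "speed d k z u \<le> C * speed d (k + N) z u" using C(1) by simp
    also have "\<dots> \<le> C' * speed d (k + N) z u" by (rule mult_right_mono[OF C(2) speed_nonneg])
    finally show "speed d k z u \<le> C' * speed d (k + N) z u" .
  qed
qed

subsection \<open>The building block\<close>

definition block :: "real \<Rightarrow> 'a \<Rightarrow> real" where
  "block \<epsilon> w = (if w \<in> B then bump \<epsilon> r 1 1 (\<phi> w) else 0)"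

definition term_levi :: "real \<Rightarrow> 'a chart \<Rightarrow> int \<Rightarrow> cvec \<Rightarrow> cvec \<Rightarrow> real" where
  "term_levi \<epsilon> d k z u = levi (\<lambda>z. block \<epsilon> (iter k (cinv d z))) z u"

lemma block_nonneg: "block \<epsilon> w \<ge> 0"
  by (simp add: block_def bump_nonneg)

lemma phi_sum_norms: "\<phi> (iter k (cinv d z)) = sum_norms n (hcoord d k) z"
  by (simp add: chart_norm_def sum_norms_def hcoord_def)

lemma block_outside:
  assumes d: "d \<in> charts M"
  shows "open_Cn (cdim d) {z\<in>cimage d. iter k (cinv d z) \<notin> {w\<in>B. \<phi> w \<le> r}}"
    and "w \<notin> {w\<in>B. \<phi> w \<le> r} \<Longrightarrow> block \<epsilon> w = 0"
proof -
  have "closedin (Top V) {w\<in>B. \<phi> w \<le> r}" using compactin_imp_closedin[OF Hausdorff compact_r] .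
  from openin_diff[OF openin_topspace this]
  have o: "openin (Top M) (S \<inter> (points V - {w\<in>B. \<phi> w \<le> r}))" using open_S openin_M by blast
  have "{z\<in>cimage d. iter k (cinv d z) \<in> S \<inter> (points V - {w\<in>B. \<phi> w \<le> r})} = {z\<in>cimage d. iter k (cinv d z) \<notin> {w\<in>B. \<phi> w \<le> r}}"
    using iter_S[OF cinv_S[OF d]] by auto
  moreover have "open_Cn (cdim d) (coord d ` ({y\<in>S. iter k y \<in> S \<inter> (points V - {w\<in>B. \<phi> w \<le> r})} \<inter> cdom d))"
    using iter_preimage_open[OF o] local_model_open[OF chartsD(1)[OF d]]
    by (intro chart_open_image[OF d]) auto
  moreover have "coord d ` ({y\<in>S. iter k y \<in> N} \<inter> cdom d) = {z\<in>cimage d. iter k (cinv d z) \<in> N}" for N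
  proof (intro equalityI subsetI)
    fix z assume z: "z \<in> {z\<in>cimage d. iter k (cinv d z) \<in> N}"
    then have "cinv d z \<in> {y\<in>S. iter k y \<in> N} \<inter> cdom d" "z = coord d (cinv d z)"
      using cinv_S[OF d] cinv_in[OF chartsD(1)[OF d]] coord_cinv[OF chartsD(1)[OF d]] by auto
    then show "z \<in> coord d ` ({y\<in>S. iter k y \<in> N} \<inter> cdom d)" by blast
  qed (use cinv_coord[OF chartsD(1)[OF d]] in \<open>auto simp: cimage_def\<close>)
  ultimately show "open_Cn (cdim d) {z\<in>cimage d. iter k (cinv d z) \<notin> {w\<in>B. \<phi> w \<le> r}}" by (simp only:)
  show "w \<notin> {w\<in>B. \<phi> w \<le> r} \<Longrightarrow> block \<epsilon> w = 0"
    using bump_zero(1)[OF r, of "\<phi> w" \<epsilon>] by (auto simp: block_def)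
qed

text \<open>
  The two descriptions agree where both apply: inside the local model the bump vanishes as soon as \<open>\<phi> > r\<close>.
\<close>

lemma block_smooth:
  assumes d: "d \<in> charts M"
  shows "gen_smooth (cdim d) (cimage d) (\<lambda>z. block \<epsilon> (iter k (cinv d z)))"
proof (rule gen_smooth.local[OF chartsD(2)[OF d]])
  fix z assume z: "z \<in> cimage d"
  show "\<exists>W g. z \<in> W \<and> W \<subseteq> cimage d \<and> gen_smooth (cdim d) W g \<and> (\<forall>w\<in>W. g w = block \<epsilon> (iter k (cinv d w)))"
  proof (cases "z \<in> hdom d k")
    case True
    have "gen_smooth (cdim d) (hdom d k) (sum_norms n (hcoord d k))"
      by (rule sum_norms_derivs(1)[where u = "\<lambda>_. 0", OF hcoord_holomorphic(1,3)[OF d] True]) (simp add: Cn_def)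
    from gen_smooth_bump(1)[OF this] True show ?thesis
      by (intro exI[of _ "hdom d k"] exI[of _ "\<lambda>z. bump \<epsilon> r 1 1 (sum_norms n (hcoord d k) z)"])
         (auto simp: hdom_def block_def phi_sum_norms)
  next
    case False
    let ?W = "{z\<in>cimage d. iter k (cinv d z) \<notin> {w\<in>B. \<phi> w \<le> r}}"
    have "gen_smooth (cdim d) ?W (\<lambda>z. 0)" by (rule gen_smooth_const[OF block_outside(1)[OF d]])
    moreover have "z \<in> ?W" using False z by (auto simp: hdom_def)
    ultimately show ?thesis
      using block_outside(2)[OF d] by (intro exI[of _ ?W] exI[of _ "\<lambda>z. 0"]) auto
  qed
qed

lemma term_levi_outside:
  assumes d: "d \<in> charts M" and z: "z \<in> cimage d" and u: "u \<in> Cn (cdim d)"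
    and out: "iter k (cinv d z) \<notin> {w\<in>B. \<phi> w \<le> r}"
  shows "term_levi \<epsilon> d k z u = 0"
proof -
  have "term_levi \<epsilon> d k z u = levi (\<lambda>z. 0) z u"
    unfolding term_levi_def
    by (rule levi_cong[OF block_outside(1)[OF d, of k] _ _ u]) (use z out block_outside(2)[OF d] in auto)
  then show ?thesis by (simp add: levi_const)
qed

lemma term_levi_inside:
  assumes d: "d \<in> charts M" and z: "z \<in> hdom d k" and u: "u \<in> Cn (cdim d)"
  obtains Q where "0 \<le> Q" "Q \<le> 4 * \<phi> (iter k (cinv d z)) * speed d k z u"
    "term_levi \<epsilon> d k z u = bump' \<epsilon> r 1 1 (\<phi> (iter k (cinv d z))) * (4 * speed d k z u) + bump'' \<epsilon> r 1 1 (\<phi> (iter k (cinv d z))) * Q"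
proof -
  note o = hcoord_holomorphic(1)[OF d, of k]
  let ?s = "sum_norms n (hcoord d k)"
  have hh: "\<And>j. j < n \<Longrightarrow> holomorphic_Cn (cdim d) (hdom d k) (hcoord d k j)" using hcoord_holomorphic(3)[OF d] .
  note sn = sum_norms_derivs[where N = n and h = "hcoord d k", OF o hh z u]
  have L: "levi ?s z u = 4 * speed d k z u" using sn(2) by (simp add: speed_def)
  let ?Q = "(dir_deriv u ?s z)\<^sup>2 + (dir_deriv (iscale u) ?s z)\<^sup>2"
  have "term_levi \<epsilon> d k z u = levi (\<lambda>z. bump \<epsilon> r 1 1 (?s z)) z u"
    unfolding term_levi_def
    by (rule levi_cong[OF o z _ u]) (auto simp: hdom_def block_def phi_sum_norms)
  also have "\<dots> = bump' \<epsilon> r 1 1 (?s z) * levi ?s z u + bump'' \<epsilon> r 1 1 (?s z) * ?Q"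
    by (rule levi_comp[OF sn(1) z u gen_smooth_bump[OF sn(1)] bump_has_derivative bump'_has_derivative])
  finally show ?thesis
    using that[of ?Q] sn(3) L by (simp add: phi_sum_norms)
qed

subsection \<open>Summing over the group\<close>

definition shell :: "real \<Rightarrow> 'a set" where
  "shell \<epsilon> = {w\<in>B. \<epsilon> \<le> \<phi> w \<and> \<phi> w \<le> r}"

lemma compactin_shell: "compactin (Top V) (shell \<epsilon>)"
proof -
  have "openin (Top V) {w\<in>B. \<phi> w \<in> {..<\<epsilon>}}" by (rule chart_norm_open[OF c]) simp
  then have "closedin (Top V) (points V - {w\<in>B. \<phi> w \<in> {..<\<epsilon>}})" by blast
  from closedin_Int[OF compactin_imp_closedin[OF Hausdorff compact_r] this]
  have "closedin (Top V) ({w\<in>B. \<phi> w \<le> r} \<inter> (points V - {w\<in>B. \<phi> w \<in> {..<\<epsilon>}}))" .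
  moreover have "{w\<in>B. \<phi> w \<le> r} \<inter> (points V - {w\<in>B. \<phi> w \<in> {..<\<epsilon>}}) = shell \<epsilon>"
    using B_points by (auto simp: shell_def)
  ultimately show ?thesis using closed_compactin[OF compact_r, of "shell \<epsilon>"] by (auto simp: shell_def)
qed

lemma phi_eq_0: "w \<in> B \<Longrightarrow> \<phi> w = 0 \<longleftrightarrow> w = x"
  by (rule chart_norm_eq_0[OF c xc])

lemma x_notin_shell: "\<epsilon> > 0 \<Longrightarrow> x \<notin> shell \<epsilon>"
  using phi_eq_0[OF xc] by (auto simp: shell_def)

lemma block_support: "block \<epsilon> w \<noteq> 0 \<Longrightarrow> w \<in> shell \<epsilon>"
  using bump_zero(1)[OF r, of "\<phi> w" \<epsilon> 1 1]
  by (cases "\<phi> w \<le> \<epsilon> \<or> r \<le> \<phi> w") (auto simp: block_def shell_def split: if_splits)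

text \<open>
  The index set is finite for every point of the punctured variety, by \<open>potential_local\<close>.
\<close>

definition potential :: "real \<Rightarrow> real \<Rightarrow> 'a \<Rightarrow> real" where
  "potential \<epsilon> \<Lambda> y = (\<Sum>k | block \<epsilon> (iter k y) \<noteq> 0. \<Lambda> powi k * block \<epsilon> (iter k y))"

text \<open>
  Near \<open>y\<close> the indices that contribute lie in one finite set, since the compact set \<open>K \<union> shell \<epsilon>\<close> is
  wandering.
\<close>

lemma potential_local:
  assumes \<epsilon>: "\<epsilon> > 0" and y: "y \<in> S"
  obtains U N where "openin (Top M) U" "y \<in> U" "\<And>w k. w \<in> U \<Longrightarrow> iter k w \<in> shell \<epsilon> \<Longrightarrow> \<bar>k\<bar> \<le> N"
    "\<And>w J \<Lambda>. w \<in> U \<Longrightarrow> finite J \<Longrightarrow> {- N..N} \<subseteq> J \<Longrightarrow>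
       potential \<epsilon> \<Lambda> w = (\<Sum>k\<in>J. \<Lambda> powi k * block \<epsilon> (iter k w))"
proof -
  obtain U K where U: "openin (Top M) U" "y \<in> U" "U \<subseteq> K" "compactin (Top V) K" "x \<notin> K"
    using M_compact_nbhd[OF y] .
  have "compactin (Top V) (K \<union> shell \<epsilon>)" using compactin_Un[OF U(4) compactin_shell] .
  moreover have "x \<notin> K \<union> shell \<epsilon>" using U(5) x_notin_shell[OF \<epsilon>] by blast
  ultimately obtain N where N: "\<And>k. \<bar>k\<bar> > N \<Longrightarrow> iter k ` (K \<union> shell \<epsilon>) \<inter> (K \<union> shell \<epsilon>) = {}"
    using iter_wandering by blast
  have 1: "\<bar>k\<bar> \<le> N" if w: "w \<in> U" "iter k w \<in> shell \<epsilon>" for w k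
  proof (rule ccontr)
    assume "\<not> \<bar>k\<bar> \<le> N"
    then have "iter k ` (K \<union> shell \<epsilon>) \<inter> (K \<union> shell \<epsilon>) = {}" using N by simp
    moreover have "w \<in> K" using w(1) U(3) by blast
    ultimately show False using w(2) by blast
  qed
  have 2: "potential \<epsilon> \<Lambda> w = (\<Sum>k\<in>J. \<Lambda> powi k * block \<epsilon> (iter k w))"
    if w: "w \<in> U" and J: "finite J" "{- N..N} \<subseteq> J" for w J \<Lambda>
    unfolding potential_def
  proof (rule sum.mono_neutral_left[OF J(1)])
    have "k \<in> {- N..N}" if "block \<epsilon> (iter k w) \<noteq> 0" for k
      using 1[OF w block_support[OF that]] by auto
    then show "{k. block \<epsilon> (iter k w) \<noteq> 0} \<subseteq> J" using J(2) by blast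
  qed auto
  show ?thesis by (rule that[OF U(1,2) 1 2])
qed

lemma potential_automorphic:
  assumes "y \<in> S" "\<Lambda> > 0"
  shows "potential \<epsilon> \<Lambda> (iter j y) = inverse \<Lambda> powi j * potential \<epsilon> \<Lambda> y"
proof -
  have add: "iter k (iter j y) = iter (k + j) y" for k using iter_add[of y k j] assms by simp
  have "potential \<epsilon> \<Lambda> (iter j y) = (\<Sum>k | block \<epsilon> (iter k y) \<noteq> 0. \<Lambda> powi (k - j) * block \<epsilon> (iter k y))"
    unfolding potential_def add
    by (rule sum.reindex_bij_witness[of _ "\<lambda>k. k - j" "\<lambda>k. k + j"]) auto
  also have "\<dots> = (\<Sum>k | block \<epsilon> (iter k y) \<noteq> 0. inverse \<Lambda> powi j * (\<Lambda> powi k * block \<epsilon> (iter k y)))"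
    using assms(2) by (intro sum.cong) (auto simp: power_int_diff power_int_inverse divide_inverse)
  finally show ?thesis by (simp add: potential_def sum_distrib_left)
qed

text \<open>
  The order of the choices matters: \<open>N\<close> depends only on \<open>r\<close>, then \<open>\<epsilon>\<close> is chosen in terms of \<open>N\<close>, then the
  bounds \<open>\<eta>\<close>, \<open>C\<close>, \<open>D\<close> in terms of \<open>\<epsilon>\<close> and \<open>N\<close>, and \<open>\<Lambda>\<close> last. The condition on \<open>iter (- 1)\<close> ensures that an
  orbit which enters the ball of radius \<open>r / 2\<close> meets the part \<open>\<phi> > \<epsilon>\<close> of it.
\<close>

lemma exists_constants:
  obtains \<epsilon> \<Lambda> \<eta> C D :: real and N :: int where "0 < \<epsilon>" "\<epsilon> < r / 2" "\<Lambda> > 0" "N > 0" "\<eta> > 0"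
    "\<forall>w\<in>shell (r / 2). iter N w \<in> B \<and> \<epsilon> < \<phi> (iter N w) \<and> \<phi> (iter N w) < r / 2 \<and> \<eta> < bump' \<epsilon> r 1 1 (\<phi> (iter N w))"
    "\<forall>w\<in>B. \<phi> w \<le> \<epsilon> \<longrightarrow> iter (- 1) w \<in> B \<and> \<phi> (iter (- 1) w) < r / 2"
    "\<forall>d\<in>charts M. \<forall>z\<in>cimage d. \<forall>u\<in>Cn (cdim d). \<forall>k. iter k (cinv d z) \<in> shell (r / 2) \<longrightarrow>
       speed d k z u \<le> C * speed d (k + N) z u"
    "\<forall>t. 0 \<le> t \<longrightarrow> t \<le> r \<longrightarrow> 4 * (\<bar>bump' \<epsilon> r 1 1 t\<bar> + \<bar>bump'' \<epsilon> r 1 1 t\<bar> * r) \<le> D"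
    "C \<ge> 0" "D \<ge> 0" "D * C < \<Lambda> powi N * (4 * \<eta>)"
proof -
  let ?U = "{w\<in>B. \<phi> w \<in> {..<r / 2}}"
  have Uo: "openin (Top V) ?U" by (rule chart_norm_open[OF c]) simp
  have xU: "x \<in> ?U" using xc r phi_eq_0[OF xc] by simp
  note K = compactin_shell[of "r / 2"]
  obtain N0 where N0: "\<And>k. k > N0 \<Longrightarrow> iter k ` shell (r / 2) \<subseteq> ?U" "N0 > 0"
    using iter_shrinks[OF K Uo xU] by blast
  define N where "N = N0 + 1"
  have N: "N > 0" "iter N ` shell (r / 2) \<subseteq> ?U" using N0 by (auto simp: N_def)
  have cmap: "continuous_map (subtopology (Top V) (shell (r / 2))) (subtopology (Top V) B) (iter N)"
  proof -
    have "continuous_map (Top V) (Top V) (iter N)" using iter_holomorphic by (auto simp: holomorphic_map_def)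
    then have "continuous_map (subtopology (Top V) (shell (r / 2))) (Top V) (iter N)"
      by (rule continuous_map_from_subtopology)
    then show ?thesis using N(2) by (auto simp: continuous_map_in_subtopology)
  qed
  have cphi: "continuous_map (subtopology (Top V) (shell (r / 2))) euclideanreal (\<lambda>w. \<phi> (iter N w))"
    using continuous_map_compose[OF cmap chart_norm_continuous[OF c, of x]] by (simp add: o_def)
  have pos: "\<phi> (iter N w) > 0" if w: "w \<in> shell (r / 2)" for w
  proof -
    have "w \<noteq> x" using x_notin_shell[of "r / 2"] r w by auto
    then have "iter N w \<noteq> x" using iter_S[of w N] B_points w by (auto simp: shell_def)
    moreover have "iter N w \<in> B" using N(2) w by blast
    ultimately show ?thesis using phi_eq_0 chart_norm_nonneg[of c x "iter N w"] by force
  qed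
  obtain \<epsilon>1 where \<epsilon>1: "\<epsilon>1 > 0" "\<And>w. w \<in> shell (r / 2) \<Longrightarrow> \<epsilon>1 < \<phi> (iter N w)"
    using compactin_positive_lower_bound[OF K cphi pos] by blast
  let ?O = "{w\<in>points V. iter (- 1) w \<in> ?U}"
  have Oo: "openin (Top V) ?O"
    using iter_holomorphic[of "- 1"] Uo by (intro openin_continuous_map_preimage) (auto simp: holomorphic_map_def)
  have xO: "x \<in> ?O" using x xU by simp
  let ?L = "{w\<in>B. \<phi> w \<le> r} - ?O"
  have "closedin (Top V) (points V - ?O)" using Oo by blast
  from closedin_Int[OF compactin_imp_closedin[OF Hausdorff compact_r] this]
  have "closedin (Top V) ({w\<in>B. \<phi> w \<le> r} \<inter> (points V - ?O))" .
  moreover have "{w\<in>B. \<phi> w \<le> r} \<inter> (points V - ?O) = ?L" using B_points by blast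
  ultimately have L: "compactin (Top V) ?L" using closed_compactin[OF compact_r, of ?L] by auto
  have "continuous_map (subtopology (Top V) ?L) euclideanreal \<phi>"
    using continuous_map_from_subtopology_mono[OF chart_norm_continuous[OF c, of x], of ?L] by blast
  moreover have "\<phi> w > 0" if "w \<in> ?L" for w
  proof -
    have "w \<noteq> x" "w \<in> B" using that xO by auto
    then show ?thesis using phi_eq_0[of w] chart_norm_nonneg[of c x w] by simp
  qed
  ultimately obtain \<epsilon>2 where \<epsilon>2: "\<epsilon>2 > 0" "\<And>w. w \<in> ?L \<Longrightarrow> \<epsilon>2 < \<phi> w"
    using compactin_positive_lower_bound[OF L] by blast
  define \<epsilon> where "\<epsilon> = min (min \<epsilon>1 \<epsilon>2) (r / 4)"
  have \<epsilon>: "0 < \<epsilon>" "\<epsilon> < r / 2" "\<epsilon> \<le> \<epsilon>1" "\<epsilon> \<le> \<epsilon>2" "\<epsilon> \<le> r" using \<epsilon>1 \<epsilon>2 r by (auto simp: \<epsilon>_def)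
  have backward: "iter (- 1) w \<in> B \<and> \<phi> (iter (- 1) w) < r / 2" if "w \<in> B" "\<phi> w \<le> \<epsilon>" for w
  proof -
    have "w \<notin> ?L" using \<epsilon>2(2)[of w] that \<epsilon> by fastforce
    then show ?thesis using that \<epsilon> by auto
  qed
  have in': "iter N w \<in> B \<and> \<epsilon> < \<phi> (iter N w) \<and> \<phi> (iter N w) < r / 2" if "w \<in> shell (r / 2)" for w
    using N(2) \<epsilon>1(2)[OF that] that \<epsilon>(3) by auto
  have "continuous_map (subtopology (Top V) (shell (r / 2))) euclideanreal (bump' \<epsilon> r 1 1 \<circ> (\<lambda>w. \<phi> (iter N w)))"
    using continuous_on_bump(2)[of UNIV] by (intro continuous_map_compose[OF cphi]) simp
  moreover have "(bump' \<epsilon> r 1 1 \<circ> (\<lambda>w. \<phi> (iter N w))) w > 0" if "w \<in> shell (r / 2)" for w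
    using bump_convex_part(2)[OF \<epsilon>(1), of "\<phi> (iter N w)" r] in'[OF that] by simp
  ultimately obtain \<eta> where \<eta>: "\<eta> > 0" "\<And>w. w \<in> shell (r / 2) \<Longrightarrow> \<eta> < (bump' \<epsilon> r 1 1 \<circ> (\<lambda>w. \<phi> (iter N w))) w"
    using compactin_positive_lower_bound[OF K] by blast
  have sh: "shell (r / 2) \<subseteq> B" "x \<notin> shell (r / 2)" "iter N ` shell (r / 2) \<subseteq> B"
    using x_notin_shell r N(2) by (auto simp: shell_def)
  obtain C0 where C0': "\<forall>v\<in>shell (r / 2). \<forall>d\<in>charts M. \<forall>z\<in>cimage d. \<forall>u\<in>Cn (cdim d). \<forall>k.
     iter k (cinv d z) = v \<longrightarrow> speed d k z u \<le> C0 * speed d (k + N) z u"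
    using speed_comparison[OF K sh] by (elim exE)
  have C0: "speed d k z u \<le> C0 * speed d (k + N) z u"
    if "d \<in> charts M" "z \<in> cimage d" "u \<in> Cn (cdim d)" "iter k (cinv d z) \<in> shell (r / 2)" for d z u k
    using C0'[rule_format, OF that(4,1-3) refl] .
  define C where "C = max 0 C0"
  have C: "speed d k z u \<le> C * speed d (k + N) z u"
    if "d \<in> charts M" "z \<in> cimage d" "u \<in> Cn (cdim d)" "iter k (cinv d z) \<in> shell (r / 2)" for d z u k
    using C0[OF that] mult_right_mono[OF _ speed_nonneg, of C0 C d "k + N" z u] by (simp add: C_def)
  have "compact ((\<lambda>t. 4 * (\<bar>bump' \<epsilon> r 1 1 t\<bar> + \<bar>bump'' \<epsilon> r 1 1 t\<bar> * r)) ` {0..r})"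
    using continuous_on_bump(2,3) by (intro compact_continuous_image continuous_intros) auto
  then have "bounded ((\<lambda>t. 4 * (\<bar>bump' \<epsilon> r 1 1 t\<bar> + \<bar>bump'' \<epsilon> r 1 1 t\<bar> * r)) ` {0..r})"
    by (rule compact_imp_bounded)
  then obtain D0 where D0: "\<forall>t\<in>{0..r}. \<bar>4 * (\<bar>bump' \<epsilon> r 1 1 t\<bar> + \<bar>bump'' \<epsilon> r 1 1 t\<bar> * r)\<bar> \<le> D0"
    unfolding bounded_iff by auto
  define D where "D = max 0 D0"
  have D: "4 * (\<bar>bump' \<epsilon> r 1 1 t\<bar> + \<bar>bump'' \<epsilon> r 1 1 t\<bar> * r) \<le> D" if "0 \<le> t" "t \<le> r" for t
    using D0 that unfolding D_def by (metis abs_le_D1 atLeastAtMost_iff max.coboundedI2)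
  define \<Lambda> where "\<Lambda> = 1 + D * C / (4 * \<eta>)"
  have \<Lambda>: "\<Lambda> \<ge> 1" using \<eta>(1) by (simp add: \<Lambda>_def C_def D_def)
  have "D * C < \<Lambda> * (4 * \<eta>)" using \<eta>(1) by (simp add: \<Lambda>_def field_simps)
  also have "\<dots> \<le> \<Lambda> powi N * (4 * \<eta>)"
  proof -
    have "\<Lambda> ^ 1 \<le> \<Lambda> ^ nat N" using N(1) \<Lambda> by (intro power_increasing) auto
    then show ?thesis using N(1) \<eta>(1) by (simp add: power_int_def)
  qed
  finally have fin: "D * C < \<Lambda> powi N * (4 * \<eta>)" .
  show ?thesis
  proof (rule that[of \<epsilon> \<Lambda> N \<eta> C D])
    show "C \<ge> 0" "D \<ge> 0" by (simp_all add: C_def D_def)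
  qed (use \<epsilon> \<Lambda> N \<eta> in' backward C D fin in \<open>simp_all\<close>)
qed

text \<open>
  Positive definiteness is the compensation argument described at the beginning: indices in \<open>Bad\<close> are those
  whose argument lies in the outer shell, and each of them is paired with its translate by \<open>N\<close>, which
  is not in \<open>Bad\<close>. If \<open>Bad\<close> is empty, a term of index given by \<open>crossing\<close> is strictly positive.
\<close>

lemma exists_automorphic_potential:
  "\<exists>\<psi> \<mu>. \<mu> > 0 \<and> strictly_psh M \<psi> \<and> (\<forall>y\<in>S. \<psi> y > 0) \<and> (\<forall>k. \<forall>y\<in>S. \<psi> (iter k y) = \<mu> powi k * \<psi> y)"
proof -
  obtain \<epsilon> \<Lambda> \<eta> C D :: real and N :: int where \<epsilon>: "0 < \<epsilon>" "\<epsilon> < r / 2" and \<Lambda>: "\<Lambda> > 0" and N: "N > 0" and \<eta>: "\<eta> > 0"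
    and good': "\<forall>w\<in>shell (r / 2). iter N w \<in> B \<and> \<epsilon> < \<phi> (iter N w) \<and> \<phi> (iter N w) < r / 2 \<and> \<eta> < bump' \<epsilon> r 1 1 (\<phi> (iter N w))"
    and backward': "\<forall>w\<in>B. \<phi> w \<le> \<epsilon> \<longrightarrow> iter (- 1) w \<in> B \<and> \<phi> (iter (- 1) w) < r / 2"
    and C': "\<forall>d\<in>charts M. \<forall>z\<in>cimage d. \<forall>u\<in>Cn (cdim d). \<forall>k. iter k (cinv d z) \<in> shell (r / 2) \<longrightarrow>
       speed d k z u \<le> C * speed d (k + N) z u"
    and D': "\<forall>t. 0 \<le> t \<longrightarrow> t \<le> r \<longrightarrow> 4 * (\<bar>bump' \<epsilon> r 1 1 t\<bar> + \<bar>bump'' \<epsilon> r 1 1 t\<bar> * r) \<le> D"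
    and CD: "C \<ge> 0" "D \<ge> 0" "D * C < \<Lambda> powi N * (4 * \<eta>)"
    using exists_constants .
  note good = good'[rule_format] and backward = backward'[rule_format] and C = C'[rule_format] and D = D'[rule_format]
  let ?\<psi> = "potential \<epsilon> \<Lambda>"
  have \<Lambda>k: "\<Lambda> powi k > 0" for k using \<Lambda> by simp
  let ?inner = "\<lambda>w. w \<in> B \<and> \<phi> w < r / 2"
  \<comment> \<open>Forward iterates end up in the inner ball, sufficiently negative ones lie outside the ball; at
     an index where the orbit enters, phi exceeds epsilon by the choice of epsilon.\<close>
  have crossing: "\<exists>k. iter k y \<in> B \<and> \<epsilon> < \<phi> (iter k y) \<and> \<phi> (iter k y) < r / 2" if y: "y \<in> S" for y
  proof -
    have yV: "y \<in> points V" using y by simp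
    have Uo: "openin (Top V) {w\<in>B. \<phi> w \<in> {..<r / 2}}" by (rule chart_norm_open[OF c]) simp
    have xU: "x \<in> {w\<in>B. \<phi> w \<in> {..<r / 2}}" using xc r phi_eq_0[OF xc] by simp
    have "compactin (Top V) {y}" using yV by simp
    then obtain N1 where N1: "\<And>k. k > N1 \<Longrightarrow> iter k ` {y} \<subseteq> {w\<in>B. \<phi> w \<in> {..<r / 2}}" "N1 > 0"
      using iter_shrinks[OF _ Uo xU] by blast
    have "closedin (Top V) {y}" using closedin_Hausdorff_singleton[OF Hausdorff yV] .
    from openin_diff[OF openin_topspace this] have "openin (Top V) (points V - {y})" .
    moreover have "x \<in> points V - {y}" using x y by auto
    ultimately obtain N2 where N2: "\<And>k. k > N2 \<Longrightarrow> iter k ` {w\<in>B. \<phi> w \<le> r} \<subseteq> points V - {y}" "N2 > 0"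
      using iter_shrinks[OF compact_r] by blast
    have "\<not> ?inner (iter (- (N2 + 1)) y)"
    proof
      assume a: "?inner (iter (- (N2 + 1)) y)"
      then have "iter (- (N2 + 1)) y \<in> {w\<in>B. \<phi> w \<le> r}" using r by simp
      moreover have "iter (N2 + 1) ` {w\<in>B. \<phi> w \<le> r} \<subseteq> points V - {y}" by (rule N2(1)) simp
      ultimately have "iter (N2 + 1) (iter (- (N2 + 1)) y) \<in> points V - {y}" by blast
      then show False using iter_inverse(2)[OF yV, of "N2 + 1"] by simp
    qed
    moreover have "?inner (iter (N1 + 1) y)" using N1(1)[of "N1 + 1"] by simp
    ultimately obtain k where k: "?inner (iter k y)" "\<not> ?inner (iter (k - 1) y)"
      using discrete_crossing[of "\<lambda>k. ?inner (iter k y)" "N1 + 1" "- (N2 + 1)"] N1(2) N2(2) by auto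
    have "\<epsilon> < \<phi> (iter k y)"
    proof (rule ccontr)
      assume "\<not> ?thesis"
      then have "?inner (iter (- 1) (iter k y))" using backward k(1) by simp
      then show False using k(2) iter_add[OF yV, of "- 1" k] by simp
    qed
    then show ?thesis using k(1) by blast
  qed
  have pos: "?\<psi> y > 0" if y: "y \<in> S" for y
  proof -
    obtain k where k: "iter k y \<in> B" "\<epsilon> < \<phi> (iter k y)" "\<phi> (iter k y) < r / 2" using crossing[OF y] by blast
    obtain U N where "openin (Top M) U" and U1: "y \<in> U" and "\<And>w k. w \<in> U \<Longrightarrow> iter k w \<in> shell \<epsilon> \<Longrightarrow> \<bar>k\<bar> \<le> N"
      and U2: "\<And>w J \<Lambda>. w \<in> U \<Longrightarrow> finite J \<Longrightarrow> {- N..N} \<subseteq> J \<Longrightarrow>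
       potential \<epsilon> \<Lambda> w = (\<Sum>k\<in>J. \<Lambda> powi k * block \<epsilon> (iter k w))"
      by (rule potential_local[OF \<epsilon>(1) y]) (rule that; assumption)
    have "block \<epsilon> (iter k y) > 0" using k bump_convex_part(1)[OF \<epsilon>(1), of "\<phi> (iter k y)" r] by (simp add: block_def)
    then have "0 < (\<Sum>k\<in>insert k {- N..N}. \<Lambda> powi k * block \<epsilon> (iter k y))"
      using \<Lambda>k block_nonneg by (intro sum_pos2[of _ k]) (auto simp: less_imp_le)
    moreover have "?\<psi> y = (\<Sum>k\<in>insert k {- N..N}. \<Lambda> powi k * block \<epsilon> (iter k y))"
      by (rule U2[OF U1]) auto
    ultimately show ?thesis by (simp only:)
  qed
  have chart: "\<exists>W J. open_Cn (cdim d) W \<and> z \<in> W \<and> W \<subseteq> cimage d \<and> finite J \<and>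
      (\<forall>k. iter k (cinv d z) \<in> shell \<epsilon> \<longrightarrow> k \<in> J \<and> k + N \<in> J) \<and>
      (\<forall>w\<in>W. (?\<psi> \<circ> cinv d) w = (\<Sum>k\<in>J. \<Lambda> powi k * block \<epsilon> (iter k (cinv d w))))"
    if d: "d \<in> charts M" and z: "z \<in> cimage d" for d z
  proof -
    note ld = chartsD(1)[OF d]
    obtain U N0 where U: "openin (Top M) U" "cinv d z \<in> U" "\<And>w k. w \<in> U \<Longrightarrow> iter k w \<in> shell \<epsilon> \<Longrightarrow> \<bar>k\<bar> \<le> N0"
      "\<And>w J \<Lambda>. w \<in> U \<Longrightarrow> finite J \<Longrightarrow> {- N0..N0} \<subseteq> J \<Longrightarrow>
       potential \<epsilon> \<Lambda> w = (\<Sum>k\<in>J. \<Lambda> powi k * block \<epsilon> (iter k w))"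
      by (rule potential_local[OF \<epsilon>(1) cinv_S[OF d z]]) (rule that; assumption)
    let ?J = "{- N0 - N..N0 + N}"
    have Uo: "openin (Top M) (U \<inter> cdom d)" using U(1) local_model_open[OF ld] by blast
    have "open_Cn (cdim d) (coord d ` (U \<inter> cdom d))" by (rule chart_open_image[OF d Uo]) auto
    moreover have "z \<in> coord d ` (U \<inter> cdom d)" using U(2) cinv_in[OF ld z] coord_cinv[OF ld z] by force
    moreover have "coord d ` (U \<inter> cdom d) \<subseteq> cimage d" by (auto simp: cimage_def)
    moreover have "\<forall>k. iter k (cinv d z) \<in> shell \<epsilon> \<longrightarrow> k \<in> ?J \<and> k + N \<in> ?J"
      using U(3)[OF U(2)] N by fastforce
    moreover have "\<forall>w\<in>coord d ` (U \<inter> cdom d). (?\<psi> \<circ> cinv d) w = (\<Sum>k\<in>?J. \<Lambda> powi k * block \<epsilon> (iter k (cinv d w)))"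
      using U(4)[of _ ?J \<Lambda>] cinv_coord[OF ld] N by auto
    ultimately show ?thesis by (intro exI[of _ "coord d ` (U \<inter> cdom d)"] exI[of _ ?J]) auto
  qed
  have sm: "gen_smooth (cdim d) W (\<lambda>w. \<Lambda> powi k * block \<epsilon> (iter k (cinv d w)))"
    if "d \<in> charts M" "open_Cn (cdim d) W" "W \<subseteq> cimage d" for d W k
    using gen_smooth_cmult[OF gen_smooth_subset[OF block_smooth[OF that(1)] that(2,3)]] .
  have "smooth_potential M ?\<psi>"
    unfolding smooth_potential_def
  proof (intro ballI gen_smooth.local)
    fix d z assume d: "d \<in> charts M" and z: "z \<in> cimage d"
    obtain W J where W: "open_Cn (cdim d) W" "z \<in> W" "W \<subseteq> cimage d" "finite J"
      "\<forall>w\<in>W. (?\<psi> \<circ> cinv d) w = (\<Sum>k\<in>J. \<Lambda> powi k * block \<epsilon> (iter k (cinv d w)))"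
      using chart[OF d z] by blast
    have "gen_smooth (cdim d) W (\<lambda>w. \<Sum>k\<in>J. \<Lambda> powi k * block \<epsilon> (iter k (cinv d w)))"
      by (intro gen_smooth_sum[OF W(1)] sm[OF d W(1,3)])
    then show "\<exists>W g. z \<in> W \<and> W \<subseteq> cimage d \<and> gen_smooth (cdim d) W g \<and> (\<forall>w\<in>W. g w = (?\<psi> \<circ> cinv d) w)"
      using W by (intro exI[of _ W] exI[of _ "\<lambda>w. \<Sum>k\<in>J. \<Lambda> powi k * block \<epsilon> (iter k (cinv d w))"]) auto
  qed (rule chartsD(2))
  moreover have "levi (?\<psi> \<circ> cinv d) z u > 0"
    if d: "d \<in> charts M" and z: "z \<in> cimage d" and u: "u \<in> Cn (cdim d)" "u \<noteq> (\<lambda>_. 0)" for d z u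
  proof -
    obtain W J where W: "open_Cn (cdim d) W" "z \<in> W" "W \<subseteq> cimage d" "finite J"
      and J: "\<And>k. iter k (cinv d z) \<in> shell \<epsilon> \<Longrightarrow> k \<in> J \<and> k + N \<in> J"
      and eq: "\<And>w. w \<in> W \<Longrightarrow> (?\<psi> \<circ> cinv d) w = (\<Sum>k\<in>J. \<Lambda> powi k * block \<epsilon> (iter k (cinv d w)))"
      using chart[OF d z] by blast
    define T where "T k = \<Lambda> powi k * term_levi \<epsilon> d k z u" for k
    let ?y = "\<lambda>k. iter k (cinv d z)"
    have add: "?y (k + N) = iter N (?y k)" for k
      using iter_add[of "cinv d z" N k] cinv_S[OF d z] by (simp add: add.commute)
    have "levi (?\<psi> \<circ> cinv d) z u = levi (\<lambda>w. \<Sum>k\<in>J. \<Lambda> powi k * block \<epsilon> (iter k (cinv d w))) z u"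
      by (rule levi_cong[OF W(1,2) eq u(1)])
    also have "\<dots> = (\<Sum>k\<in>J. levi (\<lambda>w. \<Lambda> powi k * block \<epsilon> (iter k (cinv d w))) z u)"
      by (rule levi_sum[OF W(1) sm[OF d W(1,3)] W(2) u(1)])
    also have "\<dots> = (\<Sum>k\<in>J. T k)"
      unfolding T_def term_levi_def using levi_cmult[OF block_smooth[OF d] z u(1)] by simp
    finally have L: "levi (?\<psi> \<circ> cinv d) z u = (\<Sum>k\<in>J. T k)" .
    have inner: "bump' \<epsilon> r 1 1 (\<phi> (?y k)) * (4 * speed d k z u) \<le> term_levi \<epsilon> d k z u"
      if k: "?y k \<in> B" "\<phi> (?y k) < r / 2" for k
    proof -
      have "z \<in> hdom d k" using z k by (simp add: hdom_def)
      then obtain Q where Q: "0 \<le> Q"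
        "term_levi \<epsilon> d k z u = bump' \<epsilon> r 1 1 (\<phi> (?y k)) * (4 * speed d k z u) + bump'' \<epsilon> r 1 1 (\<phi> (?y k)) * Q"
        using term_levi_inside[OF d _ u(1)] by blast
      have "bump'' \<epsilon> r 1 1 (\<phi> (?y k)) \<ge> 0"
      proof (cases "\<phi> (?y k) \<le> \<epsilon>")
        case True
        then show ?thesis using bump_zero(3)[OF r, of "\<phi> (?y k)" \<epsilon>] by simp
      next
        case False
        then show ?thesis using bump_convex_part(3)[OF \<epsilon>(1), of "\<phi> (?y k)" r] k by simp
      qed
      then show ?thesis using Q by simp
    qed
    have inner_nonneg: "bump' \<epsilon> r 1 1 t \<ge> 0" if "t < r / 2" for t
      using bump_zero(2)[OF r, of t \<epsilon>] bump_convex_part(2)[OF \<epsilon>(1), of t r] that by (cases "t \<le> \<epsilon>") auto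
    have T_nonneg: "T k \<ge> 0" if k: "?y k \<notin> shell (r / 2)" for k
    proof (cases "?y k \<in> {w\<in>B. \<phi> w \<le> r}")
      case True
      then have i: "?y k \<in> B" "\<phi> (?y k) < r / 2" using k by (auto simp: shell_def)
      have "0 \<le> bump' \<epsilon> r 1 1 (\<phi> (?y k)) * (4 * speed d k z u)" using inner_nonneg[OF i(2)] speed_nonneg by simp
      then have "0 \<le> term_levi \<epsilon> d k z u" using inner[OF i] by linarith
      then show ?thesis using \<Lambda>k[of k] by (simp add: T_def)
    next
      case False
      then show ?thesis using term_levi_outside[OF d z u(1)] by (simp add: T_def)
    qed
    \<comment> \<open>The negative part of T k is at most D C times the speed at k + N, by speed_comparison; T (k + N)
       exceeds this because of the additional weight.\<close>
    have pair: "T k + T (k + N) > 0" if k: "?y k \<in> shell (r / 2)" for k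
    proof -
      have kB: "?y k \<in> B" "\<phi> (?y k) \<le> r" using k by (auto simp: shell_def)
      have gd: "?y (k + N) \<in> B" "\<phi> (?y (k + N)) < r / 2" "\<eta> < bump' \<epsilon> r 1 1 (\<phi> (?y (k + N)))"
        using good[OF k] add by auto
      have "z \<in> hdom d k" "z \<in> hdom d (k + N)" using z kB gd by (auto simp: hdom_def)
      then have A: "speed d (k + N) z u > 0" using speed_positive[OF d _ u] by blast
      obtain Q where Q: "0 \<le> Q" "Q \<le> 4 * \<phi> (?y k) * speed d k z u"
        "term_levi \<epsilon> d k z u = bump' \<epsilon> r 1 1 (\<phi> (?y k)) * (4 * speed d k z u) + bump'' \<epsilon> r 1 1 (\<phi> (?y k)) * Q"
        using term_levi_inside[OF d \<open>z \<in> hdom d k\<close> u(1)] .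
      let ?b1 = "bump' \<epsilon> r 1 1 (\<phi> (?y k))" and ?b2 = "bump'' \<epsilon> r 1 1 (\<phi> (?y k))" and ?s = "speed d k z u"
      have s0: "?s \<ge> 0" by (rule speed_nonneg)
      have Q': "Q \<le> 4 * r * ?s" using Q(2) mult_right_mono[OF kB(2) s0] by linarith
      have "- ?b1 * (4 * ?s) \<le> \<bar>?b1\<bar> * (4 * ?s)" using s0 by (intro mult_right_mono) auto
      moreover have "- ?b2 * Q \<le> \<bar>?b2\<bar> * (4 * r * ?s)"
        using Q(1) Q' by (intro mult_mono) auto
      ultimately have "- term_levi \<epsilon> d k z u \<le> 4 * (\<bar>?b1\<bar> + \<bar>?b2\<bar> * r) * ?s"
        using Q(3) by (simp add: algebra_simps)
      also have "\<dots> \<le> D * ?s" using D[OF chart_norm_nonneg kB(2)] s0 by (intro mult_right_mono) auto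
      also have "\<dots> \<le> D * (C * speed d (k + N) z u)"
        using C[OF d z u(1) k] CD(2) by (intro mult_left_mono) auto
      finally have 1: "- term_levi \<epsilon> d k z u \<le> D * C * speed d (k + N) z u" by simp
      have "\<eta> * (4 * speed d (k + N) z u) \<le> term_levi \<epsilon> d (k + N) z u"
        using inner[OF gd(1,2)] mult_right_mono[OF less_imp_le[OF gd(3)], of "4 * speed d (k + N) z u"] A by linarith
      then have "\<Lambda> powi N * (\<eta> * (4 * speed d (k + N) z u)) \<le> \<Lambda> powi N * term_levi \<epsilon> d (k + N) z u"
        using \<Lambda>k[of N] by (intro mult_left_mono) auto
      moreover have "D * C * speed d (k + N) z u < \<Lambda> powi N * (4 * \<eta>) * speed d (k + N) z u"
        using CD(3) A by (rule mult_strict_right_mono)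
      ultimately have "0 < term_levi \<epsilon> d k z u + \<Lambda> powi N * term_levi \<epsilon> d (k + N) z u"
        using 1 by (simp add: mult.assoc mult.left_commute)
      then have "0 < \<Lambda> powi k * (term_levi \<epsilon> d k z u + \<Lambda> powi N * term_levi \<epsilon> d (k + N) z u)"
        using \<Lambda>k[of k] by (rule mult_pos_pos[rotated])
      then show ?thesis using \<Lambda> by (simp add: T_def power_int_add algebra_simps)
    qed
    define Bad where "Bad = {k\<in>J. ?y k \<in> shell (r / 2)}"
    have shell_mono: "w \<in> shell \<epsilon>" if "w \<in> shell (r / 2)" for w using that \<epsilon> by (auto simp: shell_def)
    \<comment> \<open>Translation is injective, so distinct bad indices use distinct good ones.\<close>
    have shifted: "(\<lambda>k. k + N) ` Bad \<subseteq> J - Bad"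
    proof
      fix l assume "l \<in> (\<lambda>k. k + N) ` Bad"
      then obtain k where k: "l = k + N" "?y k \<in> shell (r / 2)" by (auto simp: Bad_def)
      then have "l \<in> J" using J shell_mono by blast
      moreover have "?y l \<notin> shell (r / 2)" using good[OF k(2)] add[of k] k(1) by (auto simp: shell_def)
      ultimately show "l \<in> J - Bad" by (simp add: Bad_def)
    qed
    have fin: "finite Bad" "finite (J - Bad)" using W(4) by (auto simp: Bad_def)
    have nonneg: "T k \<ge> 0" if "k \<in> J - Bad" for k using that T_nonneg by (auto simp: Bad_def)
    have "(\<Sum>k\<in>J. T k) = (\<Sum>k\<in>Bad. T k) + (\<Sum>k\<in>J - Bad. T k)"
      using W(4) by (subst sum.subset_diff[of Bad J]) (auto simp: Bad_def)
    also have "\<dots> > 0"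
    proof (cases "Bad = {}")
      case True
      obtain k where k: "?y k \<in> B" "\<epsilon> < \<phi> (?y k)" "\<phi> (?y k) < r / 2" using crossing[OF cinv_S[OF d z]] by blast
      then have "?y k \<in> shell \<epsilon>" using r by (simp add: shell_def)
      then have kJ: "k \<in> J" using J by blast
      have "z \<in> hdom d k" using z k by (simp add: hdom_def)
      then have "0 < bump' \<epsilon> r 1 1 (\<phi> (?y k)) * (4 * speed d k z u)"
        using bump_convex_part(2)[OF \<epsilon>(1) k(2)] k(3) speed_positive[OF d \<open>z \<in> hdom d k\<close> u] by simp
      then have "0 < term_levi \<epsilon> d k z u" using inner[OF k(1,3)] by linarith
      then have "T k > 0" using \<Lambda>k[of k] by (simp add: T_def)
      then have "0 < (\<Sum>k\<in>J - Bad. T k)"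
        using kJ True fin(2) nonneg by (intro sum_pos2[of _ k]) auto
      then show ?thesis using True by simp
    next
      case False
      have "0 < (\<Sum>k\<in>Bad. T k + T (k + N))"
        using pair fin(1) False by (intro sum_pos) (auto simp: Bad_def)
      also have "\<dots> = (\<Sum>k\<in>Bad. T k) + (\<Sum>k\<in>(\<lambda>k. k + N) ` Bad. T k)"
        by (simp add: sum.distrib sum.reindex inj_on_def)
      also have "\<dots> \<le> (\<Sum>k\<in>Bad. T k) + (\<Sum>k\<in>J - Bad. T k)"
        by (intro add_left_mono sum_mono2[OF fin(2) shifted] nonneg) blast
      finally show ?thesis .
    qed
    finally show ?thesis using L by simp
  qed
  ultimately have "strictly_psh M ?\<psi>" by (simp add: strictly_psh_def)
  moreover have "inverse \<Lambda> > 0" using \<Lambda> by simp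
  ultimately show ?thesis using pos potential_automorphic \<Lambda>
    by (intro exI[of _ ?\<psi>] exI[of _ "inverse \<Lambda>"]) simp
qed

end

section \<open>Pulled-back structures\<close>

lemma pullback_structure_simps [simp]:
  "Top (pullback_structure T p X) = T"
  by (simp add: pullback_structure_def)

lemma hol_fns_pullback: "h \<in> hol_fns (pullback_structure T p X) U \<longleftrightarrow>
   (\<forall>z\<in>U. \<exists>U' W f. openin T U' \<and> z \<in> U' \<and> U' \<subseteq> U \<and> openin (Top X) W \<and> p ` U' \<subseteq> W \<and> f \<in> hol_fns X W \<and> (\<forall>w\<in>U'. h w = f (p w)))"
  by (simp add: pullback_structure_def)

lemma is_function_sheaf_pullback: "is_function_sheaf (pullback_structure T p X)"
  unfolding is_function_sheaf_def pullback_structure_simps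
proof (intro conjI allI impI)
  fix U W h assume *: "openin T U \<and> openin T W \<and> W \<subseteq> U \<and> h \<in> hol_fns (pullback_structure T p X) U"
  show "h \<in> hol_fns (pullback_structure T p X) W"
    unfolding hol_fns_pullback
  proof
    fix z assume z: "z \<in> W"
    then have "z \<in> U" using * by blast
    then obtain U' W' f where "openin T U'" "z \<in> U'" "U' \<subseteq> U" "openin (Top X) W'" "p ` U' \<subseteq> W'" "f \<in> hol_fns X W'" "\<forall>w\<in>U'. h w = f (p w)"
      using *[THEN conjunct2, THEN conjunct2, THEN conjunct2, unfolded hol_fns_pullback, rule_format, of z] by auto
    then show "\<exists>U' W' f. openin T U' \<and> z \<in> U' \<and> U' \<subseteq> W \<and> openin (Top X) W' \<and> p ` U' \<subseteq> W' \<and> f \<in> hol_fns X W' \<and> (\<forall>w\<in>U'. h w = f (p w))"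
      using * z by (intro exI[of _ "U' \<inter> W"] exI[of _ W'] exI[of _ f]) auto
  qed
next
  fix \<U> h assume *: "\<forall>U\<in>\<U>. openin T U \<and> h \<in> hol_fns (pullback_structure T p X) U"
  show "h \<in> hol_fns (pullback_structure T p X) (\<Union>\<U>)"
    unfolding hol_fns_pullback
  proof
    fix z assume "z \<in> \<Union>\<U>"
    then obtain U where U: "U \<in> \<U>" "z \<in> U" by blast
    then have "h \<in> hol_fns (pullback_structure T p X) U" using * by blast
    then obtain U' W' f where "openin T U'" "z \<in> U'" "U' \<subseteq> U" "openin (Top X) W'" "p ` U' \<subseteq> W'" "f \<in> hol_fns X W'" "\<forall>w\<in>U'. h w = f (p w)"
      using U(2) unfolding hol_fns_pullback by auto
    then show "\<exists>U' W' f. openin T U' \<and> z \<in> U' \<and> U' \<subseteq> \<Union>\<U> \<and> openin (Top X) W' \<and> p ` U' \<subseteq> W' \<and> f \<in> hol_fns X W' \<and> (\<forall>w\<in>U'. h w = f (p w))"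
      using U by (intro exI[of _ U'] exI[of _ W'] exI[of _ f]) auto
  qed
next
  fix U f g assume *: "openin T U \<and> f \<in> hol_fns (pullback_structure T p X) U \<and> (\<forall>y\<in>U. g y = f y)"
  show "g \<in> hol_fns (pullback_structure T p X) U"
    unfolding hol_fns_pullback
  proof
    fix z assume "z \<in> U"
    then obtain U' W' f' where "openin T U'" "z \<in> U'" "U' \<subseteq> U" "openin (Top X) W'" "p ` U' \<subseteq> W'" "f' \<in> hol_fns X W'" "\<forall>w\<in>U'. f w = f' (p w)"
      using *[THEN conjunct2, THEN conjunct1, unfolded hol_fns_pullback, rule_format, of z] by auto
    then show "\<exists>U' W' f. openin T U' \<and> z \<in> U' \<and> U' \<subseteq> U \<and> openin (Top X) W' \<and> p ` U' \<subseteq> W' \<and> f \<in> hol_fns X W' \<and> (\<forall>w\<in>U'. g w = f (p w))"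
      using * by (intro exI[of _ U'] exI[of _ W'] exI[of _ f']) auto
  qed
qed

lemma local_iso_pullback:
  assumes X: "is_function_sheaf X" and p: "continuous_map T (Top X) p" "open_map T (Top X) p"
    and inj: "\<And>z. z \<in> topspace T \<Longrightarrow> \<exists>U. openin T U \<and> z \<in> U \<and> inj_on p U"
  shows "local_iso (pullback_structure T p X) X p"
  unfolding local_iso_def pullback_structure_simps
proof (intro conjI ballI allI impI p inj)
  fix U f assume U: "openin T U \<and> inj_on p U"
  have oU: "openin (Top X) (p ` W)" if "openin T W" for W using p(2) that by (simp add: open_map_def)
  show "f \<in> hol_fns X (p ` U) \<longleftrightarrow> f \<circ> p \<in> hol_fns (pullback_structure T p X) U"
  proof
    assume f: "f \<in> hol_fns X (p ` U)"
    show "f \<circ> p \<in> hol_fns (pullback_structure T p X) U"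
      unfolding hol_fns_pullback
      using U f oU by (intro ballI exI[of _ U] exI[of _ "p ` U"] exI[of _ f]) auto
  next
    assume f: "f \<circ> p \<in> hol_fns (pullback_structure T p X) U"
    show "f \<in> hol_fns X (p ` U)"
    proof (rule sheaf_local[OF X])
      show "openin (Top X) (p ` U)" using U oU by blast
      fix w assume "w \<in> p ` U"
      then obtain z where z: "z \<in> U" "w = p z" by blast
      then obtain U' W' f' where U': "openin T U'" "z \<in> U'" "U' \<subseteq> U" "openin (Top X) W'" "p ` U' \<subseteq> W'" "f' \<in> hol_fns X W'" "\<forall>w\<in>U'. (f \<circ> p) w = f' (p w)"
        using f unfolding hol_fns_pullback by auto
      have "f' \<in> hol_fns X (p ` U')" using sheaf_restrict[OF X U'(4) oU[OF U'(1)] U'(5,6)] .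
      then show "\<exists>W g. openin (Top X) W \<and> w \<in> W \<and> W \<subseteq> p ` U \<and> g \<in> hol_fns X W \<and> (\<forall>w\<in>W. f w = g w)"
        using U' z oU[OF U'(1)] by (intro exI[of _ "p ` U'"] exI[of _ f']) auto
    qed
  qed
qed

text \<open>
  Charts of \<open>Y\<close> lift to charts of \<open>X\<close> with the same image, in which the two functions have the same
  expression.
\<close>

lemma strictly_psh_local_iso:
  assumes iso: "local_iso X Y \<pi>" and bij: "inj_on \<pi> (points X)" "\<pi> ` points X = points Y"
    and X: "is_function_sheaf X" and \<psi>: "strictly_psh X \<psi>" and eq: "\<And>y. y \<in> points X \<Longrightarrow> \<psi>' (\<pi> y) = \<psi> y"
  shows "strictly_psh Y \<psi>'"
proof -
  have "gen_smooth (cdim c) (cimage c) (\<psi>' \<circ> cinv c) \<and>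
      (\<forall>z\<in>cimage c. \<forall>u\<in>Cn (cdim c). u \<noteq> (\<lambda>_. 0) \<longrightarrow> levi (\<psi>' \<circ> cinv c) z u > 0)" if c: "c \<in> charts Y" for c
  proof -
    note lc = chartsD(1)[OF c]
    define U where "U = {y\<in>points X. \<pi> y \<in> cdom c}"
    have U: "openin (Top X) U" using local_iso_preimage[OF iso local_model_open[OF lc]] by (simp add: U_def)
    have im: "\<pi> ` U = cdom c"
      using bij(2) openin_subset[OF local_model_open[OF lc]] by (force simp: U_def)
    have injU: "inj_on \<pi> U" using inj_on_subset[OF bij(1)] by (auto simp: U_def)
    let ?c = "(cdim c, U, \<lambda>y. coord c (\<pi> y))"
    have c': "?c \<in> charts X" using lift_chart(1)[OF iso X c U _ injU] im by simp
    have "cimage ?c = coord c ` (\<pi> ` U)" by (simp add: image_image)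
    then have ci: "cimage ?c = cimage c" using im by (simp add: cimage_def)
    have e: "(\<psi>' \<circ> cinv c) z = (\<psi> \<circ> cinv ?c) z" if z: "z \<in> cimage c" for z
    proof -
      obtain w where w: "w \<in> cdom c" "z = coord c w" using z by (auto simp: cimage_def)
      obtain y where "y \<in> U" "w = \<pi> y" using w(1) unfolding im[symmetric] by blast
      with w have y: "y \<in> U" "z = coord c (\<pi> y)" by simp_all
      have "cinv ?c z = y" using lift_chart(2)[OF iso X c U _ injU y(1)] im y(2) by simp
      moreover have "cinv c z = \<pi> y" using cinv_coord[OF lc, of "\<pi> y"] y im by auto
      ultimately show ?thesis using eq y by (simp add: U_def)
    qed
    have s: "gen_smooth (cdim c) (cimage c) (\<psi> \<circ> cinv ?c)"
      using \<psi> c' ci by (force simp: strictly_psh_def smooth_potential_def)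
    have "levi (\<psi>' \<circ> cinv c) z u > 0" if "z \<in> cimage c" "u \<in> Cn (cdim c)" "u \<noteq> (\<lambda>_. 0)" for z u
    proof -
      have "levi (\<psi>' \<circ> cinv c) z u = levi (\<psi> \<circ> cinv ?c) z u"
        by (rule levi_cong[OF chartsD(2)[OF c] that(1) e that(2)])
      moreover have "levi (\<psi> \<circ> cinv ?c) z u > 0"
        using \<psi> c' ci that unfolding strictly_psh_def by (metis chart_simps(1))
      ultimately show ?thesis by simp
    qed
    then show ?thesis using gen_smooth_cong[OF s] e by auto
  qed
  then show ?thesis by (auto simp: strictly_psh_def smooth_potential_def)
qed

lemma dir_deriv_coord: "dir_deriv u (\<lambda>w. w k) z = u k"
proof -
  have "((\<lambda>t. z k + of_real t * u k) has_vector_derivative u k) (at 0)"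
    by (auto intro!: derivative_eq_intros simp: has_vector_derivative_def scaleR_conv_of_real)
  then show ?thesis
    by (simp add: dir_deriv_def shift_def add_cvec_def scale_cvec_def vector_derivative_at)
qed

section \<open>The quotient by the cyclic group\<close>

context invertible_contraction
begin

lemma iter_bij: "bij_betw (iter k) S S"
proof (rule bij_betw_byWitness[where f' = "iter (- k)"])
  show "\<forall>y\<in>S. iter (- k) (iter k y) = y" "\<forall>y\<in>S. iter k (iter (- k) y) = y" using iter_inverse by auto
  show "iter k ` S \<subseteq> S" "iter (- k) ` S \<subseteq> S" using iter_S by blast+
qed

lemma cyclic_group_eq: "cyclic_group S \<gamma> = range (\<lambda>k. restrict (iter k) S)"
proof -
  interpret group "BijGroup S" by (rule group_BijGroup)
  define h where "h k = restrict (iter k) S" for k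
  have hB: "h k \<in> Bij S" for k
    using iter_bij[of k] by (simp add: Bij_def h_def)
  then have hc: "h k \<in> carrier (BijGroup S)" for k by (simp add: BijGroup_def)
  have hm: "h j \<otimes>\<^bsub>BijGroup S\<^esub> h k = h (j + k)" for j k
  proof -
    have "compose S (h j) (h k) y = h (j + k) y" for y
      using iter_add[of y j k] iter_S[of y k] by (simp add: compose_def h_def)
    then show ?thesis using hB by (auto simp: BijGroup_def)
  qed
  have h1: "h 1 = restrict \<gamma> S" by (auto simp: h_def restrict_def)
  have "h 1 [^]\<^bsub>BijGroup S\<^esub> k = h k" for k :: int
  proof (induction k rule: int_induct[where k = 0])
    case base
    show ?case by (auto simp: BijGroup_def h_def restrict_def)
  next
    case (step1 k)
    then show ?case using int_pow_mult[OF hc, of 1 k 1] hm by (simp add: int_pow_1 hc)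
  next
    case (step2 k)
    have "h 1 [^]\<^bsub>BijGroup S\<^esub> (k - 1) \<otimes>\<^bsub>BijGroup S\<^esub> h 1 = h 1 [^]\<^bsub>BijGroup S\<^esub> k"
      using int_pow_mult[OF hc, of 1 "k - 1" 1] by (simp add: int_pow_1 hc)
    also have "\<dots> = h (k - 1) \<otimes>\<^bsub>BijGroup S\<^esub> h 1" using step2 hm by simp
    finally show ?case using hc by (simp add: int_pow_closed)
  qed
  then have "generate (BijGroup S) {h 1} = range h"
    using generate_pow[OF hc, of 1] by auto
  then have "cyclic_group S \<gamma> = range h" using h1 by (simp add: cyclic_group_def)
  then show ?thesis by (simp add: h_def[abs_def])
qed

abbreviation "orb \<equiv> group_orbit (cyclic_group S \<gamma>)"
abbreviation "Q \<equiv> quotient_space M (cyclic_group S \<gamma>)"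

lemma orbit_eq: "y \<in> S \<Longrightarrow> orb y = range (\<lambda>k. iter k y)"
  by (simp add: group_orbit_def cyclic_group_eq image_image)

lemma orbit_eq_iff:
  assumes "y \<in> S" "y' \<in> S" shows "orb y = orb y' \<longleftrightarrow> (\<exists>k. y' = iter k y)"
proof
  assume "orb y = orb y'"
  moreover have "y' \<in> orb y'" unfolding orbit_eq[OF assms(2)] by (metis iter_0 rangeI)
  ultimately show "\<exists>k. y' = iter k y" using orbit_eq[OF assms(1)] by auto
next
  assume "\<exists>k. y' = iter k y"
  then obtain k where k: "y' = iter k y" by blast
  have 1: "iter j y' = iter (j + k) y" for j using iter_add[of y j k] assms k by simp
  have 2: "iter j y = iter (j - k) y'" for j using iter_add[of y "j - k" k] assms k by simp
  have "iter j y' \<in> range (\<lambda>j. iter j y)" for j unfolding 1 by (rule rangeI)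
  moreover have "iter j y \<in> range (\<lambda>j. iter j y')" for j by (subst 2) (rule rangeI)
  ultimately show "orb y = orb y'" unfolding orbit_eq[OF assms(1)] orbit_eq[OF assms(2)] by blast
qed

lemma orb_iter: "y \<in> S \<Longrightarrow> orb (iter k y) = orb y"
  using orbit_eq_iff[of y "iter k y"] iter_S by metis

lemma Top_Q: "Top Q = quotient_topology (Top M) orb"
  by (simp add: quotient_space_def)

lemma openin_Q: "openin (Top Q) W \<longleftrightarrow> W \<subseteq> orb ` S \<and> openin (Top M) {y\<in>S. orb y \<in> W}"
  unfolding Top_Q openin_quotient_topology points_M ..

lemma points_Q: "points Q = orb ` S"
  using quotient_imp_surjective_map[OF quotient_map_quotient_topology[of "Top M" orb]] unfolding Top_Q points_M by simp

lemma hol_fns_Q: "f \<in> hol_fns Q W \<longleftrightarrow> f \<circ> orb \<in> hol_fns V {y\<in>S. orb y \<in> W}"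
  by (simp add: quotient_space_def)

lemma orb_saturation:
  assumes "U \<subseteq> S" shows "{y\<in>S. orb y \<in> orb ` U} = (\<Union>k. iter k ` U)"
proof (intro equalityI subsetI)
  fix y assume "y \<in> {y\<in>S. orb y \<in> orb ` U}"
  then obtain u where u: "u \<in> U" "orb u = orb y" "y \<in> S" by auto
  then have "u \<in> S" using assms by blast
  then obtain k where "y = iter k u" using orbit_eq_iff[of u y] u by auto
  then show "y \<in> (\<Union>k. iter k ` U)" using u(1) by blast
next
  fix y assume "y \<in> (\<Union>k. iter k ` U)"
  then obtain k u where u: "u \<in> U" "y = iter k u" by blast
  then have "u \<in> S" using assms by blast
  then show "y \<in> {y\<in>S. orb y \<in> orb ` U}" using u orb_iter iter_S by auto
qed

lemma orb_open: "openin (Top M) U \<Longrightarrow> openin (Top Q) (orb ` U)"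
proof -
  assume U: "openin (Top M) U"
  then have "U \<subseteq> S" using openin_M by blast
  moreover have "openin (Top M) (\<Union>k. iter k ` U)" using iter_image_open[OF U] by blast
  ultimately show ?thesis using openin_Q orb_saturation by auto
qed

lemma sheaf_Q: "is_function_sheaf Q"
  unfolding is_function_sheaf_def hol_fns_Q
proof (intro conjI allI impI)
  fix U W f assume *: "openin (Top Q) U \<and> openin (Top Q) W \<and> W \<subseteq> U \<and> f \<circ> orb \<in> hol_fns V {y\<in>S. orb y \<in> U}"
  then have "openin (Top M) {y\<in>S. orb y \<in> U}" "openin (Top M) {y\<in>S. orb y \<in> W}" using openin_Q by auto
  from sheaf_restrict[OF sheaf_M this] * show "f \<circ> orb \<in> hol_fns V {y\<in>S. orb y \<in> W}" by auto
next
  fix \<U> f assume *: "\<forall>U\<in>\<U>. openin (Top Q) U \<and> f \<circ> orb \<in> hol_fns V {y\<in>S. orb y \<in> U}"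
  have "openin (Top M) {y\<in>S. orb y \<in> U}" if "U \<in> \<U>" for U using * that openin_Q by blast
  then have "openin (Top M) (\<Union>U\<in>\<U>. {y\<in>S. orb y \<in> U})" by blast
  moreover have "(\<Union>U\<in>\<U>. {y\<in>S. orb y \<in> U}) = {y\<in>S. orb y \<in> \<Union>\<U>}" by blast
  ultimately have o: "openin (Top M) {y\<in>S. orb y \<in> \<Union>\<U>}" by simp
  have "f \<circ> orb \<in> hol_fns M {y\<in>S. orb y \<in> \<Union>\<U>}"
  proof (rule sheaf_local[OF sheaf_M o])
    fix y assume y: "y \<in> {y\<in>S. orb y \<in> \<Union>\<U>}"
    then obtain U where "U \<in> \<U>" "orb y \<in> U" by blast
    then show "\<exists>W g. openin (Top M) W \<and> y \<in> W \<and> W \<subseteq> {y\<in>S. orb y \<in> \<Union>\<U>} \<and> g \<in> hol_fns M W \<and> (\<forall>w\<in>W. (f \<circ> orb) w = g w)"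
      using y * openin_Q by (intro exI[of _ "{y\<in>S. orb y \<in> U}"] exI[of _ "f \<circ> orb"]) auto
  qed
  then show "f \<circ> orb \<in> hol_fns V {y\<in>S. orb y \<in> \<Union>\<U>}" by simp
next
  fix U f g assume *: "openin (Top Q) U \<and> f \<circ> orb \<in> hol_fns V {y\<in>S. orb y \<in> U} \<and> (\<forall>y\<in>U. g y = f y)"
  then have "openin (Top M) {y\<in>S. orb y \<in> U}" using openin_Q by auto
  from sheaf_cong[OF sheaf_M this] * show "g \<circ> orb \<in> hol_fns V {y\<in>S. orb y \<in> U}" by auto
qed

lemma free_imp_inj:
  assumes "U \<subseteq> S" "\<And>k. k \<noteq> 0 \<Longrightarrow> iter k ` U \<inter> U = {}" shows "inj_on orb U"
proof (rule inj_onI)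
  fix y y' assume y: "y \<in> U" "y' \<in> U" "orb y = orb y'"
  then obtain k where k: "y' = iter k y" using orbit_eq_iff[of y y'] assms(1) by blast
  show "y = y'"
  proof (cases "k = 0")
    case False
    then show ?thesis using assms(2)[OF False] y k by blast
  qed (use k in simp)
qed

lemma orb_continuous: "continuous_map (Top M) (Top Q) orb"
  unfolding Top_Q using quotient_imp_continuous_map[OF quotient_map_quotient_topology] .

lemma local_iso_orb: "local_iso M Q orb"
  unfolding local_iso_def points_M
proof (intro conjI ballI allI impI)
  show "continuous_map (Top M) (Top Q) orb" by (rule orb_continuous)
  show "open_map (Top M) (Top Q) orb" using orb_open by (simp add: open_map_def)
next
  fix y assume y: "y \<in> S"
  obtain U where U: "openin (Top M) U" "y \<in> U" "\<And>k. k \<noteq> 0 \<Longrightarrow> iter k ` U \<inter> U = {}"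
    by (rule free_nbhd[OF y]) (rule that; assumption)
  have "U \<subseteq> S" using U(1) openin_M by blast
  then have "inj_on orb U" using U(3) by (rule free_imp_inj)
  then show "\<exists>U. openin (Top M) U \<and> y \<in> U \<and> inj_on orb U" using U by blast
next
  fix U and f :: "'a set \<Rightarrow> complex" assume "openin (Top M) U \<and> inj_on orb U"
  then have U: "openin (Top M) U" "inj_on orb U" "U \<subseteq> S" using openin_M by auto
  have o: "openin (Top M) {y\<in>S. orb y \<in> orb ` U}" using orb_open[OF U(1)] openin_Q by blast
  have "f \<circ> orb \<in> hol_fns V {y\<in>S. orb y \<in> orb ` U} \<longleftrightarrow> f \<circ> orb \<in> hol_fns V U"
  proof
    assume "f \<circ> orb \<in> hol_fns V {y\<in>S. orb y \<in> orb ` U}"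
    then show "f \<circ> orb \<in> hol_fns V U" using sheaf_restrict[OF sheaf_M o U(1)] U(3) by auto
  next
    assume f: "f \<circ> orb \<in> hol_fns V U"
    have "f \<circ> orb \<in> hol_fns M {y\<in>S. orb y \<in> orb ` U}"
    proof (rule sheaf_local[OF sheaf_M o])
      fix y assume "y \<in> {y\<in>S. orb y \<in> orb ` U}"
      then obtain k where k: "y \<in> iter k ` U" unfolding orb_saturation[OF U(3)] by blast
      have "(\<lambda>y. (f \<circ> orb) (iter (- k) y)) \<in> hol_fns V (iter k ` U)"
        using iter_hol_fns[OF U(1) f, of "- k"] iter_image[OF U(3)] by simp
      moreover have "(f \<circ> orb) w = (f \<circ> orb) (iter (- k) w)" if w: "w \<in> iter k ` U" for w
      proof -
        obtain u where u: "u \<in> U" "w = iter k u" using w by blast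
        then have "u \<in> S" using U(3) by blast
        then show ?thesis using u(2) orb_iter[of u k] iter_inverse(1)[of u k] by simp
      qed
      moreover have "iter k ` U \<subseteq> {y\<in>S. orb y \<in> orb ` U}" unfolding orb_saturation[OF U(3)] by blast
      ultimately show "\<exists>W g. openin (Top M) W \<and> y \<in> W \<and> W \<subseteq> {y\<in>S. orb y \<in> orb ` U} \<and> g \<in> hol_fns M W \<and> (\<forall>w\<in>W. (f \<circ> orb) w = g w)"
        using k iter_image_open[OF U(1)] by (intro exI[of _ "iter k ` U"] exI[of _ "\<lambda>y. (f \<circ> orb) (iter (- k) y)"]) auto
    qed
    then show "f \<circ> orb \<in> hol_fns V {y\<in>S. orb y \<in> orb ` U}" by simp
  qed
  then show "f \<in> hol_fns Q (orb ` U) \<longleftrightarrow> f \<circ> orb \<in> hol_fns M U" unfolding hol_fns_Q hol_fns_M .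
qed

lemma Hausdorff_Q: "Hausdorff_space (Top Q)"
  unfolding Hausdorff_space_def
proof (intro allI impI)
  fix a b assume *: "a \<in> topspace (Top Q) \<and> b \<in> topspace (Top Q) \<and> a \<noteq> b"
  then obtain y y' where y: "y \<in> S" "y' \<in> S" "a = orb y" "b = orb y'" using points_Q by auto
  then have "iter k y \<noteq> y'" for k using * orbit_eq_iff[OF y(1,2)] by auto
  then obtain A B where AB: "openin (Top M) A" "openin (Top M) B" "y \<in> A" "y' \<in> B" "\<And>k. True \<Longrightarrow> iter k ` A \<inter> B = {}"
    by (rule separated_nbhds[OF y(1,2), of "\<lambda>_. True"]) (rule that; assumption)
  have sub: "A \<subseteq> S" "B \<subseteq> S" using AB openin_M by blast+
  have "disjnt (orb ` A) (orb ` B)"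
    unfolding disjnt_iff
  proof (intro allI notI)
    fix w assume "w \<in> orb ` A \<and> w \<in> orb ` B"
    then obtain p q where pq: "p \<in> A" "q \<in> B" "orb p = orb q" by auto
    then obtain k where "q = iter k p" using orbit_eq_iff[of p q] sub by blast
    then show False using AB(5)[OF TrueI, of k] pq by blast
  qed
  then show "\<exists>U W. openin (Top Q) U \<and> openin (Top Q) W \<and> a \<in> U \<and> b \<in> W \<and> disjnt U W"
    using AB orb_open y by (intro exI[of _ "orb ` A"] exI[of _ "orb ` B"]) auto
qed

lemma manifold_Q: "complex_manifold Q"
proof (rule local_iso_manifold[OF local_iso_orb manifold])
  show "orb ` points M = points Q" using points_Q by simp
  show "second_countable (Top Q)"
    by (rule second_countable_open_map_image[OF orb_continuous, unfolded points_M])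
       (use orb_open points_Q complex_manifoldD(3)[OF manifold] in \<open>auto simp: open_map_def\<close>)
qed (rule Hausdorff_Q sheaf_Q)+

subsection \<open>The covering\<close>

text \<open>
  The covering has to consist of pairs of an orbit and a natural number. A point is encoded by its orbit
  and the exponent that leads to it from a chosen representative of the orbit.
\<close>

definition rep :: "'a set \<Rightarrow> 'a" where "rep W = (SOME y. y \<in> S \<and> orb y = W)"

definition level :: "'a \<Rightarrow> int" where "level y = (SOME k. y = iter k (rep (orb y)))"

definition emb :: "'a \<Rightarrow> 'a set \<times> nat" where "emb y = (orb y, to_nat (level y))"

lemma rep: assumes "y \<in> S" shows "rep (orb y) \<in> S" "orb (rep (orb y)) = orb y" "y = iter (level y) (rep (orb y))"
proof -
  have "\<exists>y'. y' \<in> S \<and> orb y' = orb y" using assms by blast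
  from someI_ex[OF this] show r: "rep (orb y) \<in> S" "orb (rep (orb y)) = orb y" by (auto simp: rep_def)
  have "\<exists>k. y = iter k (rep (orb y))" using orbit_eq_iff[OF r(1) assms] r(2) by blast
  from someI_ex[OF this] show "y = iter (level y) (rep (orb y))" by (simp add: level_def)
qed

lemma inj_emb: "inj_on emb S"
proof (rule inj_onI)
  fix y y' assume y: "y \<in> S" "y' \<in> S" "emb y = emb y'"
  then have "orb y = orb y'" "level y = level y'" by (auto simp: emb_def)
  then show "y = y'" using rep(3)[OF y(1)] rep(3)[OF y(2)] by simp
qed

definition T :: "('a set \<times> nat) topology" where "T = quotient_topology (Top M) emb"

abbreviation "XT \<equiv> pullback_structure T fst Q"

definition unemb :: "'a set \<times> nat \<Rightarrow> 'a" where "unemb = inv_into S emb"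

lemma unemb_emb [simp]: "y \<in> S \<Longrightarrow> unemb (emb y) = y"
  using inj_emb by (simp add: unemb_def)

lemma fst_emb [simp]: "fst (emb y) = orb y" by (simp add: emb_def)

lemma emb_homeo: "homeomorphic_map (Top M) T emb"
  using quotient_map_quotient_topology[of "Top M" emb] inj_emb by (simp add: T_def homeomorphic_map_def)

lemma topspace_T: "topspace T = emb ` S"
  using homeomorphic_imp_surjective_map[OF emb_homeo] by simp

lemma emb_continuous: "continuous_map (Top M) T emb"
  using homeomorphic_imp_continuous_map[OF emb_homeo] .

lemma emb_open: "openin (Top M) U \<Longrightarrow> openin T (emb ` U)"
  using homeomorphic_imp_open_map[OF emb_homeo] by (simp add: open_map_def)

lemma openin_T:
  assumes "openin T U"
  shows "openin (Top M) {y\<in>S. emb y \<in> U}" "emb ` {y\<in>S. emb y \<in> U} = U"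
proof -
  show "openin (Top M) {y\<in>S. emb y \<in> U}"
    using openin_continuous_map_preimage[OF emb_continuous assms] unfolding points_M .
  have "U \<subseteq> emb ` S" using openin_subset[OF assms] topspace_T by simp
  then show "emb ` {y\<in>S. emb y \<in> U} = U" by blast
qed

lemma unemb_continuous: "continuous_map T (Top M) unemb"
  using homeomorphic_imp_continuous_map[OF homeomorphic_map_inverse[OF emb_homeo]] by simp

lemma fst_continuous: "continuous_map T (Top Q) fst"
proof -
  have "continuous_map T (Top Q) (orb \<circ> unemb)" using continuous_map_compose[OF unemb_continuous orb_continuous] .
  then show ?thesis by (rule continuous_map_eq) (auto simp: topspace_T)
qed

lemma fst_open: assumes "openin T U" shows "openin (Top Q) (fst ` U)"
proof -
  have "fst ` U = orb ` {y\<in>S. emb y \<in> U}"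
    using openin_T(2)[OF assms] by (metis (no_types, lifting) fst_emb image_cong image_image)
  then show ?thesis using orb_open[OF openin_T(1)[OF assms]] by simp
qed

lemma fst_inj: assumes "U \<subseteq> S" "inj_on orb U" shows "inj_on fst (emb ` U)"
  using assms by (auto simp: inj_on_def)

lemma local_iso_fst: "local_iso XT Q fst"
proof (rule local_iso_pullback[OF sheaf_Q fst_continuous])
  show "open_map T (Top Q) fst" using fst_open by (simp add: open_map_def)
  fix z assume "z \<in> topspace T"
  then obtain y where y: "y \<in> S" "z = emb y" using topspace_T by blast
  obtain U where U: "openin (Top M) U" "y \<in> U" "\<And>k. k \<noteq> 0 \<Longrightarrow> iter k ` U \<inter> U = {}"
    by (rule free_nbhd[OF y(1)]) (rule that; assumption)
  have "U \<subseteq> S" using U(1) openin_M by blast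
  then show "\<exists>U. openin T U \<and> z \<in> U \<and> inj_on fst U"
    using fst_inj[OF _ free_imp_inj] U y emb_open by (intro exI[of _ "emb ` U"]) auto
qed

text \<open>
  The structure pulled back along the projection is the original structure of the punctured variety,
  because the orbit map is a local isomorphism.
\<close>

lemma local_iso_emb: "local_iso M XT emb"
  unfolding local_iso_def pullback_structure_simps points_M
proof (intro conjI ballI allI impI)
  show "continuous_map (Top M) T emb" by (rule emb_continuous)
  show "open_map (Top M) T emb" using emb_open by (simp add: open_map_def)
next
  fix y assume "y \<in> S"
  then show "\<exists>U. openin (Top M) U \<and> y \<in> U \<and> inj_on emb U"
    using inj_emb open_S openin_M by blast
next
  fix U and f :: "'a set \<times> nat \<Rightarrow> complex" assume "openin (Top M) U \<and> inj_on emb U"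
  then have U: "openin (Top M) U" "U \<subseteq> S" using openin_M by auto
  show "f \<in> hol_fns XT (emb ` U) \<longleftrightarrow> f \<circ> emb \<in> hol_fns M U"
  proof
    assume f: "f \<in> hol_fns XT (emb ` U)"
    show "f \<circ> emb \<in> hol_fns M U"
    proof (rule sheaf_local[OF sheaf_M U(1)])
      fix y assume y: "y \<in> U"
      then have "emb y \<in> emb ` U" by blast
      from f[unfolded hol_fns_pullback, rule_format, OF this]
      obtain U' W g where U': "openin T U'" "emb y \<in> U'" "U' \<subseteq> emb ` U" "openin (Top Q) W" "fst ` U' \<subseteq> W" "g \<in> hol_fns Q W" "\<forall>w\<in>U'. f w = g (fst w)"
        by auto
      let ?U = "{y\<in>S. emb y \<in> U'}"
      have o: "openin (Top M) ?U" using openin_T(1)[OF U'(1)] .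
      have "?U \<subseteq> U"
      proof
        fix w assume w: "w \<in> ?U"
        then obtain w' where "w' \<in> U" "emb w = emb w'" using U'(3) by blast
        then show "w \<in> U" using inj_onD[OF inj_emb] w U(2) by blast
      qed
      moreover have "g \<circ> orb \<in> hol_fns M ?U"
      proof (rule sheaf_restrict[OF sheaf_M _ o])
        show "openin (Top M) {y\<in>S. orb y \<in> W}" using U'(4) openin_Q by blast
        show "g \<circ> orb \<in> hol_fns M {y\<in>S. orb y \<in> W}" using U'(6) hol_fns_Q by simp
        show "?U \<subseteq> {y\<in>S. orb y \<in> W}" using U'(5) by (force simp flip: fst_emb)
      qed
      moreover have "\<forall>w\<in>?U. (f \<circ> emb) w = (g \<circ> orb) w" using U'(7) by simp
      moreover have "y \<in> ?U" using y U'(2) U(2) by blast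
      ultimately show "\<exists>W g. openin (Top M) W \<and> y \<in> W \<and> W \<subseteq> U \<and> g \<in> hol_fns M W \<and> (\<forall>w\<in>W. (f \<circ> emb) w = g w)"
        using o by (intro exI[of _ ?U] exI[of _ "g \<circ> orb"]) auto
    qed
  next
    assume f: "f \<circ> emb \<in> hol_fns M U"
    show "f \<in> hol_fns XT (emb ` U)"
      unfolding hol_fns_pullback
    proof
      fix z assume "z \<in> emb ` U"
      then obtain y where y: "y \<in> U" "z = emb y" by blast
      obtain U1 where U1: "openin (Top M) U1" "y \<in> U1" "U1 \<subseteq> U" "inj_on orb U1"
        using local_iso_injective_nbhd[OF local_iso_orb U(1) y(1)] .
      let ?g = "f \<circ> emb \<circ> inv_into U1 orb"
      have "f \<circ> emb \<in> hol_fns M U1" using sheaf_restrict[OF sheaf_M U(1) U1(1,3) f] .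
      then have "?g \<circ> orb \<in> hol_fns M U1"
        by (rule sheaf_cong[OF sheaf_M U1(1)]) (use U1(4) in simp)
      then have "?g \<in> hol_fns Q (orb ` U1)" using local_iso_hol[OF local_iso_orb U1(1,4)] by blast
      moreover have "fst ` emb ` U1 \<subseteq> orb ` U1" by auto
      moreover have "\<forall>w\<in>emb ` U1. f w = ?g (fst w)" using U1(4) by auto
      moreover have "z \<in> emb ` U1" "emb ` U1 \<subseteq> emb ` U" using y U1 by auto
      ultimately show "\<exists>U' W g. openin T U' \<and> z \<in> U' \<and> U' \<subseteq> emb ` U \<and> openin (Top Q) W \<and> fst ` U' \<subseteq> W \<and> g \<in> hol_fns Q W \<and> (\<forall>w\<in>U'. f w = g (fst w))"
        using emb_open[OF U1(1)] orb_open[OF U1(1)] by (intro exI[of _ "emb ` U1"] exI[of _ "orb ` U1"] exI[of _ ?g]) simp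
    qed
  qed
qed

lemma sheaf_XT: "is_function_sheaf XT" by (rule is_function_sheaf_pullback)

lemma manifold_XT: "complex_manifold XT"
proof (rule local_iso_manifold[OF local_iso_emb manifold])
  have h: "Top M homeomorphic_space T" using homeomorphic_map_imp_homeomorphic_space[OF emb_homeo] .
  show "Hausdorff_space (Top XT)"
    using homeomorphic_Hausdorff_space[OF h] complex_manifoldD(2)[OF manifold] by simp
  show "second_countable (Top XT)"
    using homeomorphic_space_second_countability[OF h] complex_manifoldD(3)[OF manifold] by simp
qed (simp_all add: topspace_T sheaf_XT)

lemma covering_fst: "covering_map T (Top Q) fst"
  unfolding covering_map_def
proof (intro conjI ballI)
  show "continuous_map T (Top Q) fst" by (rule fst_continuous)
  show im: "fst ` topspace T = points Q" unfolding topspace_T points_Q by (simp add: image_image)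
  fix w assume "w \<in> points Q"
  then obtain y where y: "y \<in> S" "w = orb y" using points_Q by blast
  obtain U where U: "openin (Top M) U" "y \<in> U" "\<And>k. k \<noteq> 0 \<Longrightarrow> iter k ` U \<inter> U = {}"
    by (rule free_nbhd[OF y(1)]) (rule that; assumption)
  have US: "U \<subseteq> S" using U(1) openin_M by blast
  let ?V = "range (\<lambda>k. emb ` iter k ` U)"
  have sub: "iter k ` U \<subseteq> S" for k using US iter_S by blast
  have orbk: "orb ` iter k ` U = orb ` U" for k
    using US orb_iter by (auto simp: image_image subset_iff intro!: image_cong)
  have free: "iter j ` iter k ` U \<inter> iter k ` U = {}" if "j \<noteq> 0" for j k
  proof (rule ccontr)
    assume "\<not> ?thesis"
    then obtain p q where pq: "p \<in> U" "q \<in> U" "iter j (iter k p) = iter k q" by auto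
    have pV: "p \<in> points V" "q \<in> points V" using pq US by auto
    have "iter j (iter k p) = iter k (iter j p)" using iter_add[OF pV(1), of j k] iter_add[OF pV(1), of k j] by (simp add: add.commute)
    then have e: "iter k (iter j p) = iter k q" using pq(3) by (simp only:)
    have "iter j p = iter (- k) (iter k (iter j p))" using iter_inverse(1)[OF iter_points[OF pV(1)]] by (rule sym)
    also have "\<dots> = q" unfolding e by (rule iter_inverse(1)[OF pV(2)])
    finally have "iter j p = q" .
    then show False using U(3)[OF that] pq by blast
  qed
  have inj: "inj_on fst (emb ` iter k ` U)" for k
    by (rule fst_inj[OF sub free_imp_inj[OF sub free]])
  have o: "openin T (emb ` iter k ` U)" for k using emb_open[OF iter_image_open[OF U(1)]] .
  have "\<Union>?V = {z\<in>topspace T. fst z \<in> orb ` U}"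
  proof -
    have "{z\<in>topspace T. fst z \<in> orb ` U} = emb ` {y\<in>S. orb y \<in> orb ` U}" unfolding topspace_T by auto
    also have "\<dots> = \<Union>?V" unfolding orb_saturation[OF US] by auto
    finally show ?thesis by simp
  qed
  moreover have "\<forall>W\<in>?V. openin T W" using o by auto
  moreover have "pairwise disjnt ?V"
  proof (rule pairwiseI)
    fix A B assume "A \<in> ?V" "B \<in> ?V" "A \<noteq> B"
    then obtain j k where jk: "A = emb ` iter j ` U" "B = emb ` iter k ` U" "j \<noteq> k" by auto
    have "iter j ` U \<inter> iter k ` U = {}"
    proof -
      have "iter (j - k) ` iter k ` U = iter j ` U"
      proof -
        have "iter (j - k) (iter k p) = iter j p" if "p \<in> U" for p
          using iter_add[of p "j - k" k] that US by auto
        then show ?thesis by (auto simp: image_image)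
      qed
      then show ?thesis using free[of "j - k" k] jk(3) by simp
    qed
    then show "disjnt A B" unfolding jk disjnt_iff using inj_onD[OF inj_emb] sub by blast
  qed
  moreover have "\<forall>W\<in>?V. homeomorphic_map (subtopology T W) (subtopology (Top Q) (orb ` U)) fst"
  proof
    fix W assume "W \<in> ?V"
    then obtain k where k: "W = emb ` iter k ` U" by blast
    have "fst ` W = orb ` U" using orbk[of k] unfolding k by (simp add: image_image)
    then show "homeomorphic_map (subtopology T W) (subtopology (Top Q) (orb ` U)) fst"
      using local_iso_homeo[OF local_iso_fst, of W] o inj unfolding k by simp
  qed
  ultimately show "\<exists>W. w \<in> W \<and> openin (Top Q) W \<and> (\<exists>\<V>. \<Union>\<V> = {z\<in>topspace T. fst z \<in> W} \<and> (\<forall>U\<in>\<V>. openin T U) \<and>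
       pairwise disjnt \<V> \<and> (\<forall>U\<in>\<V>. homeomorphic_map (subtopology T U) (subtopology (Top Q) W) fst))"
    using y U(2) orb_open[OF U(1)] by (intro exI[of _ "orb ` U"] conjI exI[of _ ?V]) auto
qed

text \<open>
  The action of the powers of \<open>\<gamma>\<close> on the copy of the punctured variety.
\<close>

definition shiftT :: "int \<Rightarrow> 'a set \<times> nat \<Rightarrow> 'a set \<times> nat" where
  "shiftT k z = emb (iter k (unemb z))"

lemma shiftT_emb: "y \<in> S \<Longrightarrow> shiftT k (emb y) = emb (iter k y)"
  by (simp add: shiftT_def)

lemma shiftT_points: "z \<in> topspace T \<Longrightarrow> shiftT k z \<in> topspace T \<and> fst (shiftT k z) = fst z"
  using iter_S orb_iter by (auto simp: topspace_T shiftT_emb)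

lemma shiftT_holomorphic: "holomorphic_map XT XT (shiftT k)"
  unfolding holomorphic_map_def pullback_structure_simps
proof (intro conjI allI impI)
  have "continuous_map (Top M) (Top M) (iter k)"
    unfolding continuous_map_def points_M using iter_S iter_preimage_open by auto
  from continuous_map_compose[OF continuous_map_compose[OF unemb_continuous this] emb_continuous]
  show "continuous_map T T (shiftT k)" by (simp add: o_def shiftT_def[abs_def])
  fix W f assume W: "openin T W \<and> f \<in> hol_fns XT W"
  let ?W = "{y\<in>S. emb y \<in> W}"
  have o: "openin (Top M) ?W" "emb ` ?W = W" using openin_T W by auto
  have "f \<circ> emb \<in> hol_fns V ?W"
    using local_iso_hol[OF local_iso_emb o(1), of f] inj_on_subset[OF inj_emb, of ?W] W o(2) by auto
  from iter_hol_fns[OF o(1) this, of k]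
  have f: "(\<lambda>y. (f \<circ> emb) (iter k y)) \<in> hol_fns M {y\<in>S. iter k y \<in> ?W}" by simp
  have o': "openin (Top M) {y\<in>S. iter k y \<in> ?W}" using iter_preimage_open[OF o(1)] .
  have "(f \<circ> shiftT k) \<circ> emb \<in> hol_fns M {y\<in>S. iter k y \<in> ?W}"
    by (rule sheaf_cong[OF sheaf_M o' f]) (simp add: shiftT_emb)
  then have "f \<circ> shiftT k \<in> hol_fns XT (emb ` {y\<in>S. iter k y \<in> ?W})"
    using local_iso_hol[OF local_iso_emb o', of "f \<circ> shiftT k"] inj_on_subset[OF inj_emb, of "{y\<in>S. iter k y \<in> ?W}"] by auto
  moreover have "emb ` {y\<in>S. iter k y \<in> ?W} = {z\<in>topspace T. shiftT k z \<in> W}"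
  proof -
    have "iter k y \<in> ?W \<longleftrightarrow> shiftT k (emb y) \<in> W" if "y \<in> S" for y
      using iter_S[OF that, of k] shiftT_emb[OF that, of k] by simp
    then show ?thesis unfolding topspace_T by blast
  qed
  ultimately show "f \<circ> shiftT k \<in> hol_fns XT {z\<in>topspace T. shiftT k z \<in> W}" by simp
qed

lemma same_fibre:
  assumes "z \<in> topspace T" "z' \<in> topspace T" "fst z = fst z'"
  obtains k where "z' = shiftT k z"
proof -
  obtain y y' where y: "y \<in> S" "z = emb y" "y' \<in> S" "z' = emb y'" using assms topspace_T by auto
  then have "orb y = orb y'" using assms(3) by simp
  then obtain k where "y' = iter k y" using orbit_eq_iff y by blast
  then show ?thesis using that[of k] y shiftT_emb by simp
qed

text \<open>
  The sets where \<open>g\<close> agrees with a given power of \<open>\<gamma>\<close> are open, since the projection is locally injective;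
  they are disjoint because the action is free; and they cover the space because \<open>g\<close> preserves fibres.
  A connected set lies in one of them.
\<close>

lemma deck_shift:
  assumes g: "deck_transformation T fst g" and K: "K \<in> connected_components_of T"
  obtains k N where "openin T N" "K \<subseteq> N" "\<And>z. z \<in> N \<Longrightarrow> g z = shiftT k z"
proof -
  define A where "A k = {z\<in>topspace T. g z = shiftT k z}" for k
  have gc: "continuous_map T T g" using g homeomorphic_imp_continuous_map by (auto simp: deck_transformation_def)
  have gT: "g z \<in> topspace T" "fst (g z) = fst z" if "z \<in> topspace T" for z
    using that g continuous_map_image_subset_topspace[OF gc] by (auto simp: deck_transformation_def)
  have sc: "continuous_map T T (shiftT k)" for k using shiftT_holomorphic by (simp add: holomorphic_map_def)
  have Ao: "openin T (A k)" for k
  proof (subst openin_subopen, intro ballI)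
    fix z assume z: "z \<in> A k"
    then have zT: "z \<in> topspace T" "g z = shiftT k z" by (auto simp: A_def)
    obtain U where U: "openin T U" "g z \<in> U" "inj_on fst U"
      using local_iso_injective_nbhd[OF local_iso_fst, of "topspace T" "g z"] gT(1)[OF zT(1)] by auto
    let ?N = "{w\<in>topspace T. g w \<in> U} \<inter> {w\<in>topspace T. shiftT k w \<in> U}"
    have "openin T ?N" using openin_continuous_map_preimage[OF gc U(1)] openin_continuous_map_preimage[OF sc U(1)] by blast
    moreover have "z \<in> ?N" using zT U(2) by simp
    moreover have "?N \<subseteq> A k"
    proof
      fix w assume w: "w \<in> ?N"
      then have "fst (g w) = fst (shiftT k w)" using gT(2) shiftT_points by auto
      then show "w \<in> A k" using inj_onD[OF U(3)] w by (auto simp: A_def)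
    qed
    ultimately show "\<exists>N. openin T N \<and> z \<in> N \<and> N \<subseteq> A k" by blast
  qed
  have cover: "\<exists>k. z \<in> A k" if z: "z \<in> topspace T" for z
  proof -
    obtain k where "g z = shiftT k z" using same_fibre[OF z gT(1)[OF z] gT(2)[OF z, symmetric]] .
    then show ?thesis using z by (auto simp: A_def)
  qed
  have disj: "A j \<inter> A k = {}" if "j \<noteq> k" for j k
  proof (rule ccontr)
    assume "\<not> ?thesis"
    then obtain z where "z \<in> A j" "z \<in> A k" by blast
    then have "z \<in> topspace T" "shiftT j z = shiftT k z" by (simp_all add: A_def)
    then obtain y where "y \<in> S" "shiftT j (emb y) = shiftT k (emb y)" unfolding topspace_T by blast
    then have y: "y \<in> S" "emb (iter j y) = emb (iter k y)" using shiftT_emb by simp_all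
    then have "iter j y = iter k y" using inj_onD[OF inj_emb] iter_S by blast
    then show False using iter_S_inj[OF y(1)] that by blast
  qed
  have KT: "K \<subseteq> topspace T" using connected_components_of_subset[OF K] .
  obtain z0 where z0: "z0 \<in> K" using nonempty_connected_components_of[OF K] by blast
  then obtain k where k: "z0 \<in> A k" using cover KT by blast
  let ?B = "\<Union>j\<in>UNIV - {k}. A j"
  have Bo: "openin T ?B" using Ao by blast
  have "connectedin T K" using connectedin_connected_components_of[OF K] .
  then have "\<not> (openin T (A k) \<and> openin T ?B \<and> K \<subseteq> A k \<union> ?B \<and> A k \<inter> ?B \<inter> K = {} \<and> A k \<inter> K \<noteq> {} \<and> ?B \<inter> K \<noteq> {})"
    unfolding connectedin by (elim conjE) (rule notI, elim conjE, erule notE, intro exI conjI)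
  moreover have "K \<subseteq> A k \<union> ?B"
  proof
    fix z assume "z \<in> K"
    then obtain j where "z \<in> A j" using cover KT by blast
    then show "z \<in> A k \<union> ?B" by (cases "j = k") auto
  qed
  moreover have "A k \<inter> ?B \<inter> K = {}" using disj by blast
  moreover have "A k \<inter> K \<noteq> {}" using k z0 by blast
  ultimately have e: "?B \<inter> K = {}" using Ao[of k] Bo by argo
  have "K \<subseteq> A k"
  proof
    fix z assume z: "z \<in> K"
    then obtain j where j: "z \<in> A j" using cover KT by blast
    show "z \<in> A k"
    proof (cases "j = k")
      case False
      then have "z \<in> ?B" using j by blast
      then show ?thesis using e z by blast
    qed (use j in simp)
  qed
  moreover have "g z = shiftT k z" if "z \<in> A k" for z using that by (simp add: A_def)
  ultimately show ?thesis using that[of "A k" k] Ao[of k] by blast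
qed

end

section \<open>From an automorphic potential to an LCK metric\<close>

locale automorphic_psh = invertible_contraction +
  fixes \<psi> :: "'a \<Rightarrow> real" and \<mu> :: real
  assumes \<mu>: "\<mu> > 0" and psh: "strictly_psh M \<psi>" and \<psi>_pos: "\<And>y. y \<in> S \<Longrightarrow> \<psi> y > 0"
    and \<psi>_iter: "\<And>y k. y \<in> S \<Longrightarrow> \<psi> (iter k y) = \<mu> powi k * \<psi> y"
begin

definition \<Psi> :: "'a set \<times> nat \<Rightarrow> real" where "\<Psi> z = \<psi> (unemb z)"

abbreviation "\<omega> \<equiv> ddc_form \<Psi>"

lemma \<Psi>_pos: assumes "z \<in> topspace T" shows "\<Psi> z > 0"
proof -
  obtain y where y: "y \<in> S" "z = emb y" using assms topspace_T by auto
  then show ?thesis using \<psi>_pos[OF y(1)] by (simp add: \<Psi>_def)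
qed

lemma \<Psi>_shift: assumes "z \<in> topspace T" shows "\<Psi> (shiftT k z) = \<mu> powi k * \<Psi> z"
proof -
  obtain y where y: "y \<in> S" "z = emb y" using assms topspace_T by auto
  then show ?thesis using iter_S[OF y(1), of k] \<psi>_iter[OF y(1), of k] by (simp add: \<Psi>_def shiftT_emb)
qed

lemma psh_\<Psi>: "strictly_psh XT \<Psi>"
  by (rule strictly_psh_local_iso[OF local_iso_emb _ _ sheaf_M psh])
     (simp_all add: inj_emb topspace_T \<Psi>_def)

lemma gen_smooth_\<Psi>: "c \<in> charts XT \<Longrightarrow> gen_smooth (cdim c) (cimage c) (\<Psi> \<circ> cinv c)"
  using psh_\<Psi> by (auto simp: strictly_psh_def smooth_potential_def)

lemma smooth_\<Psi>: "smooth_potential XT \<Psi>" using psh_\<Psi> by (simp add: strictly_psh_def)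

lemma chart_subset_T: "c \<in> charts XT \<Longrightarrow> cdom c \<subseteq> topspace T"
  using openin_subset[OF local_model_open[OF chartsD(1)]] by fastforce

lemma \<Psi>_cinv_pos: assumes "c \<in> charts XT" "z \<in> cimage c" shows "(\<Psi> \<circ> cinv c) z > 0"
proof -
  have "cinv c z \<in> topspace T" using cinv_in[OF chartsD(1)[OF assms(1)] assms(2)] chart_subset_T[OF assms(1)] by blast
  then show ?thesis using \<Psi>_pos by simp
qed

lemma smooth_inverse_\<Psi>: "smooth_function XT (\<lambda>z. inverse (\<Psi> z))"
proof (rule smooth_potential_imp_smooth_function, unfold smooth_potential_def, intro ballI)
  fix c assume c: "c \<in> charts XT"
  from gen_smooth_inverse[OF gen_smooth_\<Psi>[OF c] \<Psi>_cinv_pos[OF c]]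
  show "gen_smooth (cdim c) (cimage c) ((\<lambda>z. inverse (\<Psi> z)) \<circ> cinv c)" by (simp add: o_def)
qed

text \<open>
  Powers of \<open>\<gamma>\<close> act by homotheties because \<open>\<Psi>\<close> is automorphic and \<open>ddc\<close> commutes with holomorphic
  substitutions.
\<close>

lemma omega_pullback:
  assumes c: "c \<in> charts XT" and d: "d \<in> charts XT" and y: "y \<in> cdom c" "F y \<in> cdom d"
    and N: "openin T N" "y \<in> N" "\<And>w. w \<in> N \<Longrightarrow> F w = shiftT k w"
    and uv: "u \<in> Cn (cdim c)" "v \<in> Cn (cdim c)"
  shows "\<mu> powi k * \<omega> c (coord c y) u v = \<omega> d (coord d (F y)) (push F c d (coord c y) u) (push F c d (coord c y) v)"
proof -
  have N': "openin (Top XT) N" using N(1) by simp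
  have "ddc_form (\<lambda>w. \<mu> powi k * \<Psi> w) c (coord c y) u v =
      \<omega> d (coord d (F y)) (push F c d (coord c y) u) (push F c d (coord c y) v)"
  proof (rule ddc_form_pullback[where F = F and F' = "shiftT k", OF sheaf_XT smooth_\<Psi> c d y shiftT_holomorphic N' N(2,3) uv])
    fix w assume w: "w \<in> N"
    then have "w \<in> topspace T" using openin_subset[OF N(1)] by blast
    then show "\<mu> powi k * \<Psi> w = \<Psi> (F w)" using \<Psi>_shift N(3)[OF w] by simp
  qed
  moreover have "ddc_form (\<lambda>w. \<mu> powi k * \<Psi> w) c (coord c y) u v = \<mu> powi k * \<omega> c (coord c y) u v"
    using ddc_cmult[OF gen_smooth_\<Psi>[OF c] coord_in[OF chartsD(1)[OF c] y(1)] uv]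
    by (simp add: ddc_form_def o_def)
  ultimately show ?thesis by simp
qed

lemma kaehler_covering_T: "kaehler_covering Q T fst \<omega>"
  unfolding kaehler_covering_def
proof (intro conjI allI impI ballI)
  show "covering_map T (Top Q) fst" by (rule covering_fst)
  show "complex_manifold XT" by (rule manifold_XT)
  show "kaehler_metric XT \<omega>" by (rule kaehler_metric_ddc_form(1)[OF sheaf_XT psh_\<Psi>])
  fix g K assume g: "deck_transformation T fst g" and K: "K \<in> connected_components_of T"
  obtain k N where N: "openin T N" "K \<subseteq> N" "\<And>z. z \<in> N \<Longrightarrow> g z = shiftT k z"
    by (rule deck_shift[OF g K]) (rule that; assumption)
  have "is_pullback_on K XT XT g (mult_form (\<lambda>_. \<mu> powi k) \<omega>) \<omega>"
    unfolding is_pullback_on_def mult_form_def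
    using omega_pullback[OF _ _ _ _ N(1) _ N(3)] N(2) by blast
  then show "\<exists>a>0. is_pullback_on K XT XT g (mult_form (\<lambda>_. a) \<omega>) \<omega>"
    using \<mu> by (intro exI[of _ "\<mu> powi k"]) simp
qed

lemma automorphic_potential_T: "automorphic_potential Q T fst \<omega> \<Psi>"
  unfolding automorphic_potential_def
proof (intro conjI allI impI ballI)
  show "kaehler_potential XT \<omega> \<Psi>" by (rule kaehler_metric_ddc_form(2)[OF sheaf_XT psh_\<Psi>])
  show "\<Psi> z > 0" if "z \<in> topspace T" for z using \<Psi>_pos[OF that] .
  fix g K assume g: "deck_transformation T fst g" and K: "K \<in> connected_components_of T"
  obtain k N where N: "openin T N" "K \<subseteq> N" "\<And>z. z \<in> N \<Longrightarrow> g z = shiftT k z"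
    by (rule deck_shift[OF g K]) (rule that; assumption)
  have "\<Psi> (g z) = \<mu> powi k * \<Psi> z" if "z \<in> K" for z
    using that N \<Psi>_shift openin_subset[OF N(1)] by (metis subsetD)
  then show "\<exists>a. \<forall>z\<in>K. \<Psi> (g z) = a * \<Psi> z" by blast
qed

subsection \<open>The metric on the quotient\<close>

text \<open>
  The chart of the covering obtained from a chart of the quotient on a sheet \<open>U\<close>.
\<close>

definition lift :: "'a set chart \<Rightarrow> ('a set \<times> nat) set \<Rightarrow> ('a set \<times> nat) chart" where
  "lift d U = (cdim d, U, \<lambda>z. coord d (fst z))"

definition section_point :: "'a set \<Rightarrow> 'a set \<times> nat" where
  "section_point w = (SOME z. z \<in> topspace T \<and> fst z = w)"

definition section_nbhd :: "'a set chart \<Rightarrow> 'a set \<times> nat \<Rightarrow> ('a set \<times> nat) set" where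
  "section_nbhd d y = (SOME U. openin T U \<and> y \<in> U \<and> fst ` U \<subseteq> cdom d \<and> inj_on fst U)"

text \<open>
  The form \<open>\<Psi>\<^sup>-\<^sup>1 ddc \<Psi>\<close> on the covering is invariant, so its value on the quotient can be read off on any
  sheet. The definition chooses a preimage and a sheet separately for every point; by \<open>eta_pullback\<close> the
  result does not depend on the choices, and therefore \<open>eta_lift\<close> computes it on one sheet near a point.
\<close>

definition \<eta> :: "'a set form2" where
  "\<eta> d z u v = inverse (\<Psi> (section_point (cinv d z))) * \<omega> (lift d (section_nbhd d (section_point (cinv d z)))) z u v"

lemma lift_nbhd:
  assumes d: "d \<in> charts Q" and y: "y \<in> topspace T" "fst y \<in> cdom d"
  shows "\<exists>U. openin T U \<and> y \<in> U \<and> fst ` U \<subseteq> cdom d \<and> inj_on fst U"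
proof -
  have o: "openin (Top XT) {z\<in>points XT. fst z \<in> cdom d}"
    using local_iso_preimage[OF local_iso_fst local_model_open[OF chartsD(1)[OF d]]] .
  obtain U where "openin (Top XT) U" "y \<in> U" "U \<subseteq> {z\<in>points XT. fst z \<in> cdom d}" "inj_on fst U"
    using local_iso_injective_nbhd[OF local_iso_fst o, of y] y by auto
  then show ?thesis by (intro exI[of _ U]) auto
qed

lemma lift_props:
  assumes d: "d \<in> charts Q" and U: "openin T U" "fst ` U \<subseteq> cdom d" "inj_on fst U"
  shows "lift d U \<in> charts XT" "cdim (lift d U) = cdim d" "cdom (lift d U) = U" "coord (lift d U) = (\<lambda>z. coord d (fst z))"
    "cimage (lift d U) \<subseteq> cimage d" "w \<in> cimage (lift d U) \<Longrightarrow> fst (cinv (lift d U) w) = cinv d w"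
proof -
  show l: "lift d U \<in> charts XT" unfolding lift_def
    using lift_chart(1)[OF local_iso_fst sheaf_XT d _ U(2,3)] U(1) by simp
  show s: "cdim (lift d U) = cdim d" "cdom (lift d U) = U" "coord (lift d U) = (\<lambda>z. coord d (fst z))"
    by (simp_all add: lift_def)
  show "cimage (lift d U) \<subseteq> cimage d" using U(2) by (auto simp: lift_def cimage_def)
  assume w: "w \<in> cimage (lift d U)"
  have "cinv (lift d U) w \<in> U" using cinv_in[OF chartsD(1)[OF l] w] s by simp
  moreover have "coord d (fst (cinv (lift d U) w)) = w" using coord_cinv[OF chartsD(1)[OF l] w] s by simp
  ultimately show "fst (cinv (lift d U) w) = cinv d w"
    using cinv_coord[OF chartsD(1)[OF d], of "fst (cinv (lift d U) w)"] U(2) by auto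
qed

text \<open>
  The preimage chosen in the definition of \<open>\<eta>\<close> is \<open>shiftT k y\<close> for some \<open>k\<close>; the factors \<open>\<mu> powi k\<close> of \<open>\<Psi>\<close> and of
  \<open>\<omega>\<close> cancel, and \<open>shiftT k\<close> does not change the projection.
\<close>

lemma eta_pullback:
  assumes d: "d \<in> charts Q" and c: "c \<in> charts XT" and y: "y \<in> cdom c" "fst y \<in> cdom d"
    and uv: "u \<in> Cn (cdim c)" "v \<in> Cn (cdim c)"
  shows "inverse (\<Psi> y) * \<omega> c (coord c y) u v =
    \<eta> d (coord d (fst y)) (push fst c d (coord c y) u) (push fst c d (coord c y) v)"
proof -
  let ?w = "cinv d (coord d (fst y))"
  have w: "?w = fst y" using cinv_coord[OF chartsD(1)[OF d] y(2)] .
  have yT: "y \<in> topspace T" using chart_subset_T[OF c] y(1) by blast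
  define y1 where "y1 = section_point (fst y)"
  have "\<exists>z. z \<in> topspace T \<and> fst z = fst y" using yT by blast
  from someI_ex[OF this] have y1: "y1 \<in> topspace T" "fst y1 = fst y" by (auto simp: y1_def section_point_def)
  define U where "U = section_nbhd d y1"
  have "fst y1 \<in> cdom d" using y1 y by simp
  from someI_ex[OF lift_nbhd[OF d y1(1) this]]
  have U: "openin T U" "y1 \<in> U" "fst ` U \<subseteq> cdom d" "inj_on fst U" by (auto simp: U_def section_nbhd_def)
  note L = lift_props[OF d U(1,3,4)]
  obtain k where k: "y1 = shiftT k y" using same_fibre[OF yT y1(1) y1(2)[symmetric]] .
  have \<eta>: "\<eta> d (coord d (fst y)) u v = inverse (\<Psi> y1) * \<omega> (lift d U) (coord d (fst y)) u v" for u v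
    unfolding \<eta>_def w y1_def[symmetric] U_def[symmetric] ..
  have "shiftT k y \<in> cdom (lift d U)" using U(2) k L(3) by simp
  from omega_pullback[where F = "shiftT k" and k = k, OF c L(1) y(1) this openin_topspace yT refl uv]
  have p: "\<mu> powi k * \<omega> c (coord c y) u v = \<omega> (lift d U) (coord d (fst y))
     (push (shiftT k) c (lift d U) (coord c y) u) (push (shiftT k) c (lift d U) (coord c y) v)"
    using k y1(2) L(4) by simp
  have "push (shiftT k) c (lift d U) (coord c y) u = push fst c d (coord c y) u" if u: "u \<in> Cn (cdim c)" for u
    unfolding push_def L(4)
  proof
    fix j
    show "dir_deriv u (\<lambda>w. coord d (fst (shiftT k (cinv c w))) j) (coord c y) = dir_deriv u (\<lambda>w. coord d (fst (cinv c w)) j) (coord c y)"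
    proof (rule dir_deriv_cong[OF chartsD(2)[OF c] coord_in[OF chartsD(1)[OF c] y(1)] u])
      fix w assume "w \<in> cimage c"
      then have "cinv c w \<in> topspace T" using cinv_in[OF chartsD(1)[OF c]] chart_subset_T[OF c] by blast
      then show "coord d (fst (shiftT k (cinv c w))) j = coord d (fst (cinv c w)) j" using shiftT_points by simp
    qed
  qed
  then have "\<eta> d (coord d (fst y)) (push fst c d (coord c y) u) (push fst c d (coord c y) v) = inverse (\<Psi> y1) * (\<mu> powi k * \<omega> c (coord c y) u v)"
    unfolding \<eta> p using uv by simp
  also have "\<Psi> y1 = \<mu> powi k * \<Psi> y" using \<Psi>_shift[OF yT] k by simp
  finally show ?thesis using \<mu> by (simp add: field_simps)
qed

lemma push_lift:
  assumes d: "d \<in> charts Q" and U: "openin T U" "fst ` U \<subseteq> cdom d" "inj_on fst U"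
    and z: "z \<in> cimage (lift d U)" and u: "u \<in> Cn (cdim d)"
  shows "push fst (lift d U) d' z u = push id d d' z u" "push fst (lift d U) d z u = u"
proof -
  note L = lift_props[OF d U]
  have u': "u \<in> Cn (cdim (lift d U))" using u L(2) by simp
  note o = chartsD(2)[OF L(1)]
  have *: "push fst (lift d U) d' z u = push id d d' z u" for d' :: "'a set chart"
    unfolding push_def
  proof
    fix j
    show "dir_deriv u (\<lambda>w. coord d' (fst (cinv (lift d U) w)) j) z = dir_deriv u (\<lambda>w. coord d' (id (cinv d w)) j) z"
      by (rule dir_deriv_cong[OF o z u']) (simp add: L(6))
  qed
  then show "push fst (lift d U) d' z u = push id d d' z u" .
  have "dir_deriv u (\<lambda>w. coord d (id (cinv d w)) j) z = u j" for j
  proof -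
    have "dir_deriv u (\<lambda>w. coord d (id (cinv d w)) j) z = dir_deriv u (\<lambda>w. w j) z"
      using z L(5) coord_cinv[OF chartsD(1)[OF d]] by (intro dir_deriv_cong[OF chartsD(2)[OF d] _ u]) auto
    then show ?thesis by (simp add: dir_deriv_coord)
  qed
  then show "push fst (lift d U) d z u = u" unfolding * by (simp add: push_def)
qed

lemma eta_lift:
  assumes d: "d \<in> charts Q" and U: "openin T U" "fst ` U \<subseteq> cdom d" "inj_on fst U"
    and z: "z \<in> cimage (lift d U)" and uv: "u \<in> Cn (cdim d)" "v \<in> Cn (cdim d)"
  shows "\<eta> d z u v = inverse ((\<Psi> \<circ> cinv (lift d U)) z) * ddc (\<Psi> \<circ> cinv (lift d U)) z u v"
proof -
  note L = lift_props[OF d U]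
  note lm = chartsD(1)[OF L(1)]
  have y: "cinv (lift d U) z \<in> cdom (lift d U)" using cinv_in[OF lm z] .
  have c: "coord (lift d U) (cinv (lift d U) z) = z" using coord_cinv[OF lm z] .
  then have c': "coord d (fst (cinv (lift d U) z)) = z" using L(4) by simp
  have "fst (cinv (lift d U) z) \<in> cdom d" using y L(3) U(2) by auto
  from eta_pullback[OF d L(1) y this, of u v]
  have "inverse (\<Psi> (cinv (lift d U) z)) * \<omega> (lift d U) z u v = \<eta> d z (push fst (lift d U) d z u) (push fst (lift d U) d z v)"
    unfolding c c' using uv L(2) by simp
  then show ?thesis using push_lift(2)[OF d U z] uv by (simp add: ddc_form_def)
qed

lemma lift_cover:
  assumes d: "d \<in> charts Q" and z: "z \<in> cimage d"
  obtains U where "openin T U" "fst ` U \<subseteq> cdom d" "inj_on fst U" "z \<in> cimage (lift d U)"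
proof -
  have w: "cinv d z \<in> cdom d" using cinv_in[OF chartsD(1)[OF d] z] .
  then have "cinv d z \<in> points Q" using openin_subset[OF local_model_open[OF chartsD(1)[OF d]]] by blast
  then obtain s where "s \<in> S" "cinv d z = orb s" unfolding points_Q by blast
  then have y: "emb s \<in> topspace T" "fst (emb s) = cinv d z" by (auto simp: topspace_T)
  then obtain U where U: "openin T U" "emb s \<in> U" "fst ` U \<subseteq> cdom d" "inj_on fst U"
    using lift_nbhd[OF d y(1)] w by auto
  have "z = coord d (fst (emb s))" using y(2) coord_cinv[OF chartsD(1)[OF d] z] by simp
  then have "z \<in> cimage (lift d U)" using U(2) unfolding lift_def cimage_tuple by blast
  then show ?thesis using that U by blast
qed

lemma hermitian_eta: "hermitian_metric Q \<eta>"
proof -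
  have sm: "gen_smooth (cdim d) (cimage (lift d U)) (\<Psi> \<circ> cinv (lift d U))"
    and pos: "z \<in> cimage (lift d U) \<Longrightarrow> (\<Psi> \<circ> cinv (lift d U)) z > 0"
    and lev: "z \<in> cimage (lift d U) \<Longrightarrow> u \<in> Cn (cdim d) \<Longrightarrow> u \<noteq> (\<lambda>_. 0) \<Longrightarrow> levi (\<Psi> \<circ> cinv (lift d U)) z u > 0"
    if d: "d \<in> charts Q" and U: "openin T U" "fst ` U \<subseteq> cdom d" "inj_on fst U" for d U z u
  proof -
    note L = lift_props[OF d U]
    show "gen_smooth (cdim d) (cimage (lift d U)) (\<Psi> \<circ> cinv (lift d U))" using gen_smooth_\<Psi>[OF L(1)] L(2) by simp
    show "z \<in> cimage (lift d U) \<Longrightarrow> (\<Psi> \<circ> cinv (lift d U)) z > 0"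
      by (rule \<Psi>_cinv_pos[OF L(1)])
    show "z \<in> cimage (lift d U) \<Longrightarrow> u \<in> Cn (cdim d) \<Longrightarrow> u \<noteq> (\<lambda>_. 0) \<Longrightarrow> levi (\<Psi> \<circ> cinv (lift d U)) z u > 0"
      using psh_\<Psi> L(1,2) unfolding strictly_psh_def by metis
  qed
  have "smooth_form2 Q \<eta>"
    unfolding smooth_form2_def
  proof (intro conjI ballI allI)
    fix d u v assume d: "d \<in> charts Q" and uv: "u \<in> Cn (cdim d)" "v \<in> Cn (cdim d)"
    have "gen_smooth (cdim d) (cimage d) (\<lambda>z. \<eta> d z u v)"
    proof (rule gen_smooth.local[OF chartsD(2)[OF d]])
      fix z assume "z \<in> cimage d"
      then obtain U where U: "openin T U" "fst ` U \<subseteq> cdom d" "inj_on fst U" "z \<in> cimage (lift d U)"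
        using lift_cover[OF d] by blast
      let ?f = "\<Psi> \<circ> cinv (lift d U)"
      have "gen_smooth (cdim d) (cimage (lift d U)) (\<lambda>z. inverse (?f z) * ddc ?f z u v)"
        by (intro gen_smooth.mult gen_smooth_inverse gen_smooth_ddc sm[OF d U(1-3)] pos[OF d U(1-3)] uv)
      moreover have "\<forall>w\<in>cimage (lift d U). inverse (?f w) * ddc ?f w u v = \<eta> d w u v"
        using eta_lift[OF d U(1-3) _ uv] by simp
      ultimately show "\<exists>W g. z \<in> W \<and> W \<subseteq> cimage d \<and> gen_smooth (cdim d) W g \<and> (\<forall>w\<in>W. g w = \<eta> d w u v)"
        using U(4) lift_props(5)[OF d U(1-3)]
        by (intro exI[of _ "cimage (lift d U)"] exI[of _ "\<lambda>z. inverse (?f z) * ddc ?f z u v"]) simp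
    qed
    then show "smooth_Cn (cdim d) (cimage d) (\<lambda>z. \<eta> d z u v)" by (rule gen_smooth_imp_smooth_Cn)
  next
    fix d z u v assume d: "d \<in> charts Q" and z: "z \<in> cimage d" and uv: "u \<in> Cn (cdim d)" "v \<in> Cn (cdim d)"
    obtain U where U: "openin T U" "fst ` U \<subseteq> cdom d" "inj_on fst U" "z \<in> cimage (lift d U)"
      using lift_cover[OF d z] .
    note e = eta_lift[OF d U] and l = ddc_linear[OF sm[OF d U(1-3)] U(4) uv]
    show "\<eta> d z v u = - \<eta> d z u v" using e uv ddc_skew[of "\<Psi> \<circ> cinv (lift d U)" z v u] by simp
    show "\<eta> d z (add_cvec u w) v = \<eta> d z u v + \<eta> d z w v" if "w \<in> Cn (cdim d)" for w
      using e uv that l(1)[OF that] by (simp add: distrib_left)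
    show "\<eta> d z (scale_cvec (of_real a) u) v = a * \<eta> d z u v" for a
      using e uv l(2)[of a] by simp
  next
    show "is_pullback_on (points Q) Q Q id \<eta> \<eta>"
      unfolding is_pullback_on_def
    proof (intro ballI impI)
      fix d d' w u v assume d: "d \<in> charts Q" and d': "d' \<in> charts Q" and w: "w \<in> points Q \<inter> cdom d" "id w \<in> cdom d'"
        and uv: "u \<in> Cn (cdim d)" "v \<in> Cn (cdim d)"
      let ?z = "coord d w"
      have z: "?z \<in> cimage d" "cinv d ?z = w" using coord_in[OF chartsD(1)[OF d]] cinv_coord[OF chartsD(1)[OF d]] w by auto
      obtain U where U: "openin T U" "fst ` U \<subseteq> cdom d" "inj_on fst U" "?z \<in> cimage (lift d U)"
        using lift_cover[OF d z(1)] .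
      note L = lift_props[OF d U(1-3)]
      let ?y = "cinv (lift d U) ?z"
      have y: "?y \<in> cdom (lift d U)" "coord (lift d U) ?y = ?z" "fst ?y = w"
        using cinv_in[OF chartsD(1)[OF L(1)] U(4)] coord_cinv[OF chartsD(1)[OF L(1)] U(4)] L(6)[OF U(4)] z(2) by simp_all
      have "fst ?y \<in> cdom d'" using y(3) w(2) by simp
      from eta_pullback[OF d' L(1) y(1) this, of u v]
      have "inverse (\<Psi> ?y) * \<omega> (lift d U) ?z u v = \<eta> d' (coord d' w) (push id d d' ?z u) (push id d d' ?z v)"
        unfolding y using push_lift(1)[OF d U] uv L(2) by simp
      then show "\<eta> d (coord d w) u v = \<eta> d' (coord d' (id w)) (push id d d' (coord d w) u) (push id d d' (coord d w) v)"
        using eta_lift[OF d U uv] by (simp add: ddc_form_def)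
    qed
  qed
  then show ?thesis
    unfolding hermitian_metric_def
  proof (intro conjI ballI impI)
    fix d z u assume d: "d \<in> charts Q" and z: "z \<in> cimage d" and u: "u \<in> Cn (cdim d)"
    obtain U where U: "openin T U" "fst ` U \<subseteq> cdom d" "inj_on fst U" "z \<in> cimage (lift d U)"
      using lift_cover[OF d z] .
    note e = eta_lift[OF d U]
    show "\<eta> d z (iscale u) (iscale v) = \<eta> d z u v" if "v \<in> Cn (cdim d)" for v
      using e u that ddc_invariant[OF sm[OF d U(1-3)] U(4) u that] by simp
    show "\<eta> d z u (iscale u) > 0" if "u \<noteq> (\<lambda>_. 0)"
      using e u pos[OF d U] lev[OF d U u that] by (simp add: levi_def)
  qed
qed

lemma admits_lck: "admits_lck_metric_with_potential Q"
proof -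
  have "is_pullback_on (topspace T) XT Q fst (mult_form (\<lambda>z. inverse (\<Psi> z)) \<omega>) \<eta>"
    unfolding is_pullback_on_def mult_form_def
  proof (intro ballI impI)
    fix c d y u v
    assume c: "c \<in> charts XT" and d: "d \<in> charts Q" and y: "y \<in> topspace T \<inter> cdom c" "fst y \<in> cdom d"
      and uv: "u \<in> Cn (cdim c)" "v \<in> Cn (cdim c)"
    then have "y \<in> cdom c" by blast
    from eta_pullback[OF d c this y(2) uv] cinv_coord[OF chartsD(1)[OF c] this]
    show "inverse (\<Psi> (cinv c (coord c y))) * \<omega> c (coord c y) u v =
      \<eta> d (coord d (fst y)) (push fst c d (coord c y) u) (push fst c d (coord c y) v)" by simp
  qed
  moreover have "\<forall>z\<in>topspace T. inverse (\<Psi> z) > 0" using \<Psi>_pos by simp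
  ultimately have "lck_metric_with_potential Q \<eta>"
    unfolding lck_metric_with_potential_def
    using hermitian_eta kaehler_covering_T automorphic_potential_T smooth_inverse_\<Psi> by blast
  then show ?thesis unfolding admits_lck_metric_with_potential_def using manifold_Q by blast
qed

end

theorem corollary3p2:
  fixes V :: "'a complex_space" and x :: 'a and \<gamma> :: "'a \<Rightarrow> 'a"
  assumes "stein_variety V"
    and "x \<in> points V"
    and "holomorphic_contraction V x \<gamma>"
    and "biholomorphic_map V V \<gamma>"
    and "properly_discontinuous (subtopology (Top V) (points V - {x}))
           (cyclic_group (points V - {x}) \<gamma>)"
    and "complex_manifold (open_subspace V (points V - {x}))"
  shows "admits_lck_metric_with_potential
           (quotient_space (open_subspace V (points V - {x})) (cyclic_group (points V - {x}) \<gamma>))"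
proof -
  obtain \<delta> where \<delta>: "holomorphic_map V V \<delta>" "\<forall>y\<in>points V. \<delta> (\<gamma> y) = y" "\<forall>y\<in>points V. \<gamma> (\<delta> y) = y"
    using assms(4) by (auto simp: biholomorphic_map_def)
  have V: "complex_variety V" using assms(1) by (simp add: stein_variety_def)
  interpret invertible_contraction V x \<gamma> \<delta>
    using V assms \<delta> by unfold_locales auto
  obtain c where c: "local_model V c" "x \<in> cdom c" using V assms(2) by (auto simp: complex_variety_def)
  obtain r where r: "r > 0" "compactin (Top V) {w\<in>cdom c. chart_norm c x w \<le> r}"
    using local_model_compact_nbhd[OF c] .
  interpret contraction_chart V x \<gamma> \<delta> c r using c r by unfold_locales
  obtain \<psi> \<mu> where "\<mu> > 0" "strictly_psh M \<psi>" "\<forall>y\<in>S. \<psi> y > 0" "\<forall>k. \<forall>y\<in>S. \<psi> (iter k y) = \<mu> powi k * \<psi> y"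
    using exists_automorphic_potential by blast
  then interpret automorphic_psh V x \<gamma> \<delta> \<psi> \<mu> by unfold_locales auto
  show ?thesis by (rule admits_lck)
qed

end
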